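(* Let $(X_n)$ be a bounded geometry sequence of distance transitive scaled finite graphs and suppose that the number of vertices $|X_n|\to\infty$. Then $(X_n)$ converges to $S^1$ with the length distance. In particular, for every $\epsilon>0$, $E(\epsilon,X_n)\to 1/\epsilon$.
   Context: A scaled finite graph is the vertex set of a finite connected graph with the graph distance rescaled so that the diameter is $1$; correspondingly, the circle $S^1$ with its length distance is taken with diameter $1$ (total length $2$). A graph is distance transitive if its automorphism group acts transitively on pairs of vertices of any given distance. Convergence is in the Gromov--Hausdorff topology. For a compact metric space $Y$ and $\epsilon>0$, $E(\epsilon,Y)$ denotes the $\epsilon$-entropy of $Y$, i.e. the least integer $N$ such that any subset of $Y$ of size $N+1$ contains two distinct points at distance at most $\epsilon$. A family of compact metric spaces has bounded geometry if there is a non-increasing function $E:\mathbb{R}^{+}\to\mathbb{N}$ such that $E(\epsilon,Y)\le E(\epsilon)$ for every $Y$ in the family and every $\epsilon>0$.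
   Formalization: The claim E(ε,X_n)→1/ε is false (even cycles, ε=1/2: limit 3); it is replaced by E(ε,X_n)→E(ε,S^1) for every ε>0 not of the form 2/k with k≥3, and 2/ε−1 ≤ E(ε,X_n) ≤ 2/ε for all large n when 0<ε≤1. *)

theory Defs
  imports "HOL-Analysis.Analysis" "Graph_Theory.Graph_Theory"
begin

(* Metric spaces are given by a carrier M and a distance function d, as in the locale
   Metric_space. *)

definition hausdorff_dist :: "('c \<Rightarrow> 'c \<Rightarrow> real) \<Rightarrow> 'c set \<Rightarrow> 'c set \<Rightarrow> real" where
  "hausdorff_dist d A B = max (SUP a\<in>A. INF b\<in>B. d a b) (SUP b\<in>B. INF a\<in>A. d a b)"

definition isometric_embedding ::
    "'a set \<Rightarrow> ('a \<Rightarrow> 'a \<Rightarrow> real) \<Rightarrow> 'c set \<Rightarrow> ('c \<Rightarrow> 'c \<Rightarrow> real) \<Rightarrow> ('a \<Rightarrow> 'c) \<Rightarrow> bool" where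
  "isometric_embedding M d Z \<delta> f \<longleftrightarrow>
     f ` M \<subseteq> Z \<and> (\<forall>x\<in>M. \<forall>y\<in>M. \<delta> (f x) (f y) = d x y)"

(* The ambient space Z ranges over metric spaces with points in the sum type.  This is no
   restriction: only f ` M \<union> g ` N matters, and it injects into 'a + 'b.  The infimum is
   meaningful for nonempty bounded spaces. *)
definition GH_dist ::
    "'a set \<Rightarrow> ('a \<Rightarrow> 'a \<Rightarrow> real) \<Rightarrow> 'b set \<Rightarrow> ('b \<Rightarrow> 'b \<Rightarrow> real) \<Rightarrow> real" where
  "GH_dist M d N e =
     Inf {hausdorff_dist \<delta> (f ` M) (g ` N) | (Z :: ('a + 'b) set) \<delta> f g.
            Metric_space Z \<delta> \<and> isometric_embedding M d Z \<delta> f \<and> isometric_embedding N e Z \<delta> g}"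

definition entropy :: "real \<Rightarrow> 'a set \<Rightarrow> ('a \<Rightarrow> 'a \<Rightarrow> real) \<Rightarrow> nat" where
  "entropy \<epsilon> M d =
     (LEAST N. \<forall>S\<subseteq>M. card S = N + 1 \<longrightarrow> (\<exists>x\<in>S. \<exists>y\<in>S. x \<noteq> y \<and> d x y \<le> \<epsilon>))"

definition bounded_geometry :: "('i \<Rightarrow> 'a set) \<Rightarrow> ('i \<Rightarrow> 'a \<Rightarrow> 'a \<Rightarrow> real) \<Rightarrow> bool" where
  "bounded_geometry M d \<longleftrightarrow>
     (\<exists>E :: real \<Rightarrow> nat. antimono_on {0<..} E \<and> (\<forall>i. \<forall>\<epsilon>>0. entropy \<epsilon> (M i) (d i) \<le> E \<epsilon>))"

definition graph_dist :: "'a pair_pre_digraph \<Rightarrow> 'a \<Rightarrow> 'a \<Rightarrow> real" where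
  "graph_dist G u v = real_of_ereal (wf_digraph.\<mu> (with_proj G) (\<lambda>_. 1) u v)"

definition graph_diameter :: "'a pair_pre_digraph \<Rightarrow> real" where
  "graph_diameter G = Max {graph_dist G u v | u v. u \<in> pverts G \<and> v \<in> pverts G}"

definition scaled_dist :: "'a pair_pre_digraph \<Rightarrow> 'a \<Rightarrow> 'a \<Rightarrow> real" where
  "scaled_dist G u v = graph_dist G u v / graph_diameter G"

(* The locale pair_graph describes finite simple undirected graphs (symmetric arc relation,
   no loops).  A one-vertex graph cannot be rescaled to have diameter 1. *)
definition scaled_finite_graph :: "'a pair_pre_digraph \<Rightarrow> bool" where
  "scaled_finite_graph G \<longleftrightarrow>
     pair_graph G \<and> Digraph_Component.connected (with_proj G) \<and> card (pverts G) \<ge> 2"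

definition graph_automorphism :: "'a pair_pre_digraph \<Rightarrow> ('a \<Rightarrow> 'a) \<Rightarrow> bool" where
  "graph_automorphism G \<phi> \<longleftrightarrow>
     (\<exists>hom. pre_digraph.digraph_isomorphism (with_proj G) hom \<and>
            app_iso hom (with_proj G) = with_proj G \<and> iso_verts hom = \<phi>)"

definition distance_transitive :: "'a pair_pre_digraph \<Rightarrow> bool" where
  "distance_transitive G \<longleftrightarrow>
     (\<forall>u\<in>pverts G. \<forall>v\<in>pverts G. \<forall>u'\<in>pverts G. \<forall>v'\<in>pverts G.
        graph_dist G u v = graph_dist G u' v' \<longrightarrow>
        (\<exists>\<phi>. graph_automorphism G \<phi> \<and> \<phi> u = u' \<and> \<phi> v = v'))"

abbreviation circle :: "complex set" where
  "circle \<equiv> sphere 0 1"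

(* For z, w on the unit circle, the absolute value of Arg (w / z) is the length of the shorter
   arc from z to w; dividing by pi gives diameter 1 and total length 2. *)
definition circle_dist :: "complex \<Rightarrow> complex \<Rightarrow> real" where
  "circle_dist z w = \<bar>Arg (w / z)\<bar> / pi"

end

theory Submission
  imports Defs "HOL-Library.Ramsey"
begin

text \<open>
  Let G be one of the graphs, with diameter D.  Bounded geometry bounds |G| by a constant times
  the size of a ball of radius D/100, and |G| tending to infinity forces D to do so as well.

  The averaging operator over balls of radius comparable to D has a non-trivial eigenvalue which
  is not small compared to its Hilbert--Schmidt norm, so the eigenspace has bounded dimension.
  Its projection kernel depends only on the distance, and it embeds the neighbours of a vertex
  as a two-distance set in a space of bounded dimension.  Hence the degree is bounded.

  The numbers b(i) and c(i) of the intersection array are monotone and c(j) is at most b(i) if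
  i + j is at most D.  With the degree bounded, b(i) > c(i+1) means exponential growth, which the
  volume bound stops before radius D/20.  From there up to D/2 the inequalities leave only
  b(i) = c(i) = constant.  Then two adjacent vertices x and w satisfy that d(w,v) - d(x,v) is
  locally constant in v on this range of distances from x, so that the complement of a ball is
  made of ends which cannot be left; a count shows that there are at most two ends, and
  distance transitivity then yields degree two.  So G is a cycle for all large indices.
\<close>

section \<open>Eigenspaces of symmetric kernels\<close>

text \<open>Bounded geometry sees only distances comparable to D and says nothing directly about the
  degree, yet the growth argument needs a degree bound, as its rate is 1 + 1/degree. The spectral
  step extracts one from volumes alone: the eigenvalue is at least the size of an even ball of
  radius about D/20, the Hilbert--Schmidt norm is at most |G|, and so the dimension is at most the
  square of their ratio. Ramsey reduces the two-distance set to points at one mutual distance, whose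
  number a bounded dimension limits at once. The equality of b and c comes from a chain that closes
  up: if b(i) is at most c(i+1), then c(i+1), c(j+1), b(j), b(i) increase weakly in this order for i
  up to j as long as j + (j+1) is at most D; this is where D/2 comes from. The radius D/20 leaves
  room in this range for the count of ends, which looks at distances up to about seven times the
  starting radius. The constant 100 only has to make D/100 smaller than the radii at which volumes
  are compared.\<close>

definition inner_on :: "'a set \<Rightarrow> ('a \<Rightarrow> real) \<Rightarrow> ('a \<Rightarrow> real) \<Rightarrow> real" where
  "inner_on V f g = (\<Sum>x\<in>V. f x * g x)"

definition kernel_op :: "'a set \<Rightarrow> ('a \<Rightarrow> 'a \<Rightarrow> real) \<Rightarrow> ('a \<Rightarrow> real) \<Rightarrow> 'a \<Rightarrow> real" where
  "kernel_op V K f = (\<lambda>x. if x \<in> V then \<Sum>y\<in>V. K x y * f y else 0)"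

definition orthonormal_on :: "'a set \<Rightarrow> 'i set \<Rightarrow> ('i \<Rightarrow> 'a \<Rightarrow> real) \<Rightarrow> bool" where
  "orthonormal_on V I u \<longleftrightarrow> (\<forall>i\<in>I. \<forall>j\<in>I. inner_on V (u i) (u j) = (if i = j then 1 else 0))"

lemma inner_on_commute: "inner_on V f g = inner_on V g f"
  by (simp add: inner_on_def mult.commute)

lemma inner_on_lincomb_left:
  "inner_on V (\<lambda>x. a * f x + b * g x) h = a * inner_on V f h + b * inner_on V g h"
  by (simp add: inner_on_def sum_distrib_left sum.distrib algebra_simps)

lemma inner_on_lincomb_right:
  "inner_on V h (\<lambda>x. a * f x + b * g x) = a * inner_on V h f + b * inner_on V h g"
  by (simp add: inner_on_def sum_distrib_left sum.distrib algebra_simps)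

lemma inner_on_scale_left: "inner_on V (\<lambda>x. a * f x) h = a * inner_on V f h"
  by (simp add: inner_on_def sum_distrib_left algebra_simps)

lemma inner_on_scale_right: "inner_on V h (\<lambda>x. a * f x) = a * inner_on V h f"
  by (simp add: inner_on_def sum_distrib_left algebra_simps)

lemma inner_on_sum_left: "inner_on V (\<lambda>x. \<Sum>i\<in>I. f i x) h = (\<Sum>i\<in>I. inner_on V (f i) h)"
  by (simp add: inner_on_def sum_distrib_right sum.swap[of _ I])

lemma inner_on_sum_right: "inner_on V h (\<lambda>x. \<Sum>i\<in>I. f i x) = (\<Sum>i\<in>I. inner_on V h (f i))"
  by (simp add: inner_on_def sum_distrib_left sum.swap[of _ I])

lemma inner_on_self_nonneg: "0 \<le> inner_on V f f"
  by (simp add: inner_on_def sum_nonneg)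

lemma inner_on_self_eq_0:
  assumes "finite V" "inner_on V f f = 0" "x \<in> V" shows "f x = 0"
  using assms sum_nonneg_eq_0_iff[of V "\<lambda>x. f x * f x"] by (auto simp: inner_on_def)

lemma inner_on_diff_self:
  "inner_on V (\<lambda>x. f x - g x) (\<lambda>x. f x - g x)
     = inner_on V f f - 2 * inner_on V f g + inner_on V g g"
  by (simp add: inner_on_def sum_subtractf sum.distrib sum_distrib_left algebra_simps)

lemma bessel_inequality:
  assumes "finite I" "orthonormal_on V I u"
  shows "(\<Sum>i\<in>I. (inner_on V g (u i))\<^sup>2) \<le> inner_on V g g"
proof -
  define p where "p = (\<lambda>x. \<Sum>i\<in>I. inner_on V g (u i) * u i x)"
  have gp: "inner_on V g p = (\<Sum>i\<in>I. (inner_on V g (u i))\<^sup>2)"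
    by (simp add: p_def inner_on_sum_right inner_on_scale_right power2_eq_square)
  have "inner_on V p p = (\<Sum>i\<in>I. \<Sum>j\<in>I. inner_on V g (u i) * (inner_on V g (u j) * inner_on V (u i) (u j)))"
    by (simp only: p_def inner_on_sum_left inner_on_sum_right inner_on_scale_left inner_on_scale_right
        sum_distrib_left)
  also have "\<dots> = (\<Sum>i\<in>I. \<Sum>j\<in>I. if i = j then (inner_on V g (u i))\<^sup>2 else 0)"
    using assms(2) by (intro sum.cong refl) (auto simp: orthonormal_on_def power2_eq_square)
  also have "\<dots> = (\<Sum>i\<in>I. (inner_on V g (u i))\<^sup>2)" using assms(1) by simp
  finally have pp: "inner_on V p p = (\<Sum>i\<in>I. (inner_on V g (u i))\<^sup>2)" .
  have "0 \<le> inner_on V (\<lambda>x. g x - p x) (\<lambda>x. g x - p x)" by (rule inner_on_self_nonneg)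
  then show ?thesis using gp pp by (simp add: inner_on_diff_self)
qed

lemma kernel_op_lincomb:
  "kernel_op V K (\<lambda>x. a * f x + b * g x) = (\<lambda>x. a * kernel_op V K f x + b * kernel_op V K g x)"
  by (rule ext) (simp add: kernel_op_def sum_distrib_left sum.distrib algebra_simps)

lemma kernel_op_symmetric:
  assumes "\<And>x y. x \<in> V \<Longrightarrow> y \<in> V \<Longrightarrow> K x y = K y x"
  shows "inner_on V (kernel_op V K f) g = inner_on V f (kernel_op V K g)"
proof -
  have "inner_on V (kernel_op V K f) g = (\<Sum>x\<in>V. \<Sum>y\<in>V. K x y * f y * g x)"
    by (simp add: inner_on_def kernel_op_def sum_distrib_right)
  also have "\<dots> = (\<Sum>y\<in>V. \<Sum>x\<in>V. K x y * f y * g x)" by (rule sum.swap)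
  also have "\<dots> = (\<Sum>y\<in>V. \<Sum>x\<in>V. f y * (K y x * g x))"
    using assms by (intro sum.cong refl) (simp add: mult_ac)
  also have "\<dots> = inner_on V f (kernel_op V K g)"
    by (simp add: inner_on_def kernel_op_def sum_distrib_left)
  finally show ?thesis .
qed

text \<open>Tychonoff: functions on the whole type that vanish off \<open>V\<close> stand for
  functions on \<open>V\<close>, in the product topology. Unit spheres will be closed subsets of
  this cube.\<close>

lemma compact_cube_functions:
  "compact {f :: 'a \<Rightarrow> real. \<forall>x. f x \<in> (if x \<in> V then {-1..1} else {0})}"
proof -
  let ?S = "\<lambda>x. if x \<in> V then {-1..1::real} else {0}"
  have "compactin (product_topology (\<lambda>i. euclidean) UNIV) (PiE (UNIV :: 'a set) ?S)"
    by (subst compactin_PiE) auto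
  then have "compact (PiE (UNIV :: 'a set) ?S)"
    by (simp add: euclidean_product_topology)
  moreover have "PiE (UNIV :: 'a set) ?S = {f. \<forall>x. f x \<in> ?S x}"
    by (auto simp: PiE_def Pi_def)
  ultimately show ?thesis by simp
qed

lemma continuous_on_eval: "continuous_on S (\<lambda>f :: 'a \<Rightarrow> real. f x)"
  by (rule continuous_on_subset[OF continuous_on_product_coordinates]) simp

lemma continuous_on_inner_on:
  "continuous_on S (\<lambda>f. inner_on V f f)"
  unfolding inner_on_def
  by (intro continuous_on_sum continuous_on_mult continuous_on_eval)

lemma continuous_on_kernel_form:
  "continuous_on S (\<lambda>f. inner_on V (kernel_op V K f) f)"
proof -
  have "(\<lambda>f. inner_on V (kernel_op V K f) f) = (\<lambda>f. \<Sum>x\<in>V. (\<Sum>y\<in>V. K x y * f y) * f x)"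
    by (simp add: inner_on_def kernel_op_def)
  then show ?thesis
    by (simp only:) (intro continuous_on_sum continuous_on_mult continuous_on_eval continuous_on_const)
qed

text \<open>\<open>W\<close> is an invariant subspace in which eigenvectors are sought. It is closed
  so that its unit sphere is compact, and its members vanish off \<open>V\<close> so that agreement
  on \<open>V\<close> means equality.\<close>

locale kernel_space =
  fixes V :: "'a set" and K :: "'a \<Rightarrow> 'a \<Rightarrow> real" and W :: "('a \<Rightarrow> real) set"
  assumes finite_V: "finite V"
    and K_sym: "x \<in> V \<Longrightarrow> y \<in> V \<Longrightarrow> K x y = K y x"
    and W_off: "f \<in> W \<Longrightarrow> x \<notin> V \<Longrightarrow> f x = 0"
    and W_lincomb: "f \<in> W \<Longrightarrow> g \<in> W \<Longrightarrow> (\<lambda>x. a * f x + b * g x) \<in> W"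
    and W_kernel: "f \<in> W \<Longrightarrow> kernel_op V K f \<in> W"
    and W_closed: "closed W"
begin

text \<open>Variational argument: a maximiser of the quadratic form on the unit sphere of
  \<open>W\<close> is an eigenvector, and any test function \<open>h\<close> bounds its eigenvalue
  from below by its Rayleigh quotient.\<close>

lemma top_eigenvector:
  assumes h: "h \<in> W" "inner_on V h h > 0"
    and c: "c * inner_on V h h \<le> inner_on V (kernel_op V K h) h"
  obtains l f where "c \<le> l" "f \<in> W" "inner_on V f f = 1" "kernel_op V K f = (\<lambda>x. l * f x)"
proof -
  let ?T = "kernel_op V K"
  define S where "S = {f \<in> W. inner_on V f f = 1}"
  have sub: "S \<subseteq> {f. \<forall>x. f x \<in> (if x \<in> V then {-1..1} else {0})}"
  proof
    fix f assume f: "f \<in> S"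
    have "f x \<in> {-1..1}" if "x \<in> V" for x
    proof -
      have "f x * f x \<le> 1"
        using f member_le_sum[of x V "\<lambda>x. f x * f x"] that finite_V by (simp add: S_def inner_on_def)
      then have "\<bar>f x\<bar> \<le> 1" by (simp add: abs_le_square_iff[of "f x" 1, simplified] power2_eq_square)
      then show ?thesis by auto
    qed
    then show "f \<in> {f. \<forall>x. f x \<in> (if x \<in> V then {-1..1} else {0})}"
      using f W_off by (auto simp: S_def)
  qed
  have "closed {f. inner_on V f f = 1}"
    by (intro closed_Collect_eq continuous_on_inner_on continuous_on_const)
  then have "closed S" unfolding S_def using W_closed by (simp add: Collect_conj_eq closed_Int)
  then have "compact ({f. \<forall>x. f x \<in> (if x \<in> V then {-1..1} else {0})} \<inter> S)"
    by (rule compact_Int_closed[OF compact_cube_functions])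
  then have "compact S" using sub by (simp only: Int_absorb1)
  moreover have "continuous_on S (\<lambda>f. inner_on V (?T f) f)"
    by (rule continuous_on_kernel_form)
  moreover have norm_h: "(\<lambda>x. (1 / sqrt (inner_on V g g)) * g x) \<in> S"
    if "g \<in> W" "inner_on V g g > 0" for g
  proof -
    have "(\<lambda>x. (1 / sqrt (inner_on V g g)) * g x + 0 * g x) \<in> W" using that W_lincomb by blast
    then have "(\<lambda>x. (1 / sqrt (inner_on V g g)) * g x) \<in> W" by simp
    moreover have "1 / sqrt (inner_on V g g) * (1 / sqrt (inner_on V g g) * inner_on V g g) = 1"
      using that by simp
    ultimately show ?thesis
      by (simp only: S_def mem_Collect_eq inner_on_scale_left inner_on_scale_right simp_thms)
  qed
  moreover have "S \<noteq> {}" using norm_h h by blast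
  ultimately obtain f where f: "f \<in> S" and
    mx: "\<And>g. g \<in> S \<Longrightarrow> inner_on V (?T g) g \<le> inner_on V (?T f) f"
    using continuous_attains_sup by (metis (no_types, lifting))
  define l where "l = inner_on V (?T f) f"
  have scale: "?T (\<lambda>x. a * g x) = (\<lambda>x. a * ?T g x)" for a g
    using kernel_op_lincomb[of V K a g 0 g] by simp
  have quad: "inner_on V (?T g) g \<le> l * inner_on V g g" if g: "g \<in> W" for g
  proof (cases "inner_on V g g = 0")
    case True
    then have "\<And>x. x \<in> V \<Longrightarrow> g x = 0" using inner_on_self_eq_0[OF finite_V] by blast
    then show ?thesis by (simp add: inner_on_def)
  next
    case False
    then have pos: "inner_on V g g > 0" using inner_on_self_nonneg[of V g] by simp
    define a where "a = 1 / sqrt (inner_on V g g)"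
    have "inner_on V (?T (\<lambda>x. a * g x)) (\<lambda>x. a * g x) \<le> l"
      using mx[OF norm_h[OF g pos]] by (simp only: a_def l_def)
    then have "a * (a * inner_on V (?T g) g) \<le> l"
      by (simp only: scale inner_on_scale_left inner_on_scale_right)
    moreover have "a * a = 1 / inner_on V g g" using pos by (simp add: a_def)
    ultimately have "inner_on V (?T g) g / inner_on V g g \<le> l"
      by (metis mult.assoc mult.commute mult.right_neutral times_divide_eq_right)
    then show ?thesis using pos by (simp add: field_simps)
  qed
  have fW: "f \<in> W" and ff: "inner_on V f f = 1" using f by (auto simp: S_def)
  \<comment> \<open>The residual of the eigenvalue equation. Moving from \<open>f\<close> in
    direction \<open>g\<close> would improve the form to first order unless \<open>g\<close>
    vanishes.\<close>
  define g where "g = (\<lambda>x. ?T f x - l * f x)"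
  have gW: "g \<in> W" using W_lincomb[OF W_kernel[OF fW] fW, of 1 "-l"] by (simp add: g_def)
  have fg: "inner_on V (?T f) g - l * inner_on V f g = inner_on V g g"
    using inner_on_lincomb_left[of V 1 "?T f" "-l" f g] by (simp add: g_def)
  have var: "2 * t * inner_on V g g + t\<^sup>2 * (inner_on V (?T g) g - l * inner_on V g g) \<le> 0" for t
  proof -
    have "inner_on V (?T (\<lambda>x. 1 * f x + t * g x)) (\<lambda>x. 1 * f x + t * g x)
       \<le> l * inner_on V (\<lambda>x. 1 * f x + t * g x) (\<lambda>x. 1 * f x + t * g x)"
      by (rule quad) (rule W_lincomb[OF fW gW])
    then have "l + t * inner_on V (?T f) g
         + t * (inner_on V (?T g) f + t * inner_on V (?T g) g)
       \<le> l * (1 + t * inner_on V f g + t * (inner_on V g f + t * inner_on V g g))"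
      unfolding kernel_op_lincomb inner_on_lincomb_left inner_on_lincomb_right
      using ff by (simp add: l_def)
    moreover have "inner_on V (?T g) f = inner_on V (?T f) g"
      by (rule trans[OF kernel_op_symmetric[OF K_sym] inner_on_commute])
    ultimately have "2 * t * (inner_on V (?T f) g - l * inner_on V f g)
         + t\<^sup>2 * (inner_on V (?T g) g - l * inner_on V g g) \<le> 0"
      using inner_on_commute[of V g f] by (simp add: algebra_simps power2_eq_square)
    then show ?thesis by (simp only: fg)
  qed
  define A where "A = inner_on V g g"
  define B where "B = inner_on V (?T g) g - l * inner_on V g g"
  have "A = 0"
  proof (rule ccontr)
    assume "A \<noteq> 0"
    then have A: "A > 0" using inner_on_self_nonneg[of V g] by (simp add: A_def)
    \<comment> \<open>Small enough for the linear gain \<open>2 * A\<close> to outweigh the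
      quadratic term.\<close>
    define t where "t = A / (1 + \<bar>B\<bar>)"
    have t: "t > 0" using A by (simp add: t_def)
    have "t * (2 * A + t * B) \<le> 0"
      using var[of t] by (simp add: A_def B_def power2_eq_square algebra_simps)
    then have le: "2 * A + t * B \<le> 0" using t by (simp add: mult_le_0_iff)
    have "t * \<bar>B\<bar> \<le> A" using A by (simp add: t_def field_simps)
    moreover have "- (t * B) \<le> t * \<bar>B\<bar>" using t by (smt (verit) mult_minus_right mult_left_mono)
    ultimately show False using le A by linarith
  qed
  then have g0: "g x = 0" if "x \<in> V" for x
    using inner_on_self_eq_0[OF finite_V, of g x] that by (simp add: A_def)
  then have "kernel_op V K f = (\<lambda>x. l * f x)"
    using W_off[OF fW] by (intro ext) (auto simp: g_def kernel_op_def)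
  moreover have "c \<le> l"
    using order_trans[OF c quad[OF h(1)]] h(2) by simp
  ultimately show ?thesis using that fW ff by blast
qed

text \<open>The left side is the sum of the squared norms of the images of the \<open>u i\<close>;
  Bessel, applied to each row of \<open>K\<close>, bounds it by the squared Hilbert--Schmidt
  norm.\<close>

lemma eigenspace_orthonormal_bound:
  assumes I: "finite I" "orthonormal_on V I u"
    and eig: "\<And>i. i \<in> I \<Longrightarrow> kernel_op V K (u i) = (\<lambda>x. l * u i x)"
  shows "real (card I) * l\<^sup>2 \<le> (\<Sum>x\<in>V. \<Sum>y\<in>V. (K x y)\<^sup>2)"
proof -
  have "real (card I) * l\<^sup>2 = (\<Sum>i\<in>I. l\<^sup>2 * inner_on V (u i) (u i))"
    using I(2) by (simp add: orthonormal_on_def)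
  also have "\<dots> = (\<Sum>i\<in>I. \<Sum>x\<in>V. (l * u i x)\<^sup>2)"
    by (simp add: inner_on_def sum_distrib_left power2_eq_square algebra_simps)
  also have "\<dots> = (\<Sum>i\<in>I. \<Sum>x\<in>V. (inner_on V (K x) (u i))\<^sup>2)"
  proof (intro sum.cong refl)
    fix i x assume "i \<in> I" "x \<in> V"
    then show "(l * u i x)\<^sup>2 = (inner_on V (K x) (u i))\<^sup>2"
      using fun_cong[OF eig, of i x] by (simp add: kernel_op_def inner_on_def)
  qed
  also have "\<dots> = (\<Sum>x\<in>V. \<Sum>i\<in>I. (inner_on V (K x) (u i))\<^sup>2)" by (rule sum.swap)
  also have "\<dots> \<le> (\<Sum>x\<in>V. inner_on V (K x) (K x))"
    by (intro sum_mono bessel_inequality I)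
  finally show ?thesis by (simp add: inner_on_def power2_eq_square)
qed

definition eigenspace :: "real \<Rightarrow> ('a \<Rightarrow> real) set" where
  "eigenspace l = {f \<in> W. kernel_op V K f = (\<lambda>x. l * f x)}"

lemma eigenspace_lincomb:
  assumes "f \<in> eigenspace l" "g \<in> eigenspace l"
  shows "(\<lambda>x. a * f x + b * g x) \<in> eigenspace l"
  using assms W_lincomb by (auto simp: eigenspace_def kernel_op_lincomb algebra_simps)

lemma eigenspace_sum:
  assumes "finite I" "I \<noteq> {}" "\<And>i. i \<in> I \<Longrightarrow> u i \<in> eigenspace l"
  shows "(\<lambda>x. \<Sum>i\<in>I. a i * u i x) \<in> eigenspace l"
  using assms
proof (induction I rule: finite_ne_induct)
  case (singleton i)
  then show ?case using eigenspace_lincomb[of "u i" l "u i" "a i" 0] by simp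
next
  case (insert i I)
  then show ?case
    using eigenspace_lincomb[of "u i" l "\<lambda>x. \<Sum>i\<in>I. a i * u i x" "a i" 1] by simp
qed

text \<open>\<open>P\<close> is the kernel of the orthogonal projection onto the eigenspace, written
  in an orthonormal family of greatest length; such a family exists because the Hilbert--Schmidt
  norm bounds the length.\<close>

lemma reproducing_kernel_exists:
  assumes l: "l \<noteq> 0" and f: "f \<in> eigenspace l" "inner_on V f f = 1"
  shows "\<exists>P. (\<forall>x. P x \<in> eigenspace l) \<and> (\<forall>g\<in>eigenspace l. \<forall>x\<in>V. inner_on V (P x) g = g x)
    \<and> (\<forall>x y. P x y = P y x)"
proof -
  let ?Q = "\<lambda>n. \<exists>u. orthonormal_on V {..<n::nat} u \<and> (\<forall>i<n. u i \<in> eigenspace l)"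
  define M where "M = nat \<lceil>(\<Sum>x\<in>V. \<Sum>y\<in>V. (K x y)\<^sup>2) / l\<^sup>2\<rceil>"
  have bd: "n \<le> M" if Q: "?Q n" for n
  proof -
    obtain u where u: "orthonormal_on V {..<n} u" "\<forall>i<n. u i \<in> eigenspace l" using Q by blast
    then have "real n * l\<^sup>2 \<le> (\<Sum>x\<in>V. \<Sum>y\<in>V. (K x y)\<^sup>2)"
      using eigenspace_orthonormal_bound[of "{..<n}" u l] by (simp add: eigenspace_def)
    then have "real n \<le> (\<Sum>x\<in>V. \<Sum>y\<in>V. (K x y)\<^sup>2) / l\<^sup>2" using l by (simp add: field_simps)
    then show ?thesis unfolding M_def by linarith
  qed
  \<comment> \<open>Ensures a nonempty family: \<open>eigenspace_sum\<close> forms nonempty sums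
    only, since the locale does not postulate that \<open>W\<close> contains 0.\<close>
  have "?Q 1" using f by (intro exI[of _ "\<lambda>_. f"]) (auto simp: orthonormal_on_def)
  then have "?Q (Greatest ?Q)" and gr: "\<And>n. ?Q n \<Longrightarrow> n \<le> Greatest ?Q"
    using GreatestI_nat[of ?Q 1 M] Greatest_le_nat[of ?Q _ M] bd by blast+
  moreover define N where "N = Greatest ?Q"
  ultimately obtain u where u: "orthonormal_on V {..<N} u" "\<And>i. i < N \<Longrightarrow> u i \<in> eigenspace l"
    by blast
  have "N \<ge> 1" using gr[OF \<open>?Q 1\<close>] N_def by simp
  define P where "P = (\<lambda>x y. \<Sum>i<N. u i x * u i y)"
  have Pe: "P x \<in> eigenspace l" for x
    unfolding P_def using \<open>N \<ge> 1\<close> u(2) by (intro eigenspace_sum) (auto simp: lessThan_empty_iff)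
  have "inner_on V (P x) g = g x" if g: "g \<in> eigenspace l" and x: "x \<in> V" for g x
  proof -
    define p where "p = (\<lambda>x. \<Sum>i<N. inner_on V g (u i) * u i x)"
    have pe: "p \<in> eigenspace l"
      unfolding p_def using \<open>N \<ge> 1\<close> u(2) by (intro eigenspace_sum) (auto simp: lessThan_empty_iff)
    define r where "r = (\<lambda>x. g x - p x)"
    have re: "r \<in> eigenspace l" using eigenspace_lincomb[OF g pe, of 1 "-1"] by (simp add: r_def)
    have ru: "inner_on V r (u j) = 0" if "j < N" for j
    proof -
      have "inner_on V p (u j) = (\<Sum>i<N. if i = j then inner_on V g (u i) else 0)"
        unfolding p_def inner_on_sum_left inner_on_scale_left
        using u(1) that by (intro sum.cong) (auto simp: orthonormal_on_def)
      also have "\<dots> = inner_on V g (u j)" using that by simp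
      finally show ?thesis
        using inner_on_lincomb_left[of V 1 g "-1" p "u j"] by (simp add: r_def)
    qed
    \<comment> \<open>Otherwise the normalised remainder could be appended to the family, against
      its maximality.\<close>
    have "inner_on V r r = 0"
    proof (rule ccontr)
      assume "inner_on V r r \<noteq> 0"
      then have pos: "inner_on V r r > 0" using inner_on_self_nonneg[of V r] by simp
      define s where "s = 1 / sqrt (inner_on V r r)"
      define w where "w = u (N := (\<lambda>x. s * r x))"
      have one: "s * (s * inner_on V r r) = 1" using pos by (simp add: s_def)
      have ur: "inner_on V (u j) r = 0" if "j < N" for j
        using ru[OF that] inner_on_commute[of V "u j" r] by simp
      have "inner_on V (w i) (w j) = (if i = j then 1 else 0)" if "i < Suc N" "j < Suc N" for i j
        using u(1) that ru[of i] ru[of j] ur[of i] ur[of j] one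
        by (cases "i = N"; cases "j = N")
          (simp_all add: orthonormal_on_def w_def inner_on_scale_left inner_on_scale_right)
      then have "orthonormal_on V {..<Suc N} w" by (simp add: orthonormal_on_def)
      moreover have "(\<lambda>x. s * r x) \<in> eigenspace l" using eigenspace_lincomb[OF re re, of s 0] by simp
      then have "\<forall>i<Suc N. w i \<in> eigenspace l" using u(2) by (auto simp: w_def less_Suc_eq)
      ultimately have "Suc N \<le> N" using gr N_def by blast
      then show False by simp
    qed
    then have "r x = 0" using inner_on_self_eq_0[OF finite_V] x by blast
    then have "g x = p x" by (simp add: r_def)
    moreover have "inner_on V (P x) g = p x"
      by (simp only: P_def p_def inner_on_sum_left inner_on_scale_left)
        (simp only: inner_on_commute[of V g] mult.commute)
    ultimately show ?thesis by simp
  qed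
  moreover have "P x y = P y x" for x y by (simp add: P_def mult.commute)
  ultimately show ?thesis using Pe by (intro exI[of _ P]) blast
qed

text \<open>The difference of two representatives of evaluation at \<open>x\<close> is orthogonal to
  itself. Invariance of the projection kernel under isometries will follow from this without a
  choice of basis.\<close>

lemma reproducing_kernel_unique:
  assumes P: "P \<in> eigenspace l" "\<And>u. u \<in> eigenspace l \<Longrightarrow> inner_on V P u = u x"
    and g: "g \<in> eigenspace l" "\<And>u. u \<in> eigenspace l \<Longrightarrow> inner_on V g u = u x"
    and y: "y \<in> V"
  shows "g y = P y"
proof -
  define r where "r = (\<lambda>z. g z - P z)"
  have re: "r \<in> eigenspace l"
    using eigenspace_lincomb[OF g(1) P(1), of 1 "-1"] by (simp add: r_def)
  have "inner_on V r r = inner_on V g r - inner_on V P r"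
    using inner_on_lincomb_left[of V 1 g "-1" P r] by (simp add: r_def)
  then have "inner_on V r r = 0" using P(2)[OF re] g(2)[OF re] by simp
  then have "r y = 0" by (rule inner_on_self_eq_0[OF finite_V _ y])
  then show ?thesis by (simp add: r_def)
qed

end

section \<open>Distance-transitive metrics\<close>

lemma double_count_regular:
  assumes "finite A" "finite B"
    and "\<And>a. a \<in> A \<Longrightarrow> card {b \<in> B. R a b} = p"
    and "\<And>b. b \<in> B \<Longrightarrow> card {a \<in> A. R a b} = q"
  shows "card A * p = card B * (q :: nat)"
proof -
  have "(\<Sum>a\<in>A. card {b\<in>B. R a b}) = q * card B"
    using assms by (intro sum_multicount) auto
  then show ?thesis using assms(3) by (simp add: mult.commute)
qed

text \<open>Graphs enter through their path metric only: \<open>d_step\<close> says that distances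
  are realised by chains of unit steps, and automorphisms are replaced by isometries.\<close>

locale distance_transitive_metric =
  fixes V :: "'a set" and d :: "'a \<Rightarrow> 'a \<Rightarrow> nat"
  assumes finV: "finite V" and V_ne: "V \<noteq> {}"
    and d_zero_iff: "x \<in> V \<Longrightarrow> y \<in> V \<Longrightarrow> d x y = 0 \<longleftrightarrow> x = y"
    and d_sym: "x \<in> V \<Longrightarrow> y \<in> V \<Longrightarrow> d x y = d y x"
    and d_tri: "x \<in> V \<Longrightarrow> y \<in> V \<Longrightarrow> z \<in> V \<Longrightarrow> d x z \<le> d x y + d y z"
    and d_step: "x \<in> V \<Longrightarrow> y \<in> V \<Longrightarrow> d x y = Suc n \<Longrightarrow> \<exists>z\<in>V. d x z = n \<and> d z y = 1"
    and d_transitive: "u \<in> V \<Longrightarrow> v \<in> V \<Longrightarrow> u' \<in> V \<Longrightarrow> v' \<in> V \<Longrightarrow> d u v = d u' v' \<Longrightarrow>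
      \<exists>\<phi>. bij_betw \<phi> V V \<and> (\<forall>x\<in>V. \<forall>y\<in>V. d (\<phi> x) (\<phi> y) = d x y) \<and> \<phi> u = u' \<and> \<phi> v = v'"
begin

definition isom :: "('a \<Rightarrow> 'a) \<Rightarrow> bool" where
  "isom \<phi> \<longleftrightarrow> bij_betw \<phi> V V \<and> (\<forall>x\<in>V. \<forall>y\<in>V. d (\<phi> x) (\<phi> y) = d x y)"

lemma isom_dist: "isom \<phi> \<Longrightarrow> x \<in> V \<Longrightarrow> y \<in> V \<Longrightarrow> d (\<phi> x) (\<phi> y) = d x y"
  and isom_in: "isom \<phi> \<Longrightarrow> x \<in> V \<Longrightarrow> \<phi> x \<in> V"
  by (auto simp: isom_def bij_betw_def)

lemma isom_pair:
  assumes "u \<in> V" "v \<in> V" "u' \<in> V" "v' \<in> V" "d u v = d u' v'"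
  obtains \<phi> where "isom \<phi>" "\<phi> u = u'" "\<phi> v = v'"
  using d_transitive[OF assms] that by (auto simp: isom_def)

lemma isom_inverse:
  assumes "isom \<phi>"
  shows "\<exists>\<psi>. isom \<psi> \<and> (\<forall>x\<in>V. \<psi> (\<phi> x) = x) \<and> (\<forall>x\<in>V. \<phi> (\<psi> x) = x)"
proof -
  let ?\<psi> = "inv_into V \<phi>"
  have bij: "bij_betw \<phi> V V" using assms by (simp add: isom_def)
  have bij': "bij_betw ?\<psi> V V" using bij by (rule bij_betw_inv_into)
  have l: "?\<psi> (\<phi> x) = x" if "x \<in> V" for x using bij_betw_inv_into_left[OF bij that] .
  have r: "\<phi> (?\<psi> x) = x" if "x \<in> V" for x using bij_betw_inv_into_right[OF bij that] .
  have "d (?\<psi> x) (?\<psi> y) = d x y" if "x \<in> V" "y \<in> V" for x y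
    using isom_dist[OF assms, of "?\<psi> x" "?\<psi> y"] that r bij' by (metis bij_betwE)
  then have "isom ?\<psi>" using bij' by (simp add: isom_def)
  then show ?thesis using l r by blast
qed

lemma isom_card:
  assumes "isom \<phi>" "\<And>z. z \<in> V \<Longrightarrow> P z \<longleftrightarrow> Q (\<phi> z)"
  shows "card {z \<in> V. P z} = card {z \<in> V. Q z}"
proof -
  have bij: "bij_betw \<phi> V V" using assms by (simp add: isom_def)
  have "\<phi> ` {z \<in> V. P z} = {z \<in> V. Q z}"
    using bij assms(2) by (fastforce simp: bij_betw_def)
  moreover have "inj_on \<phi> {z \<in> V. P z}"
    using bij by (auto simp: bij_betw_def inj_on_def)
  ultimately show ?thesis using card_image by metis
qed

text \<open>The source of all regularity: an isometry from one pair to the other matches the counted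
  sets. Suitable \<open>P\<close> give the sizes of spheres and even balls and the intersection
  numbers.\<close>

lemma card_pair_eq:
  assumes "x \<in> V" "y \<in> V" "x' \<in> V" "y' \<in> V" "d x y = d x' y'"
  shows "card {z \<in> V. P (d x z) (d y z)} = card {z \<in> V. P (d x' z) (d y' z)}"
proof -
  obtain \<phi> where "isom \<phi>" "\<phi> x = x'" "\<phi> y = y'" using isom_pair assms by blast
  then show ?thesis
    using isom_dist[of \<phi> x] isom_dist[of \<phi> y] assms(1,2) by (intro isom_card[of \<phi>]) auto
qed

lemma d_self [simp]: "x \<in> V \<Longrightarrow> d x x = 0"
  using d_zero_iff by blast

lemma geodesic_point:
  assumes "x \<in> V" "y \<in> V" "i \<le> d x y"
  obtains z where "z \<in> V" "d x z = i" "d z y = d x y - i"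
proof -
  have "y \<in> V \<Longrightarrow> d x y = n \<Longrightarrow> i \<le> n \<Longrightarrow> \<exists>z\<in>V. d x z = i \<and> d z y = n - i" for n
  proof (induction n arbitrary: y)
    case 0
    then show ?case using assms(1) d_zero_iff by auto
  next
    case (Suc n)
    show ?case
    proof (cases "i = Suc n")
      case True
      then show ?thesis using Suc by (intro bexI[of _ y]) auto
    next
      case False
      obtain z where z: "z \<in> V" "d x z = n" "d z y = 1" using d_step assms(1) Suc by metis
      obtain w where w: "w \<in> V" "d x w = i" "d w z = n - i" using Suc False z by auto
      have "d w y \<le> Suc n - i" using d_tri[of w z y] w z Suc.prems False by auto
      moreover have "d w y \<ge> Suc n - i" using d_tri[of x w y] w Suc.prems assms(1) by auto
      ultimately show ?thesis using w by auto
    qed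
  qed
  then show ?thesis using assms that by blast
qed

definition diam :: nat where "diam = Max {d x y |x y. x \<in> V \<and> y \<in> V}"

lemma finite_dists: "finite {d x y |x y. x \<in> V \<and> y \<in> V}"
proof -
  have "{d x y |x y. x \<in> V \<and> y \<in> V} = (\<lambda>(x,y). d x y) ` (V \<times> V)" by auto
  then show ?thesis using finV by simp
qed

lemma d_le_diam: "x \<in> V \<Longrightarrow> y \<in> V \<Longrightarrow> d x y \<le> diam"
  unfolding diam_def using finite_dists by (intro Max_ge) auto

lemma diam_attained: obtains x y where "x \<in> V" "y \<in> V" "d x y = diam"
proof -
  have "diam \<in> {d x y |x y. x \<in> V \<and> y \<in> V}"
    unfolding diam_def using finite_dists V_ne by (intro Max_in) auto
  then show ?thesis using that by auto
qed

text \<open>A geodesic of diametral length contains a pair at distance \<open>d x y\<close>; the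
  isometry taking that pair to \<open>x\<close>, \<open>y\<close> brings the rest of the geodesic
  along.\<close>

lemma extend_geodesic:
  assumes "x \<in> V" "y \<in> V" "d x y \<le> j" "j \<le> diam"
  obtains z where "z \<in> V" "d x z = j" "d y z = j - d x y"
proof -
  obtain p q where pq: "p \<in> V" "q \<in> V" "d p q = diam" using diam_attained .
  obtain r where r: "r \<in> V" "d p r = j" using geodesic_point[OF pq(1,2), of j] pq(3) assms by auto
  obtain s where s: "s \<in> V" "d p s = d x y" "d s r = d p r - d x y"
    using geodesic_point[OF pq(1) r(1), of "d x y"] r(2) assms by metis
  obtain \<phi> where \<phi>: "isom \<phi>" "\<phi> p = x" "\<phi> s = y"
    using isom_pair[OF pq(1) s(1) assms(1,2)] s(2) by auto
  show ?thesis
    using that[of "\<phi> r"] \<phi> isom_dist[OF \<phi>(1) pq(1) r(1)] isom_dist[OF \<phi>(1) s(1) r(1)] r s isom_in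
    by simp
qed

lemma point_at_distance:
  assumes "x \<in> V" "i \<le> diam"
  obtains y where "y \<in> V" "d x y = i"
  using extend_geodesic[OF assms(1,1), of i] assms by auto

text \<open>b_num and c_num are the numbers b and c of the intersection array of a distance-regular
  graph.  Beyond the diameter there is no pair to choose and their values are meaningless.\<close>

definition sphere_size :: "nat \<Rightarrow> nat" where
  "sphere_size i = card {z \<in> V. d (SOME x. x \<in> V) z = i}"

definition rep :: "nat \<Rightarrow> 'a \<times> 'a" where
  "rep i = (SOME p. fst p \<in> V \<and> snd p \<in> V \<and> d (fst p) (snd p) = i)"

definition b_num :: "nat \<Rightarrow> nat" where
  "b_num i = card {z \<in> V. d (snd (rep i)) z = 1 \<and> d (fst (rep i)) z = Suc i}"

definition c_num :: "nat \<Rightarrow> nat" where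
  "c_num i = card {z \<in> V. d (snd (rep i)) z = 1 \<and> Suc (d (fst (rep i)) z) = i}"

lemma rep_dist:
  assumes "x \<in> V" "y \<in> V"
  shows "fst (rep (d x y)) \<in> V" "snd (rep (d x y)) \<in> V" "d (fst (rep (d x y))) (snd (rep (d x y))) = d x y"
proof -
  have "\<exists>p. fst p \<in> V \<and> snd p \<in> V \<and> d (fst p) (snd p) = d x y"
    using assms by (intro exI[of _ "(x,y)"]) simp
  from someI_ex[OF this]
  show "fst (rep (d x y)) \<in> V" "snd (rep (d x y)) \<in> V" "d (fst (rep (d x y))) (snd (rep (d x y))) = d x y"
    by (simp_all add: rep_def)
qed

lemma card_sphere: "x \<in> V \<Longrightarrow> card {z \<in> V. d x z = i} = sphere_size i"
proof -
  assume x: "x \<in> V"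
  have "(SOME x. x \<in> V) \<in> V" using V_ne some_in_eq by blast
  then show ?thesis unfolding sphere_size_def
    by (intro card_pair_eq[where P = "\<lambda>m n. m = i" and y = x and y' = "SOME x. x \<in> V"]) (use x in auto)
qed

lemma card_b:
  assumes "x \<in> V" "y \<in> V"
  shows "card {z \<in> V. d y z = 1 \<and> d x z = Suc (d x y)} = b_num (d x y)"
  unfolding b_num_def
  by (rule card_pair_eq[where P = "\<lambda>m n. n = 1 \<and> m = Suc (d x y)"]) (use assms rep_dist in simp_all)

lemma card_c:
  assumes "x \<in> V" "y \<in> V"
  shows "card {z \<in> V. d y z = 1 \<and> Suc (d x z) = d x y} = c_num (d x y)"
  unfolding c_num_def
  by (rule card_pair_eq[where P = "\<lambda>m n. n = 1 \<and> Suc m = d x y"]) (use assms rep_dist in simp_all)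

section \<open>Monotonicity of the intersection numbers\<close>

lemma neighbour_dist:
  assumes "x \<in> V" "y \<in> V" "z \<in> V" "d y z = 1"
  shows "d x z \<le> Suc (d x y)" "d x y \<le> Suc (d x z)"
  using d_tri[of x y z] d_tri[of x z y] d_sym[of y z] assms by auto

lemma neighbour_dist':
  assumes "x \<in> V" "y \<in> V" "z \<in> V" "d y z = 1"
  shows "d z x \<le> Suc (d y x)" "d y x \<le> Suc (d z x)"
  using d_tri[of z y x] d_tri[of y z x] d_sym[of y z] assms by auto

text \<open>Distances from \<open>x\<close> and \<open>w\<close> differ by at most one, so a
  neighbour of \<open>y\<close> can be two steps beyond \<open>d x y\<close> from \<open>w\<close>
  only if it is also farther from \<open>x\<close>. The inclusion gives monotonicity, and where the
  cardinalities coincide it becomes an equality of sets, as \<open>farther_step\<close>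
  exploits.\<close>

lemma b_set_mono:
  assumes "x \<in> V" "w \<in> V" "y \<in> V" "d x w = 1" "d w y = Suc (d x y)"
  shows "{z \<in> V. d y z = 1 \<and> d w z = Suc (d w y)} \<subseteq> {z \<in> V. d y z = 1 \<and> d x z = Suc (d x y)}"
proof (safe)
  fix z assume z: "z \<in> V" "d y z = 1" "d w z = Suc (d w y)"
  have "d w z \<le> Suc (d x z)" using neighbour_dist'[of z x w] assms z by simp
  moreover have "d x z \<le> Suc (d x y)" using neighbour_dist[of x y z] assms z by simp
  ultimately show "d x z = Suc (d x y)" using z assms by simp
qed

lemma c_set_mono:
  assumes "x \<in> V" "w \<in> V" "y \<in> V" "d x w = 1" "d w y = Suc (d x y)"
  shows "{z \<in> V. d y z = 1 \<and> Suc (d x z) = d x y} \<subseteq> {z \<in> V. d y z = 1 \<and> Suc (d w z) = d w y}"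
proof (safe)
  fix z assume z: "z \<in> V" "d y z = 1" "Suc (d x z) = d x y"
  have "d w z \<le> Suc (d x z)" using neighbour_dist'[of z x w] assms z by simp
  moreover have "d w y \<le> Suc (d w z)" using neighbour_dist[of w y z] assms z by simp
  ultimately show "Suc (d w z) = d w y" using z assms by simp
qed

lemma obtain_step_pair:
  assumes "Suc i \<le> diam"
  obtains x w y where "x \<in> V" "w \<in> V" "y \<in> V" "d x w = 1" "d x y = i" "d w y = Suc i"
proof -
  obtain p q where pq: "p \<in> V" "q \<in> V" "d p q = diam" using diam_attained .
  obtain y where y: "y \<in> V" "d p y = Suc i" using point_at_distance[OF pq(1) assms] .
  obtain x where x: "x \<in> V" "d p x = 1" "d x y = Suc i - 1"
    using geodesic_point[OF pq(1) y(1), of 1] y(2) by auto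
  show ?thesis using that[of x p y] x y pq d_sym by simp
qed

lemma b_Suc_le: "Suc i \<le> diam \<Longrightarrow> b_num (Suc i) \<le> b_num i"
proof -
  assume "Suc i \<le> diam"
  then obtain x w y where *: "x \<in> V" "w \<in> V" "y \<in> V" "d x w = 1" "d x y = i" "d w y = Suc i"
    using obtain_step_pair by metis
  show ?thesis
    using card_mono[OF _ b_set_mono[of x w y]] card_b[of w y] card_b[of x y] * finV by simp
qed

lemma c_le_Suc: "Suc i \<le> diam \<Longrightarrow> c_num i \<le> c_num (Suc i)"
proof -
  assume "Suc i \<le> diam"
  then obtain x w y where *: "x \<in> V" "w \<in> V" "y \<in> V" "d x w = 1" "d x y = i" "d w y = Suc i"
    using obtain_step_pair by metis
  show ?thesis
    using card_mono[OF _ c_set_mono[of x w y]] card_c[of w y] card_c[of x y] * finV by simp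
qed

lemma b_antimono: "i \<le> j \<Longrightarrow> j \<le> diam \<Longrightarrow> b_num j \<le> b_num i"
proof (induction j rule: dec_induct)
  case (step n)
  then show ?case using b_Suc_le[of n] by simp
qed simp

lemma c_mono: "i \<le> j \<Longrightarrow> j \<le> diam \<Longrightarrow> c_num i \<le> c_num j"
proof (induction j rule: dec_induct)
  case (step n)
  then show ?case using c_le_Suc[of n] by simp
qed simp

text \<open>Take \<open>z\<close> on a geodesic of length \<open>i + j\<close> from \<open>p\<close>
  to \<open>y\<close>, at distance \<open>i\<close> from \<open>p\<close>: a neighbour of
  \<open>z\<close> nearer to \<open>y\<close> has to be farther from \<open>p\<close>.\<close>

lemma c_le_b:
  assumes "i + j \<le> diam" shows "c_num j \<le> b_num i"
proof -
  obtain p q where pq: "p \<in> V" "q \<in> V" "d p q = diam" using diam_attained .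
  obtain y where y: "y \<in> V" "d p y = i + j" using point_at_distance[OF pq(1) assms] .
  obtain z where z: "z \<in> V" "d p z = i" "d z y = j"
    using geodesic_point[OF pq(1) y(1), of i] y(2) by auto
  have yz: "d y z = j" using z y d_sym by simp
  have "{w \<in> V. d z w = 1 \<and> Suc (d y w) = d y z} \<subseteq> {w \<in> V. d z w = 1 \<and> d p w = Suc (d p z)}"
  proof safe
    fix w assume w: "w \<in> V" "d z w = 1" "Suc (d y w) = d y z"
    have "d p y \<le> d p w + d w y" using d_tri[of p w y] pq w y by simp
    moreover have "d w y = d y w" using d_sym w y by simp
    moreover have "d p w \<le> Suc (d p z)" using neighbour_dist[of p z w] pq z w by simp
    ultimately show "d p w = Suc (d p z)" using w y z yz by simp
  qed
  from card_mono[OF _ this] show ?thesis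
    using card_b[OF pq(1) z(1)] card_c[OF y(1) z(1)] finV z yz by simp
qed

lemma b_pos: assumes "i < diam" shows "0 < b_num i"
proof -
  obtain x w y where *: "x \<in> V" "w \<in> V" "y \<in> V" "d x w = 1" "d x y = i" "d w y = Suc i"
    using obtain_step_pair[of i] assms by (metis Suc_leI)
  then have "w \<in> {z \<in> V. d x z = 1 \<and> d y z = Suc (d y x)}" using d_sym by simp
  then have "card {z \<in> V. d x z = 1 \<and> d y z = Suc (d y x)} > 0"
    using finV by (auto simp: card_gt_0_iff)
  then show ?thesis using card_b[of y x] * d_sym by simp
qed

lemma c_pos: assumes "i < diam" shows "0 < c_num (Suc i)"
proof -
  obtain x w y where *: "x \<in> V" "w \<in> V" "y \<in> V" "d x w = 1" "d x y = i" "d w y = Suc i"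
    using obtain_step_pair[of i] assms by (metis Suc_leI)
  then have "x \<in> {z \<in> V. d w z = 1 \<and> Suc (d y z) = d y w}" using d_sym by simp
  then have "card {z \<in> V. d w z = 1 \<and> Suc (d y z) = d y w} > 0"
    using finV by (auto simp: card_gt_0_iff)
  then show ?thesis using card_c[of y w] * d_sym by simp
qed

lemma b_c_le_degree: assumes "i \<le> diam" shows "b_num i + c_num i \<le> sphere_size 1"
proof -
  obtain p q where pq: "p \<in> V" "q \<in> V" "d p q = diam" using diam_attained .
  obtain y where y: "y \<in> V" "d p y = i" using point_at_distance[OF pq(1) assms] .
  let ?B = "{z \<in> V. d y z = 1 \<and> d p z = Suc (d p y)}" and ?C = "{z \<in> V. d y z = 1 \<and> Suc (d p z) = d p y}"
  have "card (?B \<union> ?C) = card ?B + card ?C" using finV by (intro card_Un_disjoint) auto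
  moreover have "card (?B \<union> ?C) \<le> card {z \<in> V. d y z = 1}" using finV by (intro card_mono) auto
  ultimately show ?thesis using card_b[of p y] card_c[of p y] card_sphere[of y 1] y pq by simp
qed

text \<open>Unit pairs between consecutive spheres are counted from both sides.\<close>

lemma sphere_size_rec: "sphere_size i * b_num i = sphere_size (Suc i) * c_num (Suc i)" if "i < diam"
proof -
  obtain x where x: "x \<in> V" using V_ne by blast
  have "card {z \<in> V. d x z = i} * b_num i = card {z \<in> V. d x z = Suc i} * c_num (Suc i)"
  proof (rule double_count_regular[where R = "\<lambda>a b. d a b = 1"])
    fix a assume "a \<in> {z \<in> V. d x z = i}"
    then show "card {b \<in> {z \<in> V. d x z = Suc i}. d a b = 1} = b_num i"
      using card_b[OF x, of a] by (simp add: conj_ac)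
  next
    fix b assume b: "b \<in> {z \<in> V. d x z = Suc i}"
    then have "{a \<in> {z \<in> V. d x z = i}. d a b = 1} = {z \<in> V. d b z = 1 \<and> Suc (d x z) = d x b}"
      using d_sym by auto
    then show "card {a \<in> {z \<in> V. d x z = i}. d a b = 1} = c_num (Suc i)"
      using card_c[OF x, of b] b by simp
  qed (use finV in auto)
  then show ?thesis using card_sphere[OF x] by simp
qed

lemma sphere_size_pos: assumes "i \<le> diam" shows "0 < sphere_size i"
proof -
  obtain x where x: "x \<in> V" using V_ne by blast
  obtain y where "y \<in> V" "d x y = i" using point_at_distance[OF x assms] .
  then have "card {z \<in> V. d x z = i} > 0" using finV by (auto simp: card_gt_0_iff)
  then show ?thesis using card_sphere[OF x, of i] by simp
qed

definition ball_size :: "nat \<Rightarrow> nat" where "ball_size r = (\<Sum>i\<le>r. sphere_size i)"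

lemma card_ball: assumes "x \<in> V" shows "card {z \<in> V. d x z \<le> r} = ball_size r"
proof -
  have "{z \<in> V. d x z \<le> r} = (\<Union>i\<in>{..r}. {z \<in> V. d x z = i})" by auto
  then have "card {z \<in> V. d x z \<le> r} = (\<Sum>i\<in>{..r}. card {z \<in> V. d x z = i})"
    using finV by (simp only:) (intro card_UN_disjoint, auto)
  then show ?thesis using card_sphere[OF assms] by (simp add: ball_size_def)
qed

end

section \<open>A bound for the degree\<close>

context distance_transitive_metric begin

text \<open>The classes of the relation generated by pairs at distance two are the two halves of
  the space in the bipartite case; only functions that are not constant on them separate
  points at distance two.\<close>

definition sim :: "'a \<Rightarrow> 'a \<Rightarrow> bool" where
  "sim = (\<lambda>x y. x \<in> V \<and> y \<in> V \<and> d x y = 2)\<^sup>*\<^sup>*"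

lemma sim_refl [simp]: "sim x x"
  by (simp add: sim_def)

lemma sim_trans: "sim x y \<Longrightarrow> sim y z \<Longrightarrow> sim x z"
  unfolding sim_def by (rule rtranclp_trans)

lemma sim_step: "x \<in> V \<Longrightarrow> y \<in> V \<Longrightarrow> d x y = 2 \<Longrightarrow> sim x y"
  unfolding sim_def by (rule r_into_rtranclp) simp

lemma sim_sym: "sim x y \<Longrightarrow> sim y x"
proof -
  have "symp (\<lambda>x y. x \<in> V \<and> y \<in> V \<and> d x y = 2)" using d_sym by (auto intro!: sympI)
  then show "sim x y \<Longrightarrow> sim y x" unfolding sim_def by (meson sympD symp_rtranclp)
qed

lemma even_sim: "x \<in> V \<Longrightarrow> y \<in> V \<Longrightarrow> even (d x y) \<Longrightarrow> sim x y"
proof (induction "d x y" arbitrary: y rule: less_induct)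
  case less
  show ?case
  proof (cases "d x y = 0")
    case True
    then show ?thesis using less.prems d_zero_iff by simp
  next
    case False
    then have ge: "d x y \<ge> 2" using less.prems by presburger
    obtain z where z: "z \<in> V" "d x z = d x y - 2" "d z y = d x y - (d x y - 2)"
      using geodesic_point[OF less.prems(1,2), of "d x y - 2"] by auto
    have "sim x z" using less.hyps[of z] z ge less.prems by auto
    moreover have "sim z y" using sim_step z less.prems ge by auto
    ultimately show ?thesis by (rule sim_trans)
  qed
qed

lemma isom_sim: assumes "isom \<phi>" "sim x y" shows "sim (\<phi> x) (\<phi> y)"
  using assms(2) unfolding sim_def
proof (induction rule: rtranclp_induct)
  case (step y z)
  then have "\<phi> y \<in> V \<and> \<phi> z \<in> V \<and> d (\<phi> y) (\<phi> z) = 2"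
    using isom_dist[OF assms(1)] isom_in[OF assms(1)] by simp
  then show ?case using step.IH by (rule rtranclp.rtrancl_into_rtrancl[rotated])
qed simp

lemma isom_sim_iff:
  assumes "isom \<phi>" "x \<in> V" "y \<in> V" shows "sim (\<phi> x) (\<phi> y) \<longleftrightarrow> sim x y"
proof -
  obtain \<psi> where \<psi>: "isom \<psi>" "\<forall>x\<in>V. \<psi> (\<phi> x) = x"
    using isom_inverse[OF assms(1)] by blast
  have "sim x y" if "sim (\<phi> x) (\<phi> y)"
    using isom_sim[OF \<psi>(1) that] \<psi>(2) assms by simp
  then show ?thesis using isom_sim[OF assms(1)] by blast
qed

section \<open>Averaging over balls inside the classes of \<open>sim\<close>\<close>

definition sim_kernel :: "nat \<Rightarrow> 'a \<Rightarrow> 'a \<Rightarrow> real" where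
  "sim_kernel r x y = (if d x y \<le> r \<and> sim x y then 1 else 0)"

text \<open>The orthogonal complement of the functions constant on classes: a nonzero member is not
  constant on some class and hence separates some pair at distance two.\<close>

definition class_null :: "('a \<Rightarrow> real) set" where
  "class_null = {f. (\<forall>x. x \<notin> V \<longrightarrow> f x = 0) \<and> (\<forall>x\<in>V. (\<Sum>y\<in>{y \<in> V. sim x y}. f y) = 0)}"

lemma closed_class_null: "closed class_null"
proof -
  have "class_null = (\<Inter>x\<in>-V. {f. f x = 0}) \<inter> (\<Inter>x\<in>V. {f. (\<Sum>y\<in>{y \<in> V. sim x y}. f y) = 0})"
    by (auto simp: class_null_def)
  then show ?thesis
    by (simp only:)
      (intro closed_Int closed_INT ballI closed_Collect_eq continuous_on_sum continuous_on_eval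
        continuous_on_const)
qed

text \<open>Such a column sum counts the points of the class of \<open>z\<close> near
  \<open>z\<close>, a number independent of \<open>z\<close> by homogeneity. Hence the kernel
  preserves vanishing class sums.\<close>

lemma sim_kernel_sum:
  "\<exists>N. \<forall>x\<in>V. \<forall>z\<in>V. (\<Sum>y\<in>{y \<in> V. sim x y}. sim_kernel r y z) = (if sim x z then N else (0::real))"
proof -
  obtain v where v: "v \<in> V" using V_ne by blast
  define n where "n z = card {y \<in> V. d y z \<le> r \<and> sim y z}" for z
  have n: "n z = n z'" if zz: "z \<in> V" "z' \<in> V" for z z'
  proof -
    obtain \<phi> where \<phi>: "isom \<phi>" "\<phi> z = z'" 
      by (rule isom_pair[OF zz(1,1) zz(2,2)]) (use zz in simp_all)
    show ?thesis unfolding n_def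
      using isom_dist[OF \<phi>(1) _ zz(1)] isom_sim_iff[OF \<phi>(1) _ zz(1)] \<phi>(2)
      by (intro isom_card[OF \<phi>(1)]) auto
  qed
  have "(\<Sum>y\<in>{y \<in> V. sim x y}. sim_kernel r y z) = (if sim x z then real (n v) else 0)"
    if "x \<in> V" "z \<in> V" for x z
  proof (cases "sim x z")
    case True
    have "{y \<in> V. d y z \<le> r \<and> sim y z} \<subseteq> {y \<in> V. sim x y}"
      using sim_trans[OF True sim_sym] by blast
    then have "(\<Sum>y\<in>{y \<in> V. sim x y}. sim_kernel r y z) = (\<Sum>y\<in>{y \<in> V. d y z \<le> r \<and> sim y z}. 1)"
      using finV by (intro sum.mono_neutral_cong_right) (auto simp: sim_kernel_def)
    then show ?thesis using True n[of z v] that v by (simp add: n_def)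
  next
    case False
    then have "(\<Sum>y\<in>{y \<in> V. sim x y}. sim_kernel r y z) = 0"
      using sim_trans[of x _ z] by (intro sum.neutral) (auto simp: sim_kernel_def)
    then show ?thesis using False by simp
  qed
  then show ?thesis using v by (intro exI[of _ "real (n v)"]) blast
qed

lemma kernel_space_sim: "kernel_space V (sim_kernel r) class_null"
proof
  fix f assume f: "f \<in> class_null"
  obtain N where N: "\<forall>x\<in>V. \<forall>z\<in>V.
    (\<Sum>y\<in>{y \<in> V. sim x y}. sim_kernel r y z) = (if sim x z then N else (0::real))"
    using sim_kernel_sum by blast
  have "(\<Sum>y\<in>{y \<in> V. sim x y}. kernel_op V (sim_kernel r) f y) = 0" if x: "x \<in> V" for x
  proof -
    have "(\<Sum>y\<in>{y \<in> V. sim x y}. kernel_op V (sim_kernel r) f y)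
        = (\<Sum>y\<in>{y \<in> V. sim x y}. \<Sum>z\<in>V. sim_kernel r y z * f z)"
      by (intro sum.cong) (auto simp: kernel_op_def)
    also have "\<dots> = (\<Sum>z\<in>V. (\<Sum>y\<in>{y \<in> V. sim x y}. sim_kernel r y z) * f z)"
      by (subst sum.swap) (simp add: sum_distrib_right)
    also have "\<dots> = (\<Sum>z\<in>V. if sim x z then N * f z else 0)"
      using N x by (intro sum.cong) auto
    also have "\<dots> = (\<Sum>z\<in>{z \<in> V. sim x z}. N * f z)"
      using finV by (subst sum.inter_filter) auto
    also have "\<dots> = N * (\<Sum>z\<in>{z \<in> V. sim x z}. f z)" by (simp add: sum_distrib_left)
    finally show ?thesis using f x by (simp add: class_null_def)
  qed
  then show "kernel_op V (sim_kernel r) f \<in> class_null"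
    by (auto simp: class_null_def kernel_op_def)
next
  fix f g :: "'a \<Rightarrow> real" and a b assume "f \<in> class_null" "g \<in> class_null"
  then show "(\<lambda>x. a * f x + b * g x) \<in> class_null"
    by (auto simp: class_null_def sum.distrib simp flip: sum_distrib_left)
next
  fix x y assume "x \<in> V" "y \<in> V"
  then show "sim_kernel r x y = sim_kernel r y x"
    using d_sym sim_sym by (auto simp: sim_kernel_def)
next
  show "finite V" by (rule finV)
  show "closed class_null" by (rule closed_class_null)
  show "f x = 0" if "f \<in> class_null" "x \<notin> V" for f x using that by (simp add: class_null_def)
qed

text \<open>Restricting to even distances keeps the ball inside one class of \<open>sim\<close>,
  bipartite or not.\<close>

definition even_ball :: "nat \<Rightarrow> 'a \<Rightarrow> 'a set" where
  "even_ball s x = {z \<in> V. d x z \<le> s \<and> even (d x z)}"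

definition even_ball_size :: "nat \<Rightarrow> nat" where
  "even_ball_size s = card (even_ball s (SOME x. x \<in> V))"

lemma card_even_ball: "x \<in> V \<Longrightarrow> card (even_ball s x) = even_ball_size s"
proof -
  assume x: "x \<in> V"
  have "(SOME x. x \<in> V) \<in> V" using V_ne some_in_eq by blast
  then show ?thesis unfolding even_ball_size_def even_ball_def
    by (intro card_pair_eq[where P = "\<lambda>m n. m \<le> s \<and> even m" and y = x and y' = "SOME x. x \<in> V"])
      (use x in auto)
qed

lemma even_ball_size_pos: "0 < even_ball_size s"
proof -
  obtain x where x: "x \<in> V" using V_ne by blast
  then have "x \<in> even_ball s x" by (simp add: even_ball_def)
  then have "card (even_ball s x) > 0" using finV by (auto simp: card_gt_0_iff even_ball_def)
  then show ?thesis using card_even_ball[OF x] by simp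
qed

text \<open>The test function is the difference of the indicators of two even balls of radius
  \<open>s\<close>. The kernel of radius \<open>2 * s\<close> is 1 within each ball and 0 between
  them, so on the balls it multiplies the function by their size.\<close>

lemma sim_kernel_test_function:
  assumes "4 * s + 2 \<le> diam"
  obtains h where "h \<in> class_null" "inner_on V h h > 0"
    "real (even_ball_size s) * inner_on V h h \<le> inner_on V (kernel_op V (sim_kernel (2 * s)) h) h"
proof -
  obtain x where x: "x \<in> V" using V_ne by blast
  \<comment> \<open>The distance is even, so both balls lie in one class and cancel in its sum, and
    it exceeds \<open>4 * s\<close>, so the kernel does not reach from one ball to the
    other.\<close>
  obtain y where y: "y \<in> V" "d x y = 4 * s + 2" using point_at_distance[OF x assms] .
  let ?A = "even_ball s x" and ?B = "even_ball s y"
  define \<alpha> where "\<alpha> = even_ball_size s"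
  define h where "h = (\<lambda>z. (if z \<in> ?A then 1 else 0) - (if z \<in> ?B then 1 else (0::real)))"
  have cA: "card ?A = \<alpha>" "card ?B = \<alpha>" using card_even_ball x y by (auto simp: \<alpha>_def)
  have sub: "?A \<subseteq> V" "?B \<subseteq> V" by (auto simp: even_ball_def)
  have fin: "finite ?A" "finite ?B" using sub finV finite_subset by auto
  have xy: "sim x y" using even_sim x y by simp
  have simA: "sim x z" if "z \<in> ?A" for z using that even_sim x by (auto simp: even_ball_def)
  have simB: "sim x z" if "z \<in> ?B" for z
    using that even_sim[OF y(1)] sim_trans[OF xy] by (auto simp: even_ball_def)
  have far: "d z w > 2 * s" if "z \<in> ?A" "w \<in> ?B" for z w
  proof -
    have zw: "z \<in> V" "w \<in> V" using that sub by auto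
    have "d x y \<le> d x z + d z y" "d z y \<le> d z w + d w y" "d w y = d y w"
      using d_tri[OF x zw(1) y(1)] d_tri[OF zw y(1)] d_sym[OF zw(2) y(1)] by auto
    then show ?thesis using that y by (auto simp: even_ball_def)
  qed
  have near: "d z w \<le> 2 * s" if "z \<in> even_ball s v" "w \<in> even_ball s v" "v \<in> V" for z w v
  proof -
    have "d z w \<le> d z v + d v w" "d z v = d v z"
      using that d_tri[of z v w] d_sym[of z v] by (auto simp: even_ball_def)
    then show ?thesis using that by (auto simp: even_ball_def)
  qed
  have disj: "?A \<inter> ?B = {}"
  proof (rule ccontr)
    assume "?A \<inter> ?B \<noteq> {}"
    then obtain z where z: "z \<in> ?A" "z \<in> ?B" by blast
    then have "d z z > 2 * s" using far by blast
    then show False using z by (simp add: even_ball_def)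
  qed
  have sum_h: "(\<Sum>z\<in>S. g z * h z) = (\<Sum>z\<in>S \<inter> ?A. g z) - (\<Sum>z\<in>S \<inter> ?B. g z)" if "finite S"
    for S and g :: "'a \<Rightarrow> real"
  proof -
    have "g z * h z = (if z \<in> ?A then g z else 0) - (if z \<in> ?B then g z else 0)" for z
      by (simp add: h_def)
    then show ?thesis using that by (simp add: sum_subtractf sum.inter_restrict)
  qed
  have "h \<in> class_null"
  proof -
    have "(\<Sum>z\<in>{z \<in> V. sim v z}. h z) = 0" for v
    proof (cases "sim v x")
      case True
      then have "{z \<in> V. sim v z} \<inter> ?A = ?A" "{z \<in> V. sim v z} \<inter> ?B = ?B"
        using simA simB sim_trans[OF True] sub by auto
      then show ?thesis using sum_h[of "{z \<in> V. sim v z}" "\<lambda>_. 1"] finV cA by simp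
    next
      case False
      have "\<not> sim v z" if "sim x z" for z using False sim_trans[of v z x] sim_sym[OF that] by blast
      then have "{z \<in> V. sim v z} \<inter> ?A = {}" "{z \<in> V. sim v z} \<inter> ?B = {}"
        using simA simB by blast+
      then show ?thesis using sum_h[of "{z \<in> V. sim v z}" "\<lambda>_. 1"] finV by simp
    qed
    then show ?thesis using sub by (auto simp: class_null_def h_def)
  qed
  moreover have hh: "inner_on V h h = 2 * real \<alpha>"
  proof -
    have "inner_on V h h = (\<Sum>z\<in>?A. h z) - (\<Sum>z\<in>?B. h z)"
      unfolding inner_on_def using sum_h[OF finV, of h] sub by (simp add: Int_absorb1)
    also have "\<dots> = (\<Sum>z\<in>?A. 1) - (\<Sum>z\<in>?B. - 1)"
      using disj by (intro arg_cong2[of _ _ _ _ minus] sum.cong) (auto simp: h_def)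
    finally show ?thesis using cA by simp
  qed
  moreover have "inner_on V (kernel_op V (sim_kernel (2 * s)) h) h = 2 * (real \<alpha>)\<^sup>2"
  proof -
    let ?Kh = "kernel_op V (sim_kernel (2 * s)) h"
    have Kh: "?Kh z = (\<Sum>w\<in>?A. sim_kernel (2 * s) z w) - (\<Sum>w\<in>?B. sim_kernel (2 * s) z w)" if "z \<in> V" for z
      using that sum_h[OF finV, of "sim_kernel (2 * s) z"] sub by (simp add: kernel_op_def Int_absorb1)
    have KA: "?Kh z = \<alpha>" if z: "z \<in> ?A" for z
    proof -
      have "(\<Sum>w\<in>?A. sim_kernel (2 * s) z w) = (\<Sum>w\<in>?A. 1)"
        using near[OF z _ x] sim_trans[OF sim_sym[OF simA[OF z]]] simA
        by (intro sum.cong) (auto simp: sim_kernel_def)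
      moreover have "(\<Sum>w\<in>?B. sim_kernel (2 * s) z w) = 0"
        using far[OF z] by (intro sum.neutral) (fastforce simp: sim_kernel_def)
      ultimately show ?thesis using Kh[of z] z sub cA by auto
    qed
    have KB: "?Kh z = - \<alpha>" if z: "z \<in> ?B" for z
    proof -
      have "(\<Sum>w\<in>?B. sim_kernel (2 * s) z w) = (\<Sum>w\<in>?B. 1)"
        using near[OF z _ y(1)] sim_trans[OF sim_sym[OF simB[OF z]]] simB
        by (intro sum.cong) (auto simp: sim_kernel_def)
      moreover have "sim_kernel (2 * s) z w = 0" if "w \<in> ?A" for w
      proof -
        have "d z w = d w z" using d_sym z that sub by auto
        then show ?thesis using far[OF that z] by (simp add: sim_kernel_def)
      qed
      then have "(\<Sum>w\<in>?A. sim_kernel (2 * s) z w) = 0" by simp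
      ultimately show ?thesis using Kh[of z] z sub cA by auto
    qed
    have "inner_on V ?Kh h = (\<Sum>z\<in>?A. ?Kh z) - (\<Sum>z\<in>?B. ?Kh z)"
      unfolding inner_on_def using sum_h[OF finV, of ?Kh] sub by (simp add: Int_absorb1)
    then show ?thesis using KA KB cA by (simp add: power2_eq_square)
  qed
  moreover have "\<alpha> > 0" using even_ball_size_pos by (simp add: \<alpha>_def)
  ultimately show ?thesis using that[of h] by (simp add: \<alpha>_def power2_eq_square)
qed

text \<open>Isometries preserve both \<open>d\<close> and \<open>sim\<close>, hence the kernel and
  the class sums. The cut-off is there because \<open>\<phi>\<close> is arbitrary off
  \<open>V\<close>.\<close>

lemma pullback_eigenspace:
  assumes \<phi>: "isom \<phi>" and f: "f \<in> kernel_space.eigenspace V (sim_kernel r) class_null l"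
  shows "(\<lambda>y. if y \<in> V then f (\<phi> y) else 0) \<in> kernel_space.eigenspace V (sim_kernel r) class_null l"
proof -
  interpret K: kernel_space V "sim_kernel r" class_null by (rule kernel_space_sim)
  let ?g = "\<lambda>y. if y \<in> V then f (\<phi> y) else 0"
  have bij: "bij_betw \<phi> V V" using \<phi> by (simp add: isom_def)
  have fc: "f \<in> class_null" and fe: "kernel_op V (sim_kernel r) f = (\<lambda>x. l * f x)"
    using f by (auto simp: K.eigenspace_def)
  have "(\<Sum>y\<in>{y \<in> V. sim x y}. ?g y) = 0" if x: "x \<in> V" for x
  proof -
    have b: "bij_betw \<phi> {y \<in> V. sim x y} {y \<in> V. sim (\<phi> x) y}"
      using bij isom_sim_iff[OF \<phi> x] by (fastforce simp: bij_betw_def inj_on_def)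
    have "(\<Sum>y\<in>{y \<in> V. sim x y}. ?g y) = (\<Sum>y\<in>{y \<in> V. sim x y}. f (\<phi> y))"
      by (intro sum.cong) auto
    also have "\<dots> = (\<Sum>y\<in>{y \<in> V. sim (\<phi> x) y}. f y)" by (rule sum.reindex_bij_betw[OF b])
    finally show ?thesis using fc isom_in[OF \<phi> x] by (simp add: class_null_def)
  qed
  then have gc: "?g \<in> class_null" by (auto simp: class_null_def)
  have "kernel_op V (sim_kernel r) ?g x = l * ?g x" for x
  proof (cases "x \<in> V")
    case True
    have "kernel_op V (sim_kernel r) ?g x = (\<Sum>y\<in>V. sim_kernel r (\<phi> x) (\<phi> y) * f (\<phi> y))"
      using True isom_sim_iff[OF \<phi> True] isom_dist[OF \<phi> True]
      by (auto simp: kernel_op_def sim_kernel_def intro!: sum.cong)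
    also have "\<dots> = (\<Sum>y\<in>V. sim_kernel r (\<phi> x) y * f y)"
      using sum.reindex_bij_betw[OF bij, of "\<lambda>y. sim_kernel r (\<phi> x) y * f y"] .
    also have "\<dots> = l * f (\<phi> x)"
      using fun_cong[OF fe, of "\<phi> x"] isom_in[OF \<phi> True] by (simp add: kernel_op_def)
    finally show ?thesis using True by simp
  qed (simp add: kernel_op_def)
  then show ?thesis unfolding K.eigenspace_def using gc by (intro CollectI conjI ext)
qed

text \<open>Many neighbours of x would, by Ramsey, contain many points at equal mutual distance.  The
  projection onto the eigenspace commutes with isometries, so its kernel P is a function of the
  distance, and differences of P at disjoint pairs of these points are orthogonal: too many
  orthogonal eigenfunctions for the Hilbert--Schmidt norm.\<close>

lemma degree_less:
  assumes diam: "4 * s + 2 \<le> diam"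
    and M: "card V \<le> M * even_ball_size s"
    and ramsey: "\<And>(S :: 'a set) E. finite S \<Longrightarrow> N \<le> card S \<Longrightarrow>
      \<exists>R\<subseteq>S. card R = 2 * (M\<^sup>2 + 1) \<and> clique R E \<or> card R = 2 * (M\<^sup>2 + 1) \<and> indep R E"
  shows "sphere_size 1 < N"
proof (rule ccontr)
  assume "\<not> sphere_size 1 < N"
  interpret K: kernel_space V "sim_kernel (2 * s)" class_null by (rule kernel_space_sim)
  define \<alpha> where "\<alpha> = even_ball_size s"
  have \<alpha>: "\<alpha> > 0" using even_ball_size_pos by (simp add: \<alpha>_def)
  obtain h where h: "h \<in> class_null" "inner_on V h h > 0"
    "real \<alpha> * inner_on V h h \<le> inner_on V (kernel_op V (sim_kernel (2 * s)) h) h"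
    unfolding \<alpha>_def using sim_kernel_test_function[OF diam] .
  obtain l f where l: "real \<alpha> \<le> l" and f: "f \<in> class_null" "inner_on V f f = 1"
    "kernel_op V (sim_kernel (2 * s)) f = (\<lambda>x. l * f x)"
    using K.top_eigenvector[OF h] .
  have l0: "l > 0" using l \<alpha> by linarith
  have fe: "f \<in> K.eigenspace l" using f by (simp add: K.eigenspace_def)
  obtain P where "(\<forall>x. P x \<in> K.eigenspace l) \<and> (\<forall>g\<in>K.eigenspace l. \<forall>x\<in>V. inner_on V (P x) g = g x)
    \<and> (\<forall>x y. P x y = P y x)"
    using K.reproducing_kernel_exists[of l f] l0 fe f(2) by auto
  then have P: "\<And>x. P x \<in> K.eigenspace l"
    "\<And>g x. g \<in> K.eigenspace l \<Longrightarrow> x \<in> V \<Longrightarrow> inner_on V (P x) g = g x" "\<And>x y. P x y = P y x"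
    by simp_all
  have PP: "inner_on V (P x) (P y) = P x y" if "x \<in> V" for x y
    using P(2)[OF P(1)[of y] that] P(3)[of y x] by simp
  \<comment> \<open>The pullback of \<open>P (\<phi> x)\<close> along \<open>\<phi>\<close> is an
    eigenfunction representing evaluation at \<open>x\<close>, so by uniqueness it is
    \<open>P x\<close>.\<close>
  have inv: "P (\<phi> x) (\<phi> y) = P x y" if \<phi>: "isom \<phi>" and x: "x \<in> V" and y: "y \<in> V" for \<phi> x y
  proof -
    obtain \<psi> where \<psi>: "isom \<psi>" "\<forall>x\<in>V. \<psi> (\<phi> x) = x"
      using isom_inverse[OF \<phi>] by blast
    have bij: "bij_betw \<phi> V V" using \<phi> by (simp add: isom_def)
    let ?g = "\<lambda>y. if y \<in> V then P (\<phi> x) (\<phi> y) else 0"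
    have ge: "?g \<in> K.eigenspace l" using pullback_eigenspace[OF \<phi> P(1)] by simp
    have "inner_on V ?g u = u x" if u: "u \<in> K.eigenspace l" for u
    proof -
      let ?w = "\<lambda>y. if y \<in> V then u (\<psi> y) else 0"
      have we: "?w \<in> K.eigenspace l" using pullback_eigenspace[OF \<psi>(1) u] by simp
      have "inner_on V ?g u = (\<Sum>y\<in>V. P (\<phi> x) (\<phi> y) * ?w (\<phi> y))"
        unfolding inner_on_def using \<psi>(2) isom_in[OF \<phi>] by (intro sum.cong) auto
      also have "\<dots> = (\<Sum>y\<in>V. P (\<phi> x) y * ?w y)"
        by (rule sum.reindex_bij_betw[OF bij, of "\<lambda>y. P (\<phi> x) y * ?w y"])
      also have "\<dots> = ?w (\<phi> x)" using P(2)[OF we isom_in[OF \<phi> x]] by (simp add: inner_on_def)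
      finally show ?thesis using \<psi>(2) x isom_in[OF \<phi> x] by simp
    qed
    then have "?g y = P x y" using K.reproducing_kernel_unique[OF P(1) P(2)[OF _ x] ge _ y] by simp
    then show ?thesis using y by simp
  qed
  have Pd: "P x y = P x' y'" if xy: "x \<in> V" "y \<in> V" "x' \<in> V" "y' \<in> V" "d x y = d x' y'" for x y x' y'
  proof -
    obtain \<phi> where "isom \<phi>" "\<phi> x = x'" "\<phi> y = y'" using isom_pair[OF xy] .
    then show ?thesis using inv[of \<phi> x y] xy by simp
  qed
  \<comment> \<open>The hypothesis makes the squared norm of \<open>P x - P y\<close> zero, so no
    eigenfunction separates \<open>x\<close> from \<open>y\<close>.\<close>
  have eqP: "u y = u x" if "x \<in> V" "y \<in> V" "P x y = P x x" "u \<in> K.eigenspace l" for x y u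
  proof -
    have "P y y = P x x" using Pd[of y y x x] that by simp
    then have "inner_on V (\<lambda>z. P x z - P y z) (\<lambda>z. P x z - P y z) = 0"
      unfolding inner_on_diff_self using that by (simp add: PP)
    then have "P x z = P y z" if "z \<in> V" for z
      using inner_on_self_eq_0[OF finV _ that] by fastforce
    then have "inner_on V (P x) u = inner_on V (P y) u" by (simp add: inner_on_def)
    then show ?thesis using P(2) that by simp
  qed
  \<comment> \<open>A function constant on the classes with vanishing class sums is zero, whereas
    \<open>f\<close> has norm one.\<close>
  have nontriv: "\<exists>u\<in>V. \<exists>v\<in>V. d u v = 2 \<and> f u \<noteq> f v"
  proof (rule ccontr)
    assume neg: "\<not> ?thesis"
    have const: "f y = f x" if "sim x y" for x y
      using that unfolding sim_def
    proof (induction rule: rtranclp_induct)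
      case (step y z)
      then show ?case using neg by metis
    qed simp
    have "f x = 0" if x: "x \<in> V" for x
    proof -
      have "0 = (\<Sum>y\<in>{y \<in> V. sim x y}. f y)" using f(1) x by (simp add: class_null_def)
      also have "\<dots> = (\<Sum>y\<in>{y \<in> V. sim x y}. f x)" using const by (intro sum.cong) auto
      also have "\<dots> = real (card {y \<in> V. sim x y}) * f x" by simp
      finally have "card {y \<in> V. sim x y} = 0 \<or> f x = 0" by simp
      then show ?thesis using finV x by (auto simp: card_eq_0_iff dest: spec[of _ x])
    qed
    then show False using f(2) by (simp add: inner_on_def)
  qed
  \<comment> \<open>By \<open>Pd\<close>, a coincidence at one pair at distance two occurs at all of
    them, and then \<open>f\<close> separates none.\<close>
  have P2: "P x y \<noteq> P x x" if xy: "x \<in> V" "y \<in> V" "d x y = 2" for x y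
  proof
    assume eq: "P x y = P x x"
    have "f u = f v" if "u \<in> V" "v \<in> V" "d u v = 2" for u v
    proof -
      have "P u v = P u u" using eq Pd[of u v x y] Pd[of u u x x] that xy by simp
      then show ?thesis using eqP[of u v f] fe that by simp
    qed
    then show False using nontriv by blast
  qed
  \<comment> \<open>A coincidence at distance one would pass to distance two through a middle
    point.\<close>
  have P1: "P x y \<noteq> P x x" if xy: "x \<in> V" "y \<in> V" "d x y = 1" for x y
  proof
    assume eq: "P x y = P x x"
    have f1: "f u = f v" if "u \<in> V" "v \<in> V" "d u v = 1" for u v
    proof -
      have "P u v = P u u" using eq Pd[of u v x y] Pd[of u u x x] that xy by simp
      then show ?thesis using eqP[of u v f] fe that by simp
    qed
    have "f u = f v" if uv: "u \<in> V" "v \<in> V" "d u v = 2" for u v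
    proof -
      obtain w where w: "w \<in> V" "d u w = 1" "d w v = 2 - 1"
        using geodesic_point[OF uv(1,2), of 1] uv(3) by auto
      show ?thesis using f1[OF uv(1) w(1,2)] f1[OF w(1) uv(2)] w(3) by simp
    qed
    then show False using nontriv by blast
  qed
  obtain x where x: "x \<in> V" using V_ne by blast
  let ?S = "{z \<in> V. d x z = 1}"
  \<comment> \<open>One more than the dimension bound reached at the end; \<open>R\<close> supplies
    two points for each of \<open>?m\<close> difference functions.\<close>
  let ?m = "M\<^sup>2 + 1"
  have "N \<le> card ?S" using card_sphere[OF x, of 1] \<open>\<not> sphere_size 1 < N\<close> by simp
  then obtain R where R: "R \<subseteq> ?S" "card R = 2 * ?m"
      "clique R {{u, v} |u v. u \<in> V \<and> v \<in> V \<and> d u v = 1} \<or> indep R {{u, v} |u v. u \<in> V \<and> v \<in> V \<and> d u v = 1}"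
    using ramsey[of ?S "{{u, v} |u v. u \<in> V \<and> v \<in> V \<and> d u v = 1}"] finV by auto
  have RV: "R \<subseteq> V" using R(1) by auto
  have le2: "d u v \<in> {1, 2}" if "u \<in> R" "v \<in> R" "u \<noteq> v" for u v
  proof -
    have uv: "u \<in> V" "v \<in> V" using that RV by auto
    have "d u v \<le> d u x + d x v" "d u x = d x u"
      using d_tri[OF uv(1) x uv(2)] d_sym[OF uv(1) x] by auto
    moreover have "d x u = 1" "d x v = 1" using that R(1) by auto
    moreover have "d u v \<noteq> 0" using d_zero_iff[OF uv] that by auto
    ultimately show ?thesis by auto
  qed
  obtain e where e: "e \<in> {1, 2}" "\<And>u v. u \<in> R \<Longrightarrow> v \<in> R \<Longrightarrow> u \<noteq> v \<Longrightarrow> d u v = e"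
    using R(3)
  proof
    assume c: "clique R {{u, v} |u v. u \<in> V \<and> v \<in> V \<and> d u v = 1}"
    have "d u v = 1" if "u \<in> R" "v \<in> R" "u \<noteq> v" for u v
    proof -
      have "{u, v} \<in> {{u, v} |u v. u \<in> V \<and> v \<in> V \<and> d u v = 1}" using c that by (auto simp: clique_def)
      then show ?thesis using d_sym by (auto simp: doubleton_eq_iff)
    qed
    then show thesis using that[of 1] by simp
  next
    assume c: "indep R {{u, v} |u v. u \<in> V \<and> v \<in> V \<and> d u v = 1}"
    have "d u v = 2" if "u \<in> R" "v \<in> R" "u \<noteq> v" for u v
    proof -
      have "{u, v} \<notin> {{u, v} |u v. u \<in> V \<and> v \<in> V \<and> d u v = 1}" using c that by (auto simp: indep_def)
      then have "d u v \<noteq> 1" using that RV by blast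
      then show ?thesis using le2[OF that] by simp
    qed
    then show thesis using that[of 2] by simp
  qed
  have finR: "finite R" using RV finV finite_subset by blast
  obtain q where q: "bij_betw q {0..<2 * ?m} R"
    using ex_bij_betw_nat_finite[OF finR] R(2) by auto
  have qR: "q i \<in> R" if "i < 2 * ?m" for i using q that by (auto simp: bij_betw_def)
  have qinj: "q i = q j \<longleftrightarrow> i = j" if "i < 2 * ?m" "j < 2 * ?m" for i j
    using q that by (auto simp: bij_betw_def inj_on_def)
  define p0 where "p0 = P x x"
  define p1 where "p1 = P (q 0) (q 1)"
  have Pq: "P (q i) (q j) = (if i = j then p0 else p1)" if ij: "i < 2 * ?m" "j < 2 * ?m" for i j
  proof (cases "i = j")
    case True
    then show ?thesis using Pd[of "q i" "q i" x x] qR[OF ij(1)] RV x by (auto simp: p0_def)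
  next
    case False
    have "d (q i) (q j) = e" "d (q 0) (q 1) = e"
      using e(2) qR qinj ij False by auto
    then show ?thesis
      using Pd[of "q i" "q j" "q 0" "q 1"] qR[OF ij(1)] qR[OF ij(2)] qR[of 0] qR[of 1] RV False
      by (auto simp: p1_def)
  qed
  have ne: "p1 \<noteq> p0"
  proof -
    have q01: "q 0 \<in> V" "q 1 \<in> V" "d (q 0) (q 1) = e"
      using qR[of 0] qR[of 1] RV e(2) qinj[of 0 1] by auto
    then have "P (q 0) (q 1) \<noteq> P (q 0) (q 0)" using e(1) P1[OF q01(1,2)] P2[OF q01(1,2)] by auto
    then show ?thesis using Pq[of 0 0] by (simp add: p1_def)
  qed
  \<comment> \<open>For disjoint pairs all mixed values of \<open>P\<close> equal \<open>p1\<close>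
    and cancel, so the \<open>G i\<close> are orthogonal, with squared norm
    \<open>2 * (p0 - p1)\<close>.\<close>
  define G where "G i = (\<lambda>z. P (q (2 * i)) z - P (q (2 * i + 1)) z)" for i
  have GG: "inner_on V (G i) (G j) = (if i = j then 2 * (p0 - p1) else 0)" if "i < ?m" "j < ?m" for i j
  proof -
    have in4: "2 * i < 2 * ?m" "2 * i + 1 < 2 * ?m" "2 * j < 2 * ?m" "2 * j + 1 < 2 * ?m"
      using that by auto
    have "inner_on V (G i) (G j) = P (q (2*i)) (q (2*j)) - P (q (2*i)) (q (2*j+1))
        - (P (q (2*i+1)) (q (2*j)) - P (q (2*i+1)) (q (2*j+1)))"
    proof -
      have "inner_on V (G i) (G j)
         = inner_on V (P (q (2*i))) (P (q (2*j))) - inner_on V (P (q (2*i))) (P (q (2*j+1)))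
         - (inner_on V (P (q (2*i+1))) (P (q (2*j))) - inner_on V (P (q (2*i+1))) (P (q (2*j+1))))"
        by (simp add: G_def inner_on_def sum_subtractf sum.distrib algebra_simps)
      moreover have "q (2*i) \<in> V" "q (2*i+1) \<in> V" using qR in4 RV by blast+
      ultimately show ?thesis by (simp add: PP)
    qed
    also have "\<dots> = (if i = j then 2 * (p0 - p1) else 0)"
    proof (cases "i = j")
      case False
      then have "2 * i + 1 \<noteq> 2 * j" "2 * i \<noteq> 2 * j + 1" by presburger+
      then show ?thesis using False by (simp only: Pq[OF in4(1,3)] Pq[OF in4(1,4)] Pq[OF in4(2,3)] Pq[OF in4(2,4)]) simp
    next
      case True
      then show ?thesis using Pq[OF in4(1,3)] Pq[OF in4(1,4)] Pq[OF in4(2,3)] Pq[OF in4(2,4)] by simp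
    qed
    finally show ?thesis .
  qed
  have "0 \<le> 2 * (p0 - p1)" using GG[of 0 0] inner_on_self_nonneg[of V "G 0"] by simp
  then have "p1 \<le> p0" by simp
  then have pos: "0 < p0 - p1" using ne by simp
  define \<beta> where "\<beta> = 1 / sqrt (2 * (p0 - p1))"
  have \<beta>: "\<beta> * (\<beta> * (2 * (p0 - p1))) = 1"
    using pos by (simp add: \<beta>_def) 
  define U where "U i = (\<lambda>z. \<beta> * G i z)" for i
  have Ge: "G i \<in> K.eigenspace l" for i
    using K.eigenspace_lincomb[OF P(1)[of "q (2*i)"] P(1)[of "q (2*i+1)"], of 1 "-1"] by (simp add: G_def)
  have Ue: "U i \<in> K.eigenspace l" for i
    using K.eigenspace_lincomb[OF Ge[of i] Ge[of i], of \<beta> 0] by (simp add: U_def)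
  have "orthonormal_on V {..<?m} U"
    unfolding orthonormal_on_def
  proof (intro ballI)
    fix i j assume "i \<in> {..<?m}" "j \<in> {..<?m}"
    then show "inner_on V (U i) (U j) = (if i = j then 1 else 0)"
      using \<beta> GG[of i j] by (simp add: U_def inner_on_scale_left inner_on_scale_right)
  qed
  \<comment> \<open>The kernel has entries at most 1, \<open>card V\<close> is at most
    \<open>M * \<alpha>\<close>, and \<open>\<alpha>\<close> is at most \<open>l\<close>; dividing
    by the square of \<open>l\<close> leaves the square of \<open>M\<close>.\<close>
  then have "real (card {..<?m}) * l\<^sup>2 \<le> (\<Sum>x\<in>V. \<Sum>y\<in>V. (sim_kernel (2 * s) x y)\<^sup>2)"
    using Ue by (intro K.eigenspace_orthonormal_bound) (auto simp: K.eigenspace_def)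
  also have "\<dots> \<le> (\<Sum>x\<in>V. \<Sum>y\<in>V. 1)" by (intro sum_mono) (auto simp: sim_kernel_def)
  also have "\<dots> = (real (card V))\<^sup>2" by (simp add: power2_eq_square)
  also have "\<dots> \<le> (real M * real \<alpha>)\<^sup>2"
    using M by (intro power_mono) (auto simp: \<alpha>_def simp flip: of_nat_mult)
  also have "\<dots> \<le> (real M)\<^sup>2 * l\<^sup>2"
    using l by (simp add: power_mult_distrib mult_left_mono power_mono)
  finally have "real ?m \<le> (real M)\<^sup>2" using l0 by simp
  then have "?m \<le> M\<^sup>2" by (metis of_nat_le_iff of_nat_power)
  then show False by simp
qed

end

section \<open>Ends\<close>

text \<open>\<open>cc\<close> is the common value of b and c between \<open>r\<close> and
  \<open>L\<close>. The bound \<open>7 * r + 4\<close> serves the count of ends, which uses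
  distances up to (4r + 2) + (3r + 1) and needs them below \<open>L\<close>.\<close>

locale constant_range = distance_transitive_metric +
  fixes r L cc :: nat
  assumes r_pos: "1 \<le> r" and L_large: "7 * r + 4 \<le> L" and L_diam: "L < diam"
    and b_const: "r \<le> i \<Longrightarrow> i \<le> L \<Longrightarrow> b_num i = cc"
    and c_const: "r \<le> i \<Longrightarrow> i \<le> L \<Longrightarrow> c_num i = cc"
begin

text \<open>The strict bounds leave a margin of one: arguments are repeated with a neighbour of
  \<open>x\<close> as centre, from which distances may be one smaller.\<close>

definition ann :: "'a \<Rightarrow> 'a \<Rightarrow> bool" where
  "ann x v \<longleftrightarrow> r < d x v \<and> d x v < L"

text \<open>Equal values of b and of c at consecutive distances turn the inclusions of
  \<open>b_set_mono\<close> and \<open>c_set_mono\<close> into equalities. So a step from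
  \<open>v\<close> leads away, back or sideways for \<open>x\<close> and \<open>w\<close>
  alike.\<close>

lemma farther_step:
  assumes "x \<in> V" "w \<in> V" "v \<in> V" "v' \<in> V" "d x w = 1" "d v v' = 1"
    and far: "d w v = Suc (d x v)" and "r \<le> d x v" "Suc (d x v) \<le> L"
  shows "d w v' = Suc (d x v')"
proof -
  let ?i = "d x v"
  have B: "{z \<in> V. d v z = 1 \<and> d w z = Suc (d w v)} = {z \<in> V. d v z = 1 \<and> d x z = Suc ?i}"
    using card_b[of w v] card_b[of x v] b_const[of ?i] b_const[of "Suc ?i"] assms finV
    by (intro card_subset_eq b_set_mono) auto
  have C: "{z \<in> V. d v z = 1 \<and> Suc (d x z) = ?i} = {z \<in> V. d v z = 1 \<and> Suc (d w z) = d w v}"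
    using card_c[of w v] card_c[of x v] c_const[of ?i] c_const[of "Suc ?i"] assms finV
    by (intro card_subset_eq c_set_mono) auto
  have 1: "d x v' = Suc ?i \<longleftrightarrow> d w v' = Suc (d w v)" using B assms(4,6) by auto
  have 2: "Suc (d x v') = ?i \<longleftrightarrow> Suc (d w v') = d w v" using C assms(4,6) by auto
  have 3: "d x v' \<le> Suc ?i" "?i \<le> Suc (d x v')" "d w v' \<le> Suc (d w v)" "d w v \<le> Suc (d w v')"
    using neighbour_dist[of x v v'] neighbour_dist[of w v v'] assms by auto
  show ?thesis using 1 2 3 far by linarith
qed

text \<open>The difference is -1, 0 or 1. The values 1 and -1 pass along the edge both ways, by
  exchanging \<open>x\<close> with \<open>w\<close> and \<open>v\<close> with \<open>v'\<close>;
  hence so does 0.\<close>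

lemma shift_step:
  assumes "x \<in> V" "w \<in> V" "v \<in> V" "v' \<in> V" "d x w = 1" "d v v' = 1" "ann x v" "ann x v'"
  shows "int (d w v') - int (d x v') = int (d w v) - int (d x v)"
proof -
  have wx: "d w x = 1" "d v' v = 1" using d_sym assms by auto
  have bnd: "d w v \<le> Suc (d x v)" "d x v \<le> Suc (d w v)" "d w v' \<le> Suc (d x v')" "d x v' \<le> Suc (d w v')"
    using neighbour_dist'[of v x w] neighbour_dist'[of v' x w] assms by auto
  have a: "d w v' = Suc (d x v')" if "d w v = Suc (d x v)"
    using assms(7) that by (intro farther_step[OF assms(1-6)]) (auto simp: ann_def)
  have b: "d x v' = Suc (d w v')" if "d x v = Suc (d w v)"
    using assms(7) that by (intro farther_step[OF assms(2,1,3,4) wx(1) assms(6)]) (auto simp: ann_def)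
  have c: "d w v = Suc (d x v)" if "d w v' = Suc (d x v')"
    using assms(8) that by (intro farther_step[OF assms(1,2,4,3,5) wx(2)]) (auto simp: ann_def)
  have e: "d x v = Suc (d w v)" if "d x v' = Suc (d w v')"
    using assms(8) that by (intro farther_step[OF assms(2,1,4,3) wx(1,2)]) (auto simp: ann_def)
  show ?thesis using a b c e bnd by linarith
qed

text \<open>The classes of \<open>conn x\<close> in the annulus around \<open>x\<close> are the ends
  of \<open>x\<close>.\<close>

definition conn :: "'a \<Rightarrow> 'a \<Rightarrow> 'a \<Rightarrow> bool" where
  "conn x = (\<lambda>u v. u \<in> V \<and> v \<in> V \<and> d u v = 1 \<and> ann x u \<and> ann x v)\<^sup>*\<^sup>*"

lemma conn_refl [simp]: "conn x u u"
  by (simp add: conn_def)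

lemma conn_trans: "conn x u v \<Longrightarrow> conn x v w \<Longrightarrow> conn x u w"
  unfolding conn_def by (rule rtranclp_trans)

lemma conn_sym: "conn x u v \<Longrightarrow> conn x v u"
proof -
  have "symp (\<lambda>u v. u \<in> V \<and> v \<in> V \<and> d u v = 1 \<and> ann x u \<and> ann x v)"
  proof (rule sympI)
    fix u v assume "u \<in> V \<and> v \<in> V \<and> d u v = 1 \<and> ann x u \<and> ann x v"
    then show "v \<in> V \<and> u \<in> V \<and> d v u = 1 \<and> ann x v \<and> ann x u" using d_sym[of u v] by simp
  qed
  from symp_rtranclp[OF this] show "conn x u v \<Longrightarrow> conn x v u" unfolding conn_def by (rule sympD)
qed

lemma conn_step: "u \<in> V \<Longrightarrow> v \<in> V \<Longrightarrow> d u v = 1 \<Longrightarrow> ann x u \<Longrightarrow> ann x v \<Longrightarrow> conn x u v"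
  unfolding conn_def by (rule r_into_rtranclp) simp

lemma conn_shift:
  assumes "conn x v v'" "x \<in> V" "w \<in> V" "d x w = 1"
  shows "int (d w v') - int (d x v') = int (d w v) - int (d x v)"
  using assms(1) unfolding conn_def
proof (induction rule: rtranclp_induct)
  case (step u v)
  then show ?case using shift_step[of x w u v] assms by simp
qed simp

lemma isom_conn:
  assumes "isom \<phi>" "x \<in> V" "conn x u v" shows "conn (\<phi> x) (\<phi> u) (\<phi> v)"
  using assms(3) unfolding conn_def
proof (induction rule: rtranclp_induct)
  case (step y z)
  then have "\<phi> y \<in> V \<and> \<phi> z \<in> V \<and> d (\<phi> y) (\<phi> z) = 1 \<and> ann (\<phi> x) (\<phi> y) \<and> ann (\<phi> x) (\<phi> z)"
    using isom_dist[OF assms(1)] isom_in[OF assms(1)] assms(2) by (simp add: ann_def)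
  then show ?case using step.IH by (rule rtranclp.rtrancl_into_rtrancl[rotated])
qed simp

lemma isom_conn_iff:
  assumes "isom \<phi>" "x \<in> V" "u \<in> V" "v \<in> V"
  shows "conn (\<phi> x) (\<phi> u) (\<phi> v) \<longleftrightarrow> conn x u v"
proof -
  obtain \<psi> where \<psi>: "isom \<psi>" "\<forall>x\<in>V. \<psi> (\<phi> x) = x"
    using isom_inverse[OF assms(1)] by blast
  have "conn x u v" if "conn (\<phi> x) (\<phi> u) (\<phi> v)"
    using isom_conn[OF \<psi>(1) isom_in[OF assms(1,2)] that] \<psi>(2) assms by simp
  then show ?thesis using isom_conn[OF assms(1,2)] by blast
qed

text \<open>One geodesic inside the annulus is enough. The hypothesis covers every point between
  \<open>z\<close> and \<open>v\<close>, so that the contrapositive produces such a point outside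
  the annulus.\<close>

lemma conn_geodesic:
  assumes "x \<in> V" "z \<in> V" "v \<in> V" "\<And>u. u \<in> V \<Longrightarrow> d z u + d u v = d z v \<Longrightarrow> ann x u"
  shows "conn x z v"
  using assms(3,4)
proof (induction "d z v" arbitrary: v)
  case 0
  then show ?case using d_zero_iff[OF assms(2), of v] by simp
next
  case (Suc n)
  obtain w where w: "w \<in> V" "d z w = n" "d w v = 1"
    using d_step[OF assms(2) Suc.prems(1), of n] Suc.hyps(2) by auto
  have between: "ann x u" if u: "u \<in> V" "d z u + d u w = d z w" for u
  proof -
    have "d u v \<le> d u w + d w v" "d z v \<le> d z u + d u v"
      using d_tri[OF u(1) w(1) Suc.prems(1)] d_tri[OF assms(2) u(1) Suc.prems(1)] by auto
    then show ?thesis using Suc.prems(2)[OF u(1)] u(2) w Suc.hyps(2) by simp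
  qed
  have "conn x z w" using Suc.hyps(1)[of w] w between by simp
  moreover have "ann x w" using between[OF w(1)] w(1) by simp
  moreover have "ann x v" using Suc.prems(2)[OF Suc.prems(1)] Suc.prems(1) by simp
  ultimately show ?case using conn_step[OF w(1) Suc.prems(1) w(3)] conn_trans by blast
qed

lemma cc_pos: "0 < cc"
  using b_pos[of r] b_const[of r] L_large L_diam by simp

lemma sphere_size_const:
  assumes "r \<le> i" "i \<le> L" shows "sphere_size i = sphere_size r"
  using assms
proof (induction i rule: dec_induct)
  case (step i)
  then show ?case
    using sphere_size_rec[of i] b_const[of i] c_const[of "Suc i"] L_diam cc_pos by simp
qed simp

definition comp_level :: "'a \<Rightarrow> 'a \<Rightarrow> nat \<Rightarrow> 'a set" where
  "comp_level x v l = {u \<in> V. d x u = l \<and> conn x v u}"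

lemma finite_comp_level: "finite (comp_level x v l)"
  using finV by (simp add: comp_level_def)

text \<open>Neighbours one level up or down stay in the end, so consecutive levels are joined
  biregularly, with \<open>cc\<close> neighbours on either side.\<close>

lemma card_comp_level_Suc:
  assumes "x \<in> V" "v \<in> V" "ann x v" "r < l" "Suc l < L"
  shows "card (comp_level x v l) = card (comp_level x v (Suc l))"
proof -
  have "card (comp_level x v l) * cc = card (comp_level x v (Suc l)) * cc"
  proof (rule double_count_regular[where R = "\<lambda>a b. d a b = 1"])
    fix a assume a: "a \<in> comp_level x v l"
    have "conn x v b" if "b \<in> V" "d a b = 1" "d x b = Suc l" for b
      using conn_step[of a b x] conn_trans[of x v a b] that a assms by (simp add: comp_level_def ann_def)
    then have "{b \<in> comp_level x v (Suc l). d a b = 1} = {z \<in> V. d a z = 1 \<and> d x z = Suc (d x a)}"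
      using a by (auto simp: comp_level_def)
    then show "card {b \<in> comp_level x v (Suc l). d a b = 1} = cc"
      using card_b[of x a] b_const[of l] a assms by (simp add: comp_level_def)
  next
    fix b assume b: "b \<in> comp_level x v (Suc l)"
    have "conn x v a" if "a \<in> V" "d b a = 1" "d x a = l" for a
      using conn_step[of b a x] conn_trans[of x v b a] that b assms by (simp add: comp_level_def ann_def)
    then have "{a \<in> comp_level x v l. d a b = 1} = {z \<in> V. d b z = 1 \<and> Suc (d x z) = d x b}"
      using b d_sym by (auto simp: comp_level_def)
    then show "card {a \<in> comp_level x v l. d a b = 1} = cc"
      using card_c[of x b] c_const[of "Suc l"] b assms by (simp add: comp_level_def)
  qed (simp_all add: finite_comp_level)
  then show ?thesis using cc_pos by simp
qed

lemma card_comp_level_level: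
  assumes "x \<in> V" "v \<in> V" "ann x v" "r < l" "l < L"
  shows "card (comp_level x v l) = card (comp_level x v (Suc r))"
proof -
  have "Suc r \<le> l" using assms by simp
  then show ?thesis using \<open>l < L\<close>
  proof (induction l rule: dec_induct)
    case (step l)
    then show ?case using card_comp_level_Suc[of x v l] assms by simp
  qed simp
qed

lemma comp_level_nonempty:
  assumes "x \<in> V" "v \<in> V" "ann x v" "r < l" "l < L"
  shows "0 < card (comp_level x v l)"
proof -
  have "v \<in> comp_level x v (d x v)" using assms by (simp add: comp_level_def)
  then have "0 < card (comp_level x v (d x v))"
    using finite_comp_level by (auto simp: card_gt_0_iff)
  then show ?thesis
    using card_comp_level_level[OF assms(1-3), of "d x v"] card_comp_level_level[OF assms] assms
    by (simp add: ann_def)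
qed

text \<open>By constancy along levels the end contains some \<open>u\<close> as far from
  \<open>x\<close> as \<open>v'\<close> is from \<open>x'\<close>, and an isometry takes
  \<open>x\<close>, \<open>u\<close> to \<open>x'\<close>, \<open>v'\<close>.\<close>

lemma card_comp_level:
  assumes "x \<in> V" "v \<in> V" "ann x v" "r < l" "l < L"
    and "x' \<in> V" "v' \<in> V" "ann x' v'" "r < l'" "l' < L"
  shows "card (comp_level x v l) = card (comp_level x' v' l')"
proof -
  have "comp_level x v (d x' v') \<noteq> {}"
    using comp_level_nonempty[OF assms(1-3), of "d x' v'"] assms(8) by (auto simp: ann_def)
  then obtain u where u: "u \<in> V" "d x u = d x' v'" "conn x v u" by (auto simp: comp_level_def)
  obtain \<phi> where \<phi>: "isom \<phi>" "\<phi> x = x'" "\<phi> u = v'"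
    using isom_pair[OF assms(1) u(1) assms(6,7) u(2)] .
  have "card (comp_level x v l') = card (comp_level x u l')"
    using conn_trans[OF u(3)] conn_trans[OF conn_sym[OF u(3)]]
    by (auto simp: comp_level_def intro!: arg_cong[of _ _ card])
  also have "\<dots> = card (comp_level x' v' l')"
    unfolding comp_level_def
    using isom_conn_iff[OF \<phi>(1) assms(1) u(1)] isom_dist[OF \<phi>(1) assms(1)] \<phi>
    by (intro isom_card[OF \<phi>(1)]) auto
  finally show ?thesis
    using card_comp_level_level[OF assms(1-5)] card_comp_level_level[OF assms(1-3), of l'] assms by simp
qed

text \<open>Seen from a point z of an end of x, every end of z other than the one of x runs away
  from x inside a single end of x.  With three ends or more there is no room for this.\<close>

lemma at_most_two_ends:
  assumes x: "x \<in> V" and v: "v1 \<in> V" "v2 \<in> V" "v3 \<in> V"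
    and n: "d x v1 = 4 * r + 2" "d x v2 = 4 * r + 2" "d x v3 = 4 * r + 2"
  shows "conn x v1 v2 \<or> conn x v1 v3 \<or> conn x v2 v3"
proof (rule ccontr)
  assume neg: "\<not> ?thesis"
  \<comment> \<open>The final count compares 2(m - r) with m + r, and m = 3r + 1 is the least value
    for which the former is larger. Taking n = m + r + 1 keeps all points within \<open>m\<close> of
    \<open>z\<close> farther than \<open>r\<close> from \<open>x\<close>.\<close>
  define n where "n = 4 * r + 2"
  define m where "m = 3 * r + 1"
  define z where "z = v1"
  define \<sigma> where "\<sigma> = card (comp_level x v1 n)"
  define \<kappa> where "\<kappa> = sphere_size r"
  have z: "z \<in> V" "d x z = n" "d z x = n" using v n x d_sym by (auto simp: z_def n_def)
  have nL: "r < n" "n < L" "n + m < L" using L_large by (auto simp: n_def m_def)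
  have ann_v: "ann x v1" "ann x v2" "ann x v3" "ann z x"
    using n nL z by (auto simp: ann_def n_def)
  have \<sigma>: "card (comp_level x' v' l) = \<sigma>" if "x' \<in> V" "v' \<in> V" "ann x' v'" "r < l" "l < L" for x' v' l
    unfolding \<sigma>_def by (rule card_comp_level) (use that x v nL ann_v in auto)
  have \<sigma>_pos: "0 < \<sigma>" unfolding \<sigma>_def by (rule comp_level_nonempty) (use x v nL ann_v in auto)
  \<comment> \<open>Three distinct ends occupy disjoint parts of one sphere.\<close>
  have "3 * \<sigma> \<le> \<kappa>"
  proof -
    let ?Q = "\<lambda>v. comp_level x v n"
    have disj: "?Q u \<inter> ?Q v = {}" if "\<not> conn x u v" for u v
      using that conn_trans[of x u _ v] conn_sym[of x v] by (auto simp: comp_level_def)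
    have dd: "?Q v1 \<inter> ?Q v2 = {}" "(?Q v1 \<union> ?Q v2) \<inter> ?Q v3 = {}"
      using disj[of v1 v2] disj[of v1 v3] disj[of v2 v3] neg by auto
    have "card (?Q v1 \<union> ?Q v2 \<union> ?Q v3) = card (?Q v1) + card (?Q v2) + card (?Q v3)"
      using card_Un_disjoint[OF _ _ dd(2)] card_Un_disjoint[OF _ _ dd(1)] finite_comp_level by simp
    moreover have "card (?Q v1 \<union> ?Q v2 \<union> ?Q v3) \<le> card {u \<in> V. d x u = n}"
      using finV by (intro card_mono) (auto simp: comp_level_def)
    moreover have "card {u \<in> V. d x u = n} = \<kappa>"
      using card_sphere[OF x, of n] sphere_size_const[of n] nL by (simp add: \<kappa>_def)
    ultimately show ?thesis using \<sigma>[OF x v(1) ann_v(1)] \<sigma>[OF x v(2) ann_v(2)] \<sigma>[OF x v(3) ann_v(3)] nL by simp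
  qed
  \<comment> \<open>Layer \<open>j\<close> of the part of the space that \<open>z\<close> sees in
    ends other than the one of \<open>x\<close>.\<close>
  define U where "U j = {v \<in> V. d z v = j \<and> \<not> conn z x v}" for j
  have card_U: "card (U j) = \<kappa> - \<sigma>" if j: "j \<in> {Suc r..m}" for j
  proof -
    have jL: "r < j" "j < L" using j nL by auto
    have "U j = {v \<in> V. d z v = j} - comp_level z x j" by (auto simp: U_def comp_level_def)
    moreover have "comp_level z x j \<subseteq> {v \<in> V. d z v = j}" by (auto simp: comp_level_def)
    ultimately have "card (U j) = card {v \<in> V. d z v = j} - card (comp_level z x j)"
      using finite_comp_level by (simp add: card_Diff_subset)
    then show ?thesis
      using card_sphere[OF z(1), of j] sphere_size_const[of j] jL \<sigma>[OF z(1) x ann_v(4) jL]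
      by (simp add: \<kappa>_def)
  qed
  have U_in: "v \<in> (\<Union>l\<in>{Suc (n - r)..n + m}. comp_level x z l)" if j: "j \<in> {Suc r..m}" and vU: "v \<in> U j" for j v
  proof -
    have vV: "v \<in> V" "d z v = j" "\<not> conn z x v" using vU by (auto simp: U_def)
    have jm: "r < j" "j \<le> m" using j by auto
    have "conn x z v"
    proof (rule conn_geodesic[OF x z(1) vV(1)])
      fix u assume u: "u \<in> V" "d z u + d u v = d z v"
      have "d x z \<le> d x u + d u z" "d x u \<le> d x z + d z u" "d u z = d z u"
        using d_tri[OF x u(1) z(1)] d_tri[OF x z(1) u(1)] d_sym[OF u(1) z(1)] by auto
      then show "ann x u" using u(2) vV(2) jm(2) z(2) nL(3) by (simp add: ann_def n_def m_def)
    qed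
    moreover have up: "d x v \<le> n + m" using d_tri[OF x z(1) vV(1)] z vV jm by simp
    \<comment> \<open>Some \<open>u\<close> between \<open>x\<close> and \<open>v\<close> lies
      outside the annulus of \<open>z\<close>. If \<open>u\<close> is within \<open>r\<close> of
      \<open>z\<close>, it is at least \<open>n - r\<close> from \<open>x\<close>, and
      \<open>v\<close> is still farther since \<open>j > r\<close>; if \<open>u\<close> is at least
      \<open>L\<close> from \<open>z\<close>, the bound holds with room to spare.\<close>
    moreover have "Suc (n - r) \<le> d x v"
    proof -
      have "\<exists>u\<in>V. d x u + d u v = d x v \<and> \<not> ann z u"
        using conn_geodesic[OF z(1) x vV(1)] vV(3) by blast
      then obtain u where u: "u \<in> V" "d x u + d u v = d x v" "\<not> ann z u" by blast
      have tri: "d z x \<le> d z u + d u x" "d u x = d x u" "d z v \<le> d z u + d u v"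
        "d z u \<le> d z x + d x u" "d z u \<le> d z v + d v u" "d v u = d u v"
        using d_tri[OF z(1) u(1) x] d_sym[OF u(1) x] d_tri[OF z(1) u(1) vV(1)]
          d_tri[OF z(1) x u(1)] d_tri[OF z(1) vV(1) u(1)] d_sym[OF vV(1) u(1)] by auto
      have "d z u \<le> r \<or> L \<le> d z u" using u(3) by (auto simp: ann_def)
      then show ?thesis using tri u(2) vV(2) z(3) jm nL L_large by (auto simp: n_def m_def)
    qed
    ultimately show ?thesis using vV by (auto simp: comp_level_def)
  qed
  have "(\<Sum>j\<in>{Suc r..m}. card (U j)) = card (\<Union>j\<in>{Suc r..m}. U j)"
    using finV by (intro card_UN_disjoint[symmetric]) (auto simp: U_def)
  also have "\<dots> \<le> card (\<Union>l\<in>{Suc (n - r)..n + m}. comp_level x z l)"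
    using U_in finite_comp_level by (intro card_mono) auto
  also have "\<dots> \<le> (\<Sum>l\<in>{Suc (n - r)..n + m}. card (comp_level x z l))"
    by (intro card_UN_le) simp
  also have "\<dots> = (\<Sum>l\<in>{Suc (n - r)..n + m}. \<sigma>)"
    using nL z x ann_v by (intro sum.cong \<sigma>) (auto simp: z_def n_def)
  \<comment> \<open>The \<open>m - r\<close> layers, each of at least \<open>2 * \<sigma>\<close>
    points, have to fit into \<open>m + r\<close> levels of \<open>\<sigma>\<close> points.\<close>
  finally have "(m - r) * (\<kappa> - \<sigma>) \<le> (m + r) * \<sigma>"
    using card_U nL by (simp add: n_def add.commute)
  then have "(2 * r + 1) * (\<kappa> - \<sigma>) \<le> (4 * r + 1) * \<sigma>" by (simp add: m_def)
  moreover have "(2 * r + 1) * (2 * \<sigma>) \<le> (2 * r + 1) * (\<kappa> - \<sigma>)"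
    using \<open>3 * \<sigma> \<le> \<kappa>\<close> by (intro mult_le_mono2) simp
  ultimately have "(2 * r + 1) * (2 * \<sigma>) \<le> (4 * r + 1) * \<sigma>" by linarith
  then show False using \<sigma>_pos by (simp add: algebra_simps)
qed

text \<open>The edge is extended to a geodesic beyond \<open>w\<close> to reach \<open>p\<close> and
  beyond \<open>x\<close> to reach \<open>q\<close>.\<close>

lemma neighbour_ends:
  assumes "x \<in> V" "w \<in> V" "d x w = 1"
  obtains p q where "p \<in> V" "q \<in> V" "d x p = 4 * r + 2" "d x q = 4 * r + 2"
    "Suc (d w p) = 4 * r + 2" "d w q = Suc (4 * r + 2)"
proof -
  obtain p where p: "p \<in> V" "d x p = 4 * r + 2" "d w p = 4 * r + 2 - d x w"
    using extend_geodesic[OF assms(1,2), of "4 * r + 2"] assms L_large L_diam by auto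
  have wx: "d w x = 1" using assms d_sym by simp
  obtain q where q: "q \<in> V" "d w q = Suc (4 * r + 2)" "d x q = Suc (4 * r + 2) - d w x"
    using extend_geodesic[OF assms(2,1), of "Suc (4 * r + 2)"] wx L_large L_diam by auto
  show ?thesis using that[of p q] p q wx assms(3) by simp
qed

text \<open>Each neighbour of \<open>x\<close> is nearer to one of the two ends and farther from the
  other. Of three neighbours two make the same choice and have equal distances to all far points,
  which a geodesic from one through the other refutes.\<close>

lemma degree_le_two: "sphere_size 1 \<le> 2"
proof (rule ccontr)
  assume "\<not> sphere_size 1 \<le> 2"
  obtain x where x: "x \<in> V" using V_ne by blast
  define n where "n = 4 * r + 2"
  have ndiam: "n + 2 < diam" "r < n" "Suc n < L" using L_large L_diam r_pos by (auto simp: n_def)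
  have "3 \<le> card {z \<in> V. d x z = 1}"
    using card_sphere[OF x, of 1] \<open>\<not> sphere_size 1 \<le> 2\<close> by simp
  then obtain T where T: "T \<subseteq> {z \<in> V. d x z = 1}" "card T = 3"
    by (meson obtain_subset_with_card_n)
  then obtain w1 w2 w3 where w: "T = {w1, w2, w3}" "w1 \<noteq> w2" "w1 \<noteq> w3" "w2 \<noteq> w3"
    by (auto simp: card_3_iff)
  have wV: "w1 \<in> V" "w2 \<in> V" "w3 \<in> V" "d x w1 = 1" "d x w2 = 1" "d x w3 = 1" using T w by auto
  obtain p q where pq: "p \<in> V" "q \<in> V" "d x p = n" "d x q = n" "Suc (d w1 p) = n" "d w1 q = Suc n"
    using neighbour_ends[OF x wV(1,4)] unfolding n_def by blast
  have npq: "\<not> conn x p q" using conn_shift[OF _ x wV(1,4)] pq by fastforce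
  have cover: "conn x p u \<or> conn x q u" if "u \<in> V" "d x u = n" for u
    using at_most_two_ends[OF x pq(1,2) that(1)] pq that npq by (simp add: n_def)
  have dpq: "d w p = n - 1 \<and> d w q = n + 1 \<or> d w p = n + 1 \<and> d w q = n - 1"
    if w: "w \<in> V" "d x w = 1" for w
  proof -
    obtain p' q' where p': "p' \<in> V" "q' \<in> V" "d x p' = n" "d x q' = n" "Suc (d w p') = n" "d w q' = Suc n"
      using neighbour_ends[OF x w] unfolding n_def by blast
    have sh: "d w u' = d w u" if "conn x u u'" "d x u = n" "d x u' = n" for u u'
      using conn_shift[OF that(1) x w] that by simp
    have "d w p' = d w p \<or> d w p' = d w q" using cover[OF p'(1,3)] sh p' pq by metis
    moreover have "d w q' = d w p \<or> d w q' = d w q" using cover[OF p'(2,4)] sh p' pq by metis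
    ultimately show ?thesis using p' by auto
  qed
  have "\<exists>w w'. w \<in> T \<and> w' \<in> T \<and> w \<noteq> w' \<and> d w p = d w' p"
    using dpq[OF wV(1,4)] dpq[OF wV(2,5)] dpq[OF wV(3,6)] w by (metis insertCI)
  then obtain w w' where ww: "w \<in> V" "w' \<in> V" "d x w = 1" "d x w' = 1" "w \<noteq> w'" "d w p = d w' p"
    using T by blast
  have "d w q = d w' q" using dpq[OF ww(1,3)] dpq[OF ww(2,4)] ww(6) by auto
  have level_n: "d w u = d w' u" if u: "u \<in> V" "d x u = n" for u
    using cover[OF u]
  proof
    assume c: "conn x p u"
    show ?thesis using conn_shift[OF c x ww(1,3)] conn_shift[OF c x ww(2,4)] ww(6) by simp
  next
    assume c: "conn x q u"
    show ?thesis using conn_shift[OF c x ww(1,3)] conn_shift[OF c x ww(2,4)] \<open>d w q = d w' q\<close> by simp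
  qed
  have level_Suc: "d w u = d w' u" if u: "u \<in> V" "d x u = Suc n" for u
  proof -
    obtain u' where u': "u' \<in> V" "d x u' = n" "d u' u = 1"
      using d_step[OF x u] by blast
    have "ann x u" "ann x u'" using u u' ndiam by (auto simp: ann_def)
    then show ?thesis
      using shift_step[OF x ww(1) u'(1) u(1) ww(3) u'(3)] shift_step[OF x ww(2) u'(1) u(1) ww(4) u'(3)]
        level_n[OF u'(1,2)] by simp
  qed
  have ww': "d w' w = d w w'" "d w' x = 1" "d w x = 1" using d_sym ww x by auto
  have e: "d w w' \<le> 2" "d w w' \<noteq> 0"
    using d_tri[OF ww(1) x ww(2)] ww ww' d_zero_iff[OF ww(1,2)] by auto
  \<comment> \<open>Beyond \<open>w\<close> on a geodesic from \<open>w'\<close>. The triangle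
    inequality puts \<open>u\<close> at distance \<open>n\<close> or \<open>n + 1\<close> from
    \<open>x\<close>, where \<open>w\<close> and \<open>w'\<close> should be equidistant from
    it.\<close>
  obtain u where u: "u \<in> V" "d w' u = n + d w w'" "d w u = n + d w w' - d w' w"
    using extend_geodesic[OF ww(2,1), of "n + d w w'"] ww'(1) e ndiam by auto
  have "d w' u \<le> d w' x + d x u" "d x u \<le> d x w + d w u"
    using d_tri[OF ww(2) x u(1)] d_tri[OF x ww(1) u(1)] by auto
  then have "d x u = n \<or> d x u = Suc n" using u ww ww' e by auto
  then show False using level_n[OF u(1)] level_Suc[OF u(1)] u ww'(1) e by auto
qed

end

section \<open>Growth of spheres and the turning point\<close>

context distance_transitive_metric begin

lemma b_num_diam: "b_num diam = 0"
proof -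
  obtain x y where xy: "x \<in> V" "y \<in> V" "d x y = diam" using diam_attained .
  have "{z \<in> V. d y z = 1 \<and> d x z = Suc (d x y)} = {}" using d_le_diam[OF xy(1)] xy(3) by fastforce
  then show ?thesis using card_b[OF xy(1,2)] xy(3) by (simp only: card.empty)
qed

lemma sphere_size_mono_half:
  assumes "2 * i + 1 \<le> diam" shows "sphere_size i \<le> sphere_size (Suc i)"
proof -
  have "c_num (Suc i) \<le> b_num i" using c_le_b[of i "Suc i"] assms by simp
  then have "sphere_size i * c_num (Suc i) \<le> sphere_size (Suc i) * c_num (Suc i)"
    using sphere_size_rec[of i] assms mult_le_mono2[of "c_num (Suc i)" "b_num i" "sphere_size i"] by simp
  then show ?thesis using c_pos[of i] assms by simp
qed

lemma even_ball_size_sum: "even_ball_size s = (\<Sum>i\<le>s. if even i then sphere_size i else 0)"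
proof -
  obtain x where x: "x \<in> V" using V_ne by blast
  have "even_ball s x = (\<Union>i\<in>{i \<in> {..s}. even i}. {z \<in> V. d x z = i})" by (auto simp: even_ball_def)
  then have "card (even_ball s x) = (\<Sum>i\<in>{i \<in> {..s}. even i}. card {z \<in> V. d x z = i})"
    using finV by (simp only:) (intro card_UN_disjoint, auto)
  also have "\<dots> = sum sphere_size {i \<in> {..s}. even i}" using card_sphere[OF x] by simp
  also have "\<dots> = (\<Sum>i\<le>s. if even i then sphere_size i else 0)" by (rule sum.inter_filter) simp
  finally show ?thesis using card_even_ball[OF x] by simp
qed

text \<open>An odd sphere is no larger than the next even one, which may have radius
  \<open>Suc s\<close>.\<close>

lemma ball_size_le_even_ball:
  assumes "2 * s + 1 \<le> diam" shows "ball_size s \<le> 2 * even_ball_size (Suc s)"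
proof -
  let ?g = "\<lambda>i. if even i then sphere_size i else 0"
  have "ball_size s \<le> (\<Sum>i\<le>s. ?g i + ?g (Suc i))"
    unfolding ball_size_def using assms sphere_size_mono_half by (intro sum_mono) auto
  also have "\<dots> = (\<Sum>i\<le>s. ?g i) + (\<Sum>i\<le>s. ?g (Suc i))" by (rule sum.distrib)
  also have "(\<Sum>i\<le>s. ?g i) \<le> (\<Sum>i\<le>Suc s. ?g i)" by simp
  also have "(\<Sum>i\<le>s. ?g (Suc i)) \<le> (\<Sum>i\<le>Suc s. ?g i)"
    using sum.atMost_Suc_shift[of ?g s] by simp
  finally show ?thesis by (simp only: even_ball_size_sum mult_2)
qed

text \<open>Before the first i with b(i) at most c(i+1) the spheres grow by the factor 1 + 1/R, whereas by
  the volume hypothesis they grow at most linearly from radius diam/100 on.\<close>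

lemma turning_point:
  assumes R: "sphere_size 1 \<le> R"
    and vol: "\<And>\<rho>. diam \<le> 100 * \<rho> \<Longrightarrow> card V \<le> E * ball_size \<rho>"
    and H: "\<And>h. H \<le> h \<Longrightarrow> real E * (real h + 1) < (1 + 1 / real R) ^ h"
    and diam: "100 * H \<le> diam" "100 \<le> diam"
  obtains i where "20 * i \<le> diam" "b_num i \<le> c_num (Suc i)"
proof -
  define i0 where "i0 = (LEAST i. b_num i \<le> c_num (Suc i))"
  \<comment> \<open>The least index exists because b vanishes at the diameter; the value of c beyond
    it does not matter.\<close>
  have ex: "b_num diam \<le> c_num (Suc diam)" using b_num_diam by simp
  have i0: "b_num i0 \<le> c_num (Suc i0)" unfolding i0_def by (rule LeastI[of _ diam]) (rule ex)
  have i0_diam: "i0 \<le> diam" unfolding i0_def by (rule Least_le) (rule ex)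
  have less: "c_num (Suc i) < b_num i" if "i < i0" for i
    using not_less_Least[of i "\<lambda>i. b_num i \<le> c_num (Suc i)"] that by (simp add: i0_def)
  have Rpos: "0 < R" using R sphere_size_pos[of 1] diam by simp
  have grow: "sphere_size i * (1 + 1 / real R) \<le> sphere_size (Suc i)" if i: "i < i0" for i
  proof -
    let ?c = "c_num (Suc i)"
    have c: "0 < ?c" using c_pos[of i] i i0_diam by simp
    have "?c \<le> R" using b_c_le_degree[of "Suc i"] i i0_diam R by simp
    have "sphere_size i * (?c + 1) \<le> sphere_size i * b_num i" using less[OF i] by (intro mult_le_mono2) simp
    also have "\<dots> = sphere_size (Suc i) * ?c" using sphere_size_rec[of i] i i0_diam by simp
    finally have "real (sphere_size i) * (real ?c + 1) \<le> real (sphere_size (Suc i)) * real ?c"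
      by (metis (mono_tags) of_nat_1 of_nat_add of_nat_le_iff of_nat_mult)
    then have "real (sphere_size i) * (1 + 1 / real ?c) \<le> real (sphere_size (Suc i))"
      using c by (simp add: field_simps)
    moreover have "1 / real R \<le> 1 / real ?c" using c \<open>?c \<le> R\<close> by (simp add: frac_le)
    then have "real (sphere_size i) * (1 + 1 / real R) \<le> real (sphere_size i) * (1 + 1 / real ?c)"
      by (intro mult_left_mono) auto
    ultimately show ?thesis by linarith
  qed
  have pow: "sphere_size h * (1 + 1 / real R) ^ j \<le> sphere_size (h + j)" if "h + j \<le> i0" for h j
    using that
  proof (induction j)
    case (Suc j)
    have "sphere_size h * (1 + 1 / real R) ^ Suc j = (sphere_size h * (1 + 1 / real R) ^ j) * (1 + 1 / real R)"
      by simp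
    also have "\<dots> \<le> sphere_size (h + j) * (1 + 1 / real R)" using Suc by (intro mult_right_mono) auto
    also have "\<dots> \<le> sphere_size (Suc (h + j))" using grow[of "h + j"] Suc.prems by simp
    finally show ?case by simp
  qed simp
  have mono: "sphere_size i \<le> sphere_size h" if "i \<le> h" "h \<le> i0" for i h
  proof -
    have "real (sphere_size i) * 1 \<le> real (sphere_size i) * (1 + 1 / real R) ^ (h - i)"
      by (intro mult_left_mono one_le_power) auto
    then show ?thesis using pow[of i "h - i"] that by simp
  qed
  have "20 * i0 \<le> diam"
  proof (rule ccontr)
    assume neg: "\<not> 20 * i0 \<le> diam"
    \<comment> \<open>\<open>h\<close> still exceeds diam/100. The sphere at \<open>h + h\<close> is
      exponentially larger than the one at \<open>h\<close>, yet has at most \<open>card V\<close>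
      points, which the volume bound limits to \<open>E * (h + 1)\<close> times the sphere at
      \<open>h\<close>.\<close>
    define h where "h = i0 div 2"
    have h100: "diam \<le> 100 * h" using neg diam(2) unfolding h_def by linarith
    then have "H \<le> h" using diam(1) by linarith
    have hh: "h + h \<le> i0" by (simp add: h_def)
    obtain x where x: "x \<in> V" using V_ne by blast
    have "ball_size h \<le> (\<Sum>i\<le>h. sphere_size h)"
      unfolding ball_size_def using mono hh by (intro sum_mono) auto
    then have ball: "ball_size h \<le> Suc h * sphere_size h" by simp
    have "sphere_size (h + h) \<le> card V"
      using card_sphere[OF x, of "h + h"] card_mono[OF finV, of "{z \<in> V. d x z = h + h}"] by auto
    also have "\<dots> \<le> E * (Suc h * sphere_size h)"
      using vol[OF h100] ball by (meson mult_le_mono2 order_trans)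
    finally have "real (sphere_size (h + h)) \<le> real (E * (Suc h * sphere_size h))" by (simp only: of_nat_le_iff)
    then have "real (sphere_size h) * (1 + 1 / real R) ^ h \<le> real (sphere_size h) * (real E * (real h + 1))"
      using pow[OF hh] by (simp add: algebra_simps)
    moreover have "0 < sphere_size h" using sphere_size_pos[of h] hh i0_diam by simp
    ultimately have "(1 + 1 / real R) ^ h \<le> real E * (real h + 1)" by simp
    then show False using H[OF \<open>H \<le> h\<close>] by simp
  qed
  then show ?thesis using that i0 by blast
qed

text \<open>The hypothesis on \<open>i\<close> closes the chain of monotonicity inequalities, and
  \<open>20 * i \<le> diam\<close> makes room for seven times \<open>Suc i\<close> below half the
  diameter.\<close>

lemma degree_le_two_of_turning_point:
  assumes i: "20 * i \<le> diam" "b_num i \<le> c_num (Suc i)" and diam: "100 \<le> diam"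
  shows "sphere_size 1 \<le> 2"
proof -
  define L where "L = (diam - 1) div 2"
  have eq: "b_num j = b_num i \<and> c_num (Suc j) = b_num i" if j: "i \<le> j" "2 * j + 1 \<le> diam" for j
  proof -
    have "c_num (Suc j) \<le> b_num j" using c_le_b[of j "Suc j"] j by simp
    moreover have "b_num j \<le> b_num i" using b_antimono[of i j] j by simp
    moreover have "c_num (Suc i) \<le> c_num (Suc j)" using c_mono[of "Suc i" "Suc j"] j by simp
    ultimately show ?thesis using i(2) by simp
  qed
  have L2: "2 * L + 1 \<le> diam" using diam by (simp add: L_def)
  \<comment> \<open>The range starts at \<open>Suc i\<close> because c is under control only from
    c(i + 1) on.\<close>
  interpret constant_range V d "Suc i" L "b_num i"
  proof
    have "diam \<le> 2 * L + 2" unfolding L_def by presburger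
    then show "7 * Suc i + 4 \<le> L" using i(1) diam by simp
    show "L < diam" using L2 by linarith
    fix j assume j: "Suc i \<le> j" "j \<le> L"
    show "b_num j = b_num i" using eq[of j] j L2 by simp
    show "c_num j = b_num i" using eq[of "j - 1"] j L2 by simp
  qed simp
  show ?thesis by (rule degree_le_two)
qed

end

lemma exponential_beats_linear:
  assumes "1 < (a::real)"
  obtains H where "\<And>h::nat. H \<le> h \<Longrightarrow> E * (real h + 1) < a ^ h"
proof -
  have "(\<lambda>h. (real h + 1) / a ^ h) \<longlonglongrightarrow> 0"
  proof -
    have "(\<lambda>h. real h / a ^ h) \<longlonglongrightarrow> 0" "(\<lambda>h. 1 / a ^ h) \<longlonglongrightarrow> 0"
      using lim_n_over_pown[of a] LIMSEQ_divide_realpow_zero[of a 1] assms by auto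
    from tendsto_add[OF this] show ?thesis by (simp add: add_divide_distrib)
  qed
  then have "\<forall>\<^sub>F h in sequentially. (real h + 1) / a ^ h < 1 / (\<bar>E\<bar> + 1)"
    by (rule order_tendstoD) simp
  then obtain H where H: "\<And>h. H \<le> h \<Longrightarrow> (real h + 1) / a ^ h < 1 / (\<bar>E\<bar> + 1)"
    by (auto simp: eventually_sequentially)
  have "E * (real h + 1) < a ^ h" if "H \<le> h" for h
  proof -
    have "(\<bar>E\<bar> + 1) * (real h + 1) < a ^ h" using H[OF that] assms by (simp add: field_simps)
    moreover have "E * (real h + 1) \<le> (\<bar>E\<bar> + 1) * (real h + 1)" by (intro mult_right_mono) auto
    ultimately show ?thesis by linarith
  qed
  then show ?thesis by (rule that)
qed

theorem degree_le_two_of_large_diameter: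
  "\<exists>T. \<forall>(V :: 'a set) d. distance_transitive_metric V d \<longrightarrow>
     T \<le> distance_transitive_metric.diam V d \<longrightarrow>
     (\<forall>\<rho>. distance_transitive_metric.diam V d \<le> 100 * \<rho> \<longrightarrow>
        card V \<le> E * distance_transitive_metric.ball_size V d \<rho>) \<longrightarrow>
     distance_transitive_metric.sphere_size V d 1 \<le> 2"
proof -
  \<comment> \<open>The factor 2 pays for passing from balls to even balls.\<close>
  define M where "M = 2 * E"
  obtain N where N1: "1 \<le> N" and N: "\<forall>(S :: 'a set) F. finite S \<and> N \<le> card S \<longrightarrow>
      (\<exists>R\<subseteq>S. card R = 2 * (M\<^sup>2 + 1) \<and> clique R F \<or> card R = 2 * (M\<^sup>2 + 1) \<and> indep R F)"
    using ramsey2[of "2 * (M\<^sup>2 + 1)" "2 * (M\<^sup>2 + 1)"] by blast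
  obtain H where H: "\<And>h::nat. H \<le> h \<Longrightarrow> real E * (real h + 1) < (1 + 1 / real N) ^ h"
    using exponential_beats_linear[of "1 + 1 / real N" "real E"] N1 by auto
  have "distance_transitive_metric.sphere_size V d 1 \<le> 2"
    if dt: "distance_transitive_metric V d"
      and T: "100 * H + 100 \<le> distance_transitive_metric.diam V d"
      and vol: "\<And>\<rho>. distance_transitive_metric.diam V d \<le> 100 * \<rho> \<Longrightarrow>
        card V \<le> E * distance_transitive_metric.ball_size V d \<rho>"
    for V :: "'a set" and d
  proof -
    interpret distance_transitive_metric V d by (rule dt)
    \<comment> \<open>Small enough for two even balls of radius \<open>Suc s\<close> at distance
      \<open>4 * Suc s + 2\<close>, large enough for the volume hypothesis at radius
      \<open>s\<close>.\<close>
    define s where "s = diam div 20 - 1"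
    have "100 \<le> diam" using T by simp
    then have s: "diam \<le> 100 * s" "4 * Suc s + 2 \<le> diam" "2 * s + 1 \<le> diam"
      unfolding s_def by (linarith, simp, linarith)
    have "card V \<le> E * (2 * even_ball_size (Suc s))"
      using vol[OF s(1)] ball_size_le_even_ball[OF s(3)] by (meson mult_le_mono2 order_trans)
    then have "card V \<le> M * even_ball_size (Suc s)" by (simp add: M_def)
    then have "sphere_size 1 < N" using N by (intro degree_less[OF s(2)]) blast+
    then have "sphere_size 1 \<le> N" by simp
    then obtain i where "20 * i \<le> diam" "b_num i \<le> c_num (Suc i)"
      using turning_point[of N E H] vol H T by (metis add_leD1 add_leD2)
    then show ?thesis using degree_le_two_of_turning_point T by simp
  qed
  then show ?thesis by blast
qed

section \<open>Cycles\<close>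

context distance_transitive_metric begin

text \<open>Follow a walk that never turns back. Distances from any of its points rise to
  \<open>diam\<close> and then fall to 0; \<open>c_num diam\<close> decides whether the maximum
  occurs once or twice in a row, that is, the parity of \<open>N\<close>.\<close>

lemma cyclic_coordinates:
  assumes deg: "sphere_size 1 \<le> 2" and diam2: "2 \<le> diam"
  shows "\<exists>v N. (N = 2 * diam \<or> N = 2 * diam + 1) \<and> bij_betw v {..<N} V
    \<and> (\<forall>i j. i \<le> j \<longrightarrow> j < N \<longrightarrow> d (v i) (v j) = min (j - i) (N - (j - i)))"
proof -
  have deg2: "card {z \<in> V. d x z = 1} = 2" if "x \<in> V" for x
    using card_sphere[OF that, of 1] b_c_le_degree[of 1] b_pos[of 1] c_pos[of 0] deg diam2 by simp
  obtain x w where xw: "x \<in> V" "w \<in> V" "d x w = 1"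
    using V_ne point_at_distance[of _ 1] diam2 by (metis all_not_in_conv one_le_numeral order_trans)
  \<comment> \<open>The state is a pair of consecutive vertices; the next vertex is the neighbour of
    the second that is not the first.\<close>
  define f where "f = rec_nat (x, w) (\<lambda>_ p. (snd p, SOME z. z \<in> V \<and> d (snd p) z = 1 \<and> z \<noteq> fst p))"
  define v where "v n = fst (f n)" for n
  have f0: "f 0 = (x, w)" and fS: "\<And>n. f (Suc n) = (snd (f n), SOME z. z \<in> V \<and> d (snd (f n)) z = 1 \<and> z \<noteq> fst (f n))"
    by (simp_all add: f_def)
  have next_ex: "\<exists>z. z \<in> V \<and> d b z = 1 \<and> z \<noteq> a" if b: "b \<in> V" for a b
  proof (rule ccontr)
    assume "\<not> ?thesis"
    then have "{z \<in> V. d b z = 1} \<subseteq> {a}" by auto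
    then have "card {z \<in> V. d b z = 1} \<le> 1" using card_mono[of "{a}"] by fastforce
    then show False using deg2[OF b] by simp
  qed
  have inv: "fst (f n) \<in> V \<and> snd (f n) \<in> V \<and> d (fst (f n)) (snd (f n)) = 1" for n
  proof (induction n)
    case 0
    then show ?case using xw f0 by simp
  next
    case (Suc n)
    then show ?case using someI_ex[OF next_ex[of "snd (f n)" "fst (f n)"]] by (simp add: fS)
  qed
  have vV: "v n \<in> V" for n using inv by (simp add: v_def)
  have vS: "v (Suc n) = snd (f n)" for n by (simp add: v_def fS)
  have v1: "d (v n) (v (Suc n)) = 1" for n using inv[of n] by (simp only: vS) (simp add: v_def)
  have v1': "d (v (Suc n)) (v n) = 1" for n using v1 d_sym vV by simp
  have vne: "v (Suc (Suc n)) \<noteq> v n" for n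
  proof -
    have "v (Suc (Suc n)) = (SOME z. z \<in> V \<and> d (snd (f n)) z = 1 \<and> z \<noteq> fst (f n))"
      by (simp only: vS[of "Suc n"]) (simp add: fS)
    then show ?thesis using someI_ex[OF next_ex[of "snd (f n)" "fst (f n)"]] inv by (simp add: v_def)
  qed
  have nbrs: "z = v n \<or> z = v (Suc (Suc n))" if "z \<in> V" "d (v (Suc n)) z = 1" for n z
  proof -
    have "{v n, v (Suc (Suc n))} = {z \<in> V. d (v (Suc n)) z = 1}"
      using deg2[OF vV, of "Suc n"] vne[of n] v1[of "Suc n"] v1'[of n] vV finV
      by (intro card_subset_eq) auto
    then show ?thesis using that by blast
  qed
  \<comment> \<open>Here and in \<open>desc\<close> a positive intersection number provides a
    neighbour in the wanted direction, and it cannot be the preceding vertex.\<close>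
  have asc: "d (v i) (v (Suc (Suc n))) = Suc (Suc j)"
    if "d (v i) (v n) = j" "d (v i) (v (Suc n)) = Suc j" "Suc j < diam" for i n j
  proof -
    have "card {z \<in> V. d (v (Suc n)) z = 1 \<and> d (v i) z = Suc (Suc j)} > 0"
      using card_b[OF vV vV, of "Suc n" i] b_pos[of "Suc j"] that by simp
    then obtain z where "z \<in> V" "d (v (Suc n)) z = 1" "d (v i) z = Suc (Suc j)"
      by (auto simp: card_gt_0_iff)
    then show ?thesis using nbrs[of z n] that by auto
  qed
  have desc: "Suc (d (v i) (v (Suc (Suc n)))) = d (v i) (v (Suc n))"
    if "d (v i) (v (Suc n)) \<le> d (v i) (v n)" "0 < d (v i) (v (Suc n))" for i n
  proof -
    let ?e = "d (v i) (v (Suc n))"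
    have "?e - 1 < diam" using d_le_diam[OF vV vV, of i "Suc n"] that by simp
    then have "card {z \<in> V. d (v (Suc n)) z = 1 \<and> Suc (d (v i) z) = ?e} > 0"
      using card_c[OF vV vV, of "Suc n" i] c_pos[of "?e - 1"] that by simp
    then obtain z where "z \<in> V" "d (v (Suc n)) z = 1" "Suc (d (v i) z) = ?e"
      by (auto simp: card_gt_0_iff)
    then show ?thesis using nbrs[of z n] that by auto
  qed
  have up: "Suc j \<le> diam \<Longrightarrow> d (v i) (v (i + j)) = j \<and> d (v i) (v (i + Suc j)) = Suc j" for i j
  proof (induction j)
    case 0
    then show ?case using v1 vV by simp
  next
    case (Suc j)
    then show ?case using asc[of i "i + j" j] by simp
  qed
  define N where "N = (if c_num diam = 2 then 2 * diam else 2 * diam + 1)"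
  obtain D where D: "diam = Suc D" using diam2 by (cases diam) auto
  have turn: "d (v i) (v (i + Suc diam)) = N - Suc diam" for i
  proof -
    have dD: "d (v i) (v (i + D)) = D" "d (v i) (v (Suc (i + D))) = Suc D" using up[of D i] D by simp_all
    let ?y = "v (Suc (i + D))" and ?z = "v (Suc (Suc (i + D)))"
    have C: "card {z \<in> V. d ?y z = 1 \<and> Suc (d (v i) z) = Suc D} = c_num diam"
      using card_c[OF vV vV, of "Suc (i + D)" i] dD D by simp
    show ?thesis
    proof (cases "Suc (d (v i) ?z) = Suc D")
      case True
      then have "{z \<in> V. d ?y z = 1 \<and> Suc (d (v i) z) = Suc D} = {v (i + D), ?z}"
        using nbrs vV v1 v1' dD by auto
      then have "c_num diam = 2" using C vne[of "i + D"] by simp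
      then show ?thesis using True D by (simp add: N_def)
    next
      case False
      then have "z = v (i + D)" if "z \<in> V" "d ?y z = 1" "Suc (d (v i) z) = Suc D" for z
        using nbrs[OF that(1), of "i + D"] that by auto
      then have "{z \<in> V. d ?y z = 1 \<and> Suc (d (v i) z) = Suc D} = {v (i + D)}"
        using vV v1' dD by blast
      then have "c_num diam \<noteq> 2" using C by simp
      moreover have "d (v i) ?z = Suc D"
        using neighbour_dist[OF vV vV vV v1, of i "Suc (i + D)"] False dD d_le_diam[OF vV vV, of i "Suc (Suc (i + D))"] D
        by simp
      ultimately show ?thesis using D by (simp add: N_def)
    qed
  qed
  have N2: "2 * diam \<le> N" "N \<le> 2 * diam + 1" by (auto simp: N_def)
  \<comment> \<open>The second conjunct carries along that the preceding vertex is not nearer, as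
    \<open>desc\<close> requires.\<close>
  have down: "Suc diam \<le> j \<Longrightarrow> j \<le> N \<Longrightarrow>
      d (v i) (v (i + j)) = N - j \<and> N - j \<le> d (v i) (v (i + (j - 1)))" for i j
  proof (induction j rule: dec_induct)
    case base
    show ?case using turn[of i] up[of D i] D N2 by simp
  next
    case (step j)
    obtain k where k: "j = Suc k" using step.hyps by (cases j) auto
    have IH: "d (v i) (v (Suc (i + k))) = N - j" "N - j \<le> d (v i) (v (i + k))"
      using step.IH step.prems k by simp_all
    have "Suc (d (v i) (v (Suc (Suc (i + k))))) = d (v i) (v (Suc (i + k)))"
      using desc[of i "i + k"] IH step.prems by simp
    then show ?case using IH k step.prems by simp arith
  qed
  have dist: "d (v i) (v (i + j)) = min j (N - j)" if "j \<le> N" for i j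
  proof (cases "j \<le> diam")
    case True
    have "d (v i) (v (i + j)) = j"
    proof (cases j)
      case 0
      then show ?thesis using vV by simp
    next
      case (Suc k)
      then show ?thesis using up[of k i] True by simp
    qed
    then show ?thesis using True N2 by simp
  next
    case False
    then show ?thesis using down[of j i] that N2 by simp
  qed
  have period: "v (i + N) = v i" for i
    using dist[of N i] d_zero_iff[OF vV vV, of i "i + N"] by simp
  have Npos: "0 < N" using N2 diam2 by simp
  have range: "v m \<in> v ` {..<N}" for m
  proof (induction m rule: less_induct)
    case (less m)
    show ?case
    proof (cases "m < N")
      case False
      then have "v m = v (m - N)" using period[of "m - N"] by simp
      then show ?thesis using less[of "m - N"] False Npos by simp
    qed simp
  qed
  have "y \<in> v ` {..<N}" if "y \<in> V" "d (v 0) y = n" for n y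
    using that
  proof (induction n arbitrary: y)
    case 0
    then have "v 0 = y" using d_zero_iff vV by simp
    then show ?case using range[of 0] by simp
  next
    case (Suc n)
    obtain z where z: "z \<in> V" "d (v 0) z = n" "d z y = 1" using d_step[OF vV Suc.prems] by blast
    obtain i where i: "z = v i" using Suc.IH[OF z(1,2)] by blast
    \<comment> \<open>Adding a period gives \<open>z\<close> a predecessor on the walk even if
      \<open>i = 0\<close>.\<close>
    obtain k where k: "i + N = Suc k" using Npos by (cases "i + N") auto
    have "z = v (Suc k)" using i period[of i] k by simp
    then have "y = v k \<or> y = v (Suc (Suc k))" using nbrs[OF Suc.prems(1), of k] z(3) by simp
    then show ?case using range by auto
  qed
  then have "V \<subseteq> v ` {..<N}" by blast
  moreover have dij: "d (v i) (v j) = min (j - i) (N - (j - i))" if "i \<le> j" "j < N" for i j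
    using dist[of "j - i" i] that by simp
  have "inj_on v {..<N}"
  proof (rule linorder_inj_onI)
    fix i j assume "i < j" "i \<in> {..<N}" "j \<in> {..<N}"
    then have "d (v i) (v j) \<noteq> 0" using dij[of i j] by simp
    then show "v i \<noteq> v j" using vV by auto
  qed auto
  ultimately have "bij_betw v {..<N} V" using vV by (auto simp: bij_betw_def)
  moreover have "N = 2 * diam \<or> N = 2 * diam + 1" by (simp add: N_def)
  ultimately show ?thesis using dij by (intro exI[of _ v] exI[of _ N]) simp
qed

end

section \<open>The circle, entropy and Gromov--Hausdorff distance\<close>

text \<open>The circle of length 2 in its parameter from 0 to 2; it is a metric on that interval
  only.\<close>

definition arc_dist :: "real \<Rightarrow> real \<Rightarrow> real" where
  "arc_dist s t = min \<bar>s - t\<bar> (2 - \<bar>s - t\<bar>)"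

lemma arc_dist_sym: "arc_dist s t = arc_dist t s"
  by (simp add: arc_dist_def abs_minus_commute)

lemma arc_dist_self [simp]: "arc_dist s s = 0"
  by (simp add: arc_dist_def)

lemma arc_dist_le_1: "arc_dist s t \<le> 1"
  by (simp add: arc_dist_def min_def)

lemma arc_dist_nonneg: "s \<in> {0..<2} \<Longrightarrow> t \<in> {0..<2} \<Longrightarrow> 0 \<le> arc_dist s t"
  by (auto simp: arc_dist_def)

lemma arc_dist_eq_0: "s \<in> {0..<2} \<Longrightarrow> t \<in> {0..<2} \<Longrightarrow> arc_dist s t = 0 \<longleftrightarrow> s = t"
  by (auto simp: arc_dist_def min_def)

lemma arc_dist_triangle:
  assumes "s \<in> {0..<2}" "t \<in> {0..<2}" "u \<in> {0..<2}"
  shows "arc_dist s u \<le> arc_dist s t + arc_dist t u"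
proof -
  have "\<bar>s - u\<bar> \<le> \<bar>s - t\<bar> + \<bar>t - u\<bar>" "\<bar>s - t\<bar> \<le> \<bar>s - u\<bar> + \<bar>t - u\<bar>" "\<bar>t - u\<bar> \<le> \<bar>s - u\<bar> + \<bar>s - t\<bar>"
    by linarith+
  moreover have "\<bar>s - t\<bar> + \<bar>t - u\<bar> + \<bar>s - u\<bar> \<le> 4"
    using assms by (auto simp: abs_if)
  ultimately show ?thesis unfolding arc_dist_def by linarith
qed

definition angle :: "complex \<Rightarrow> real" where
  "angle z = Arg2pi z / pi"

lemma angle_range: "angle z \<in> {0..<2}"
  using Arg2pi_ge_0[of z] Arg2pi_lt_2pi[of z] by (simp add: angle_def field_simps)

lemma cis_angle: "z \<in> circle \<Longrightarrow> cis (pi * angle z) = z"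
  using Arg2pi_eq[of z] by (simp add: angle_def cis_conv_exp)

lemma angle_cis:
  assumes "t \<in> {0..<2}" shows "angle (cis (pi * t)) = t"
proof -
  have "Arg2pi (cis (pi * t)) = pi * t"
    using assms by (intro Arg2pi_unique[of 1]) (auto simp: cis_conv_exp)
  then show ?thesis by (simp add: angle_def)
qed

text \<open>The value -1 is treated apart because \<open>Arg\<close> takes values above
  \<open>- pi\<close>.\<close>

lemma Arg_cis_abs:
  assumes "\<bar>u\<bar> \<le> 1" shows "\<bar>Arg (cis (pi * u))\<bar> = pi * \<bar>u\<bar>"
proof (cases "u = -1")
  case True
  then have "cis (pi * u) = cis pi" by (simp add: complex_eq_iff)
  moreover have "Arg (cis pi) = pi" by (rule Arg_cis) auto
  ultimately show ?thesis using True by simp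
next
  case False
  then have "-1 < u" "u \<le> 1" using assms by auto
  then have "pi * (-1) < pi * u" "pi * u \<le> pi * 1"
    by (intro mult_strict_left_mono mult_left_mono; simp)+
  then have "Arg (cis (pi * u)) = pi * u" by (intro Arg_cis) auto
  then show ?thesis by (simp add: abs_mult)
qed

lemma circle_dist_arc:
  assumes "z \<in> circle" "w \<in> circle"
  shows "circle_dist z w = arc_dist (angle z) (angle w)"
proof -
  define u where "u = angle w - angle z"
  have "w / z = cis (pi * angle w) / cis (pi * angle z)" using cis_angle assms by simp
  also have "\<dots> = cis (pi * u)" by (simp add: cis_divide u_def algebra_simps)
  finally have wz: "w / z = cis (pi * u)" .
  have u: "\<bar>u\<bar> < 2" using angle_range[of z] angle_range[of w] by (auto simp: u_def)
  have "\<bar>Arg (cis (pi * u))\<bar> = pi * min \<bar>u\<bar> (2 - \<bar>u\<bar>)"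
  proof -
    consider "\<bar>u\<bar> \<le> 1" | "1 < u" | "u < -1" by linarith
    then show ?thesis
    proof cases
      case 1
      then show ?thesis using Arg_cis_abs[OF 1] by (simp add: min_def)
    next
      case 2
      have "cis (pi * u) = cis (pi * (u - 2))"
        by (rule complex_eqI) (simp_all add: right_diff_distrib cos_diff sin_diff mult.commute[of pi 2])
      then show ?thesis using Arg_cis_abs[of "u - 2"] 2 u by (simp add: min_def)
    next
      case 3
      have "cis (pi * u) = cis (pi * (u + 2))"
        by (rule complex_eqI) (simp_all add: distrib_left cos_add sin_add mult.commute[of pi 2])
      then show ?thesis using Arg_cis_abs[of "u + 2"] 3 u by (simp add: min_def)
    qed
  qed
  then show ?thesis by (simp add: circle_dist_def wz arc_dist_def u_def abs_minus_commute)
qed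

lemma Metric_space_circle: "Metric_space circle circle_dist"
proof
  show "0 \<le> circle_dist x y" for x y by (simp add: circle_dist_def)
  show "circle_dist x y = circle_dist y x" for x y
    using Arg_inverse[of "y / x"] by (simp add: circle_dist_def)
  show "circle_dist x y = 0 \<longleftrightarrow> x = y" if "x \<in> circle" "y \<in> circle" for x y
    using that arc_dist_eq_0[OF angle_range angle_range, of x y] cis_angle circle_dist_arc by metis
  show "circle_dist x z \<le> circle_dist x y + circle_dist y z"
    if "x \<in> circle" "y \<in> circle" "z \<in> circle" for x y z
    using that arc_dist_triangle[OF angle_range angle_range angle_range, of x z y]
    by (simp add: circle_dist_arc)
qed

lemma finite_gaps:
  fixes A :: "real set"
  assumes "finite A" "A \<noteq> {}" "\<And>a b. a \<in> A \<Longrightarrow> b \<in> A \<Longrightarrow> a < b \<Longrightarrow> \<delta> < b - a"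
  shows "(real (card A) - 1) * \<delta> \<le> Max A - Min A"
  using assms
proof (induction A rule: finite_linorder_max_induct)
  case (insert b A)
  show ?case
  proof (cases "A = {}")
    case False
    have IH: "(real (card A) - 1) * \<delta> \<le> Max A - Min A" using insert False by auto
    have mem: "Max A \<in> A" "Min A \<in> A" using insert(1) False by auto
    have lt: "Max A < b" "Min A < b" using mem insert(2) by auto
    have "Max (insert b A) = b"
      by (rule trans[OF Max_insert[OF insert(1) False] max_absorb1[OF less_imp_le[OF lt(1)]]])
    moreover have "Min (insert b A) = Min A"
      by (rule trans[OF Min_insert[OF insert(1) False] min_absorb2[OF less_imp_le[OF lt(2)]]])
    moreover have "b \<notin> A" using insert(2) by auto
    moreover have "\<delta> < b - Max A" using insert.prems(2)[of "Max A" b] lt mem by auto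
    ultimately show ?thesis using insert(1) IH by (simp add: algebra_simps)
  qed simp
qed simp

text \<open>The gaps between consecutive points and the gap across 0 add up to 2. At least two
  points are required, since separation says nothing about one.\<close>

lemma arc_dist_packing:
  assumes "finite A" "2 \<le> card A" "A \<subseteq> {0..<2}"
    and sep: "\<And>a b. a \<in> A \<Longrightarrow> b \<in> A \<Longrightarrow> a \<noteq> b \<Longrightarrow> \<delta> < arc_dist a b"
  shows "real (card A) * \<delta> < 2"
proof -
  have ne: "A \<noteq> {}" using assms(2) by auto
  have M: "Max A \<in> A" "Min A \<in> A" using assms(1) ne by auto
  have "Min A \<noteq> Max A"
  proof
    assume eq: "Min A = Max A"
    have "A \<subseteq> {Max A}"
    proof
      fix x assume x: "x \<in> A"
      show "x \<in> {Max A}" using Max_ge[OF assms(1) x] Min_le[OF assms(1) x] eq by simp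
    qed
    then have "card A \<le> 1" using card_mono[of "{Max A}" A] by simp
    then show False using assms(2) by simp
  qed
  then have "\<delta> < 2 - (Max A - Min A)" using sep[OF M(2,1)] by (simp add: arc_dist_def abs_if split: if_splits)
  moreover have "(real (card A) - 1) * \<delta> \<le> Max A - Min A"
  proof (rule finite_gaps[OF assms(1) ne])
    fix a b assume "a \<in> A" "b \<in> A" "a < b"
    then show "\<delta> < b - a" using sep[of a b] by (simp add: arc_dist_def)
  qed
  ultimately show ?thesis by (simp add: algebra_simps)
qed

lemma arc_dist_equidistant:
  assumes "i < K" "j < K" "i \<noteq> j"
  shows "2 / real K \<le> arc_dist (2 * real i / real K) (2 * real j / real K)"
proof -
  have K: "0 < real K" using assms by simp
  define x where "x = \<bar>real i - real j\<bar>"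
  have x: "1 \<le> x" "x \<le> real K - 1" using assms by (auto simp: x_def)
  have "2 * real i / real K - 2 * real j / real K = 2 * (real i - real j) / real K"
    by (simp only: diff_divide_distrib right_diff_distrib)
  then have "\<bar>2 * real i / real K - 2 * real j / real K\<bar> = \<bar>2 * (real i - real j) / real K\<bar>"
    by (simp only:)
  also have "\<dots> = 2 * x / real K" by (simp only: abs_divide abs_mult abs_numeral abs_of_nat x_def)
  finally have "\<bar>2 * real i / real K - 2 * real j / real K\<bar> = 2 * x / real K" .
  moreover have "2 / real K \<le> 2 * x / real K" using x K by (intro divide_right_mono) auto
  moreover have "2 * x / real K \<le> (2 * real K - 2) / real K" using x K by (intro divide_right_mono) auto
  moreover have "(2 * real K - 2) / real K = 2 - 2 / real K" using K by (simp add: diff_divide_distrib)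
  ultimately show ?thesis by (simp add: arc_dist_def)
qed

section \<open>Entropy of spaces close to the circle\<close>

lemma entropy_least:
  assumes "\<forall>S\<subseteq>M. card S = N + 1 \<longrightarrow> (\<exists>x\<in>S. \<exists>y\<in>S. x \<noteq> y \<and> d x y \<le> \<epsilon>)"
  shows "entropy \<epsilon> M d \<le> N"
  unfolding entropy_def using assms by (rule Least_le)

text \<open>\<open>ex\<close> supplies a candidate for the \<open>LEAST\<close> in
  \<open>entropy\<close>, whose value would otherwise be unspecified.\<close>

lemma card_separated_le_entropy:
  assumes ex: "\<forall>S\<subseteq>M. card S = N + 1 \<longrightarrow> (\<exists>x\<in>S. \<exists>y\<in>S. x \<noteq> y \<and> d x y \<le> \<epsilon>)"
    and S: "S \<subseteq> M" "\<And>x y. x \<in> S \<Longrightarrow> y \<in> S \<Longrightarrow> x \<noteq> y \<Longrightarrow> \<epsilon> < d x y"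
  shows "card S \<le> entropy \<epsilon> M d"
proof (rule ccontr)
  assume "\<not> card S \<le> entropy \<epsilon> M d"
  then have "entropy \<epsilon> M d + 1 \<le> card S" by simp
  then obtain T where T: "T \<subseteq> S" "card T = entropy \<epsilon> M d + 1"
    by (rule obtain_subset_with_card_n)
  have close: "\<forall>S\<subseteq>M. card S = entropy \<epsilon> M d + 1 \<longrightarrow> (\<exists>x\<in>S. \<exists>y\<in>S. x \<noteq> y \<and> d x y \<le> \<epsilon>)"
    unfolding entropy_def using ex by (rule LeastI)
  have "T \<subseteq> M" using T(1) S(1) by (rule subset_trans)
  then have "\<exists>x\<in>T. \<exists>y\<in>T. x \<noteq> y \<and> d x y \<le> \<epsilon>" using close T(2) by simp
  then obtain x y where xy: "x \<in> T" "y \<in> T" "x \<noteq> y" "d x y \<le> \<epsilon>" by blast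
  have "\<epsilon> < d x y" using T(1) xy by (intro S(2)) auto
  then show False using xy(4) by simp
qed

text \<open>An approximate isometry to the circle, given by its parameter \<open>s\<close>. The
  circle itself is the instance with \<open>\<tau>\<close> = 0, so its entropy comes from the same
  lemmas.\<close>

locale circle_approx =
  fixes M :: "'a set" and \<rho> :: "'a \<Rightarrow> 'a \<Rightarrow> real" and s :: "'a \<Rightarrow> real" and \<tau> :: real
  assumes s_range: "x \<in> M \<Longrightarrow> s x \<in> {0..<2}"
    and distort: "x \<in> M \<Longrightarrow> y \<in> M \<Longrightarrow> \<bar>\<rho> x y - arc_dist (s x) (s y)\<bar> \<le> \<tau>"
    and dense: "t \<in> {0..<2} \<Longrightarrow> \<exists>x\<in>M. arc_dist (s x) t \<le> \<tau>"
    and rho_le_1: "x \<in> M \<Longrightarrow> y \<in> M \<Longrightarrow> \<rho> x y \<le> 1"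
begin

text \<open>Points more than \<open>\<epsilon>\<close> apart have parameters more than
  \<open>\<epsilon> - \<tau>\<close> apart, and the packing bound limits their number.\<close>

lemma close_pair:
  assumes N: "1 \<le> N" "\<tau> < \<epsilon>" "2 \<le> (real N + 1) * (\<epsilon> - \<tau>)"
  shows "\<forall>S\<subseteq>M. card S = N + 1 \<longrightarrow> (\<exists>x\<in>S. \<exists>y\<in>S. x \<noteq> y \<and> \<rho> x y \<le> \<epsilon>)"
proof (intro allI impI, rule ccontr)
  fix S assume S: "S \<subseteq> M" "card S = N + 1" and neg: "\<not> (\<exists>x\<in>S. \<exists>y\<in>S. x \<noteq> y \<and> \<rho> x y \<le> \<epsilon>)"
  have sep: "\<epsilon> - \<tau> < arc_dist (s x) (s y)" if xy: "x \<in> S" "y \<in> S" "x \<noteq> y" for x y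
  proof -
    have "\<epsilon> < \<rho> x y" using neg xy not_le by blast
    moreover have "\<bar>\<rho> x y - arc_dist (s x) (s y)\<bar> \<le> \<tau>" using distort xy S(1) by blast
    ultimately show ?thesis by linarith
  qed
  have inj: "inj_on s S"
  proof (rule inj_onI, rule ccontr)
    fix x y assume "x \<in> S" "y \<in> S" "s x = s y" "x \<noteq> y"
    then show False using sep[of x y] N(2) by simp
  qed
  have fin: "finite S" using S(2) by (intro card_ge_0_finite) simp
  have "real (card (s ` S)) * (\<epsilon> - \<tau>) < 2"
    using fin S N(1) card_image[OF inj] s_range sep by (intro arc_dist_packing) auto
  then show False using N(3) S(2) card_image[OF inj] by (simp add: add.commute)
qed

lemma entropy_le:
  assumes "1 \<le> N" "\<tau> < \<epsilon>" "2 \<le> (real N + 1) * (\<epsilon> - \<tau>)"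
  shows "entropy \<epsilon> M \<rho> \<le> N"
  using close_pair[OF assms] by (rule entropy_least)

lemma close_pair_exists:
  assumes "\<tau> < \<epsilon>"
  shows "\<exists>N. \<forall>S\<subseteq>M. card S = N + 1 \<longrightarrow> (\<exists>x\<in>S. \<exists>y\<in>S. x \<noteq> y \<and> \<rho> x y \<le> \<epsilon>)"
proof -
  obtain N :: nat where N: "2 / (\<epsilon> - \<tau>) < real N" using reals_Archimedean2 by blast
  then have "2 < real N * (\<epsilon> - \<tau>)" using assms by (simp add: pos_divide_less_eq)
  moreover have "real N * (\<epsilon> - \<tau>) \<le> (real (Suc N) + 1) * (\<epsilon> - \<tau>)"
    using assms by (intro mult_right_mono) auto
  ultimately have "2 \<le> (real (Suc N) + 1) * (\<epsilon> - \<tau>)" by linarith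
  then show ?thesis using close_pair[of "Suc N" \<epsilon>] assms by auto
qed

text \<open>Points are chosen near \<open>K\<close> equidistant parameters: two displacements and
  one distortion cost \<open>3 * \<tau>\<close>. A single point needs no separation.\<close>

lemma entropy_ge:
  assumes tau: "\<tau> < \<epsilon>" and K: "1 \<le> K" "K = 1 \<or> \<epsilon> + 3 * \<tau> < 2 / real K"
  shows "K \<le> entropy \<epsilon> M \<rho>"
proof -
  obtain N where ex: "\<forall>S\<subseteq>M. card S = N + 1 \<longrightarrow> (\<exists>x\<in>S. \<exists>y\<in>S. x \<noteq> y \<and> \<rho> x y \<le> \<epsilon>)"
    using close_pair_exists[OF tau] by blast
  obtain x0 where x0: "x0 \<in> M" "arc_dist (s x0) 0 \<le> \<tau>" using dense[of 0] by auto
  have tau0: "0 \<le> \<tau>" using x0(2) arc_dist_nonneg[OF s_range[OF x0(1)], of 0] by simp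
  show ?thesis
  proof (cases "K = 1")
    case True
    then show ?thesis using card_separated_le_entropy[OF ex, of "{x0}"] x0(1) by simp
  next
    case False
    define t where "t j = 2 * real j / real K" for j
    have t: "t j \<in> {0..<2}" if "j < K" for j using that by (simp add: t_def field_simps)
    have "\<forall>j\<in>{..<K}. \<exists>x\<in>M. arc_dist (s x) (t j) \<le> \<tau>" using dense t by auto
    then obtain f where f: "\<And>j. j < K \<Longrightarrow> f j \<in> M \<and> arc_dist (s (f j)) (t j) \<le> \<tau>"
      by (metis lessThan_iff)
    have far: "\<epsilon> < \<rho> (f i) (f j)" if ij: "i < K" "j < K" "i \<noteq> j" for i j
    proof -
      have r: "s (f i) \<in> {0..<2}" "s (f j) \<in> {0..<2}" using f ij s_range by auto
      have "2 / real K \<le> arc_dist (t i) (t j)" unfolding t_def using ij by (rule arc_dist_equidistant)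
      moreover have "arc_dist (t i) (t j) \<le> arc_dist (t i) (s (f i)) + arc_dist (s (f i)) (t j)"
        by (rule arc_dist_triangle[OF t[OF ij(1)] r(1) t[OF ij(2)]])
      moreover have "arc_dist (s (f i)) (t j) \<le> arc_dist (s (f i)) (s (f j)) + arc_dist (s (f j)) (t j)"
        by (rule arc_dist_triangle[OF r t[OF ij(2)]])
      moreover have "\<bar>\<rho> (f i) (f j) - arc_dist (s (f i)) (s (f j))\<bar> \<le> \<tau>" using distort f ij by blast
      ultimately show ?thesis using f[OF ij(1)] f[OF ij(2)] arc_dist_sym[of "t i" "s (f i)"] K(2) False by linarith
    qed
    have inj: "inj_on f {..<K}"
    proof (rule inj_onI, rule ccontr)
      fix i j assume ij: "i \<in> {..<K}" "j \<in> {..<K}" "f i = f j" "i \<noteq> j"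
      have "\<rho> (f i) (f i) \<le> \<tau>" using distort[of "f i" "f i"] f ij(1) by fastforce
      then show False using far[of i j] ij tau by simp
    qed
    have "card (f ` {..<K}) \<le> entropy \<epsilon> M \<rho>"
      using f far by (intro card_separated_le_entropy[OF ex]) auto
    then show ?thesis using card_image[OF inj] by simp
  qed
qed

lemma entropy_eq_1:
  assumes "1 \<le> \<epsilon>" "\<tau> < \<epsilon>" shows "entropy \<epsilon> M \<rho> = 1"
proof -
  have "\<forall>S\<subseteq>M. card S = 1 + 1 \<longrightarrow> (\<exists>x\<in>S. \<exists>y\<in>S. x \<noteq> y \<and> \<rho> x y \<le> \<epsilon>)"
  proof (intro allI impI)
    fix S assume S: "S \<subseteq> M" "card S = 1 + 1"
    have "card S = 2" using S(2) by simp
    then obtain x y where "S = {x, y}" "x \<noteq> y" unfolding card_2_iff by blast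
    then show "\<exists>x\<in>S. \<exists>y\<in>S. x \<noteq> y \<and> \<rho> x y \<le> \<epsilon>" using rho_le_1[of x y] S(1) assms by auto
  qed
  then have "entropy \<epsilon> M \<rho> \<le> 1" by (rule entropy_least)
  moreover have "1 \<le> entropy \<epsilon> M \<rho>" using assms(2) by (rule entropy_ge) auto
  ultimately show ?thesis by simp
qed

end

lemma circle_approx_circle: "circle_approx circle circle_dist angle 0"
proof
  fix t :: real assume "t \<in> {0..<2}"
  then show "\<exists>x\<in>circle. arc_dist (angle x) t \<le> 0"
    by (intro bexI[of _ "cis (pi * t)"]) (simp_all add: angle_cis)
qed (simp_all add: circle_dist_arc arc_dist_le_1 angle_range[simplified])

section \<open>Gromov--Hausdorff distance from approximate isometries\<close>

lemma hausdorff_dist_nonneg: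
  assumes "finite A" "A \<noteq> {}" "B \<noteq> {}" "\<And>a b. 0 \<le> \<delta> a b"
  shows "0 \<le> hausdorff_dist \<delta> A B"
proof -
  obtain a where a: "a \<in> A" using assms by blast
  have "0 \<le> (INF b\<in>B. \<delta> a b)" using assms by (intro cINF_greatest) auto
  also have "\<dots> \<le> (SUP a\<in>A. INF b\<in>B. \<delta> a b)" using assms a by (intro cSUP_upper) auto
  finally show ?thesis by (simp add: hausdorff_dist_def)
qed

lemma hausdorff_dist_le:
  assumes "A \<noteq> {}" "B \<noteq> {}" and nonneg: "\<And>a b. 0 \<le> \<delta> a b"
    and A: "\<And>a. a \<in> A \<Longrightarrow> \<exists>b\<in>B. \<delta> a b \<le> c" and B: "\<And>b. b \<in> B \<Longrightarrow> \<exists>a\<in>A. \<delta> a b \<le> c"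
  shows "hausdorff_dist \<delta> A B \<le> c"
proof -
  have "(INF b\<in>B. \<delta> a b) \<le> c" if "a \<in> A" for a
    using A[OF that] nonneg by (meson bdd_belowI2 cINF_lower order_trans)
  moreover have "(INF a\<in>A. \<delta> a b) \<le> c" if "b \<in> B" for b
    using B[OF that] nonneg by (meson bdd_belowI2 cINF_lower order_trans)
  ultimately show ?thesis
    unfolding hausdorff_dist_def using assms(1,2) by (intro max.boundedI cSUP_least) auto
qed

text \<open>An approximate isometry F with distortion at most 2h and dense image: glue the two spaces
  by putting the points x and F x at distance h.\<close>

lemma GH_dist_le_of_approx:
  fixes M :: "'a set" and N :: "'b set"
  assumes M: "Metric_space M d" "finite M" "M \<noteq> {}" and N: "Metric_space N e"
    and F: "\<And>x. x \<in> M \<Longrightarrow> F x \<in> N" "0 < h"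
      "\<And>x y. x \<in> M \<Longrightarrow> y \<in> M \<Longrightarrow> \<bar>d x y - e (F x) (F y)\<bar> \<le> 2 * h"
      "\<And>w. w \<in> N \<Longrightarrow> \<exists>x\<in>M. e (F x) w \<le> h"
  shows "0 \<le> GH_dist M d N e" "GH_dist M d N e \<le> 2 * h"
proof -
  interpret M: Metric_space M d by (rule M(1))
  interpret N: Metric_space N e by (rule N)
  have Nne: "N \<noteq> {}" using F(1) M(3) by blast
  \<comment> \<open>The cheapest passage from \<open>x\<close> to \<open>w\<close> through some pair
    \<open>y\<close>, \<open>F y\<close>, before the crossing cost \<open>h\<close> is
    added.\<close>
  define q where "q x w = Min ((\<lambda>y. d x y + e (F y) w) ` M)" for x w
  have q_le: "q x w \<le> d x y + e (F y) w" if "y \<in> M" for x w y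
    unfolding q_def using M(2) that by (intro Min_le) auto
  have q_ex: "\<exists>y\<in>M. q x w = d x y + e (F y) w" for x w
  proof -
    have "q x w \<in> (\<lambda>y. d x y + e (F y) w) ` M"
      unfolding q_def using M(2,3) by (intro Min_in) auto
    then show ?thesis by auto
  qed
  have q_nonneg: "0 \<le> q x w" for x w using q_ex[of x w] by (metis M.nonneg N.nonneg add_nonneg_nonneg)
  define \<delta> where "\<delta> p p' = (case p of
      Inl x \<Rightarrow> (case p' of Inl y \<Rightarrow> d x y | Inr w \<Rightarrow> q x w + h)
    | Inr v \<Rightarrow> (case p' of Inl y \<Rightarrow> q y v + h | Inr w \<Rightarrow> e v w))" for p p' :: "'a + 'b"
  have \<delta>_simps [simp]: "\<delta> (Inl x) (Inl y) = d x y" "\<delta> (Inl x) (Inr w) = q x w + h"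
    "\<delta> (Inr w) (Inl x) = q x w + h" "\<delta> (Inr v) (Inr w) = e v w" for x y v w
    by (simp_all add: \<delta>_def)
  have \<delta>_nonneg: "0 \<le> \<delta> p p'" for p p'
    using q_nonneg F(2) by (cases p; cases p') (simp_all add: add_nonneg_nonneg less_imp_le)
  have q1: "q x w \<le> d x y + q y w" if "x \<in> M" "y \<in> M" for x y w
  proof -
    obtain z where "z \<in> M" "q y w = d y z + e (F z) w" using q_ex by blast
    then show ?thesis using q_le[of z x w] M.triangle[of x y z] that by linarith
  qed
  have q2: "q x w \<le> q x v + e v w" if "x \<in> M" "v \<in> N" "w \<in> N" for x v w
  proof -
    obtain z where z: "z \<in> M" "q x v = d x z + e (F z) v" using q_ex by blast
    then show ?thesis using q_le[of z x w] N.triangle[OF F(1)[OF z(1)] that(2,3)] by linarith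
  qed
  \<comment> \<open>A detour through the other space crosses twice and pays \<open>2 * h\<close>,
    all that the distortion could save.\<close>
  have q3: "d x y \<le> q x w + q y w + 2 * h" if "x \<in> M" "y \<in> M" "w \<in> N" for x y w
  proof -
    obtain z where z: "z \<in> M" "q x w = d x z + e (F z) w" using q_ex by blast
    obtain z' where z': "z' \<in> M" "q y w = d y z' + e (F z') w" using q_ex by blast
    have "d x y \<le> d x z + d z z' + d y z'"
      using M.triangle[OF that(1) z(1) that(2)] M.triangle[OF z(1) z'(1) that(2)] M.commute[of z' y] by linarith
    moreover have "d z z' \<le> e (F z) (F z') + 2 * h" using F(3)[OF z(1) z'(1)] by linarith
    moreover have "e (F z) (F z') \<le> e (F z) w + e (F z') w"
      using N.triangle[OF F(1)[OF z(1)] that(3) F(1)[OF z'(1)]] N.commute[of w "F z'"] by linarith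
    ultimately show ?thesis using z z' by linarith
  qed
  have q4: "e v w \<le> q x v + q x w + 2 * h" if "x \<in> M" "v \<in> N" "w \<in> N" for x v w
  proof -
    obtain z where z: "z \<in> M" "q x v = d x z + e (F z) v" using q_ex by blast
    obtain z' where z': "z' \<in> M" "q x w = d x z' + e (F z') w" using q_ex by blast
    have "e v w \<le> e (F z) v + e (F z) (F z') + e (F z') w"
      using N.triangle[OF that(2) F(1)[OF z(1)] that(3)] N.triangle[OF F(1)[OF z(1)] F(1)[OF z'(1)] that(3)]
        N.commute[of v "F z"] by linarith
    moreover have "e (F z) (F z') \<le> d z z' + 2 * h" using F(3)[OF z(1) z'(1)] by linarith
    moreover have "d z z' \<le> d x z + d x z'"
      using M.triangle[OF z(1) that(1) z'(1)] M.commute[of z x] by linarith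
    ultimately show ?thesis using z z' by linarith
  qed
  define Z where "Z = Inl ` M \<union> (Inr ` N :: ('a + 'b) set)"
  have "Metric_space Z \<delta>"
  proof
    fix p p' :: "'a + 'b"
    show "0 \<le> \<delta> p p'" by (rule \<delta>_nonneg)
    show "\<delta> p p' = \<delta> p' p" by (cases p; cases p') (simp_all add: M.commute N.commute)
    assume "p \<in> Z" "p' \<in> Z"
    moreover have "q x w + h \<noteq> 0" for x w using q_nonneg[of x w] F(2) by linarith
    ultimately show "\<delta> p p' = 0 \<longleftrightarrow> p = p'" by (auto simp: Z_def)
  next
    fix p p' p'' assume "p \<in> Z" "p' \<in> Z" "p'' \<in> Z"
    then show "\<delta> p p'' \<le> \<delta> p p' + \<delta> p' p''"
      using M.triangle N.triangle q1 q2 q3 q4 M.commute N.commute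
      by (auto simp: Z_def) (smt (verit))+
  qed
  moreover have "isometric_embedding M d Z \<delta> Inl" "isometric_embedding N e Z \<delta> Inr"
    by (auto simp: isometric_embedding_def Z_def)
  ultimately have mem: "hausdorff_dist \<delta> (Inl ` M) (Inr ` N) \<in>
      {hausdorff_dist \<delta> (f ` M) (g ` N) | (Z :: ('a + 'b) set) \<delta> f g.
        Metric_space Z \<delta> \<and> isometric_embedding M d Z \<delta> f \<and> isometric_embedding N e Z \<delta> g}"
    (is "_ \<in> ?H") by blast
  have nn: "0 \<le> r" if r: "r \<in> ?H" for r
  proof -
    obtain Z \<delta> f g where "r = hausdorff_dist \<delta> (f ` M) (g ` N)" "Metric_space (Z :: ('a + 'b) set) \<delta>"
      using r by blast
    then show ?thesis using M(2,3) Nne by (auto intro!: hausdorff_dist_nonneg simp: Metric_space.nonneg)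
  qed
  have "hausdorff_dist \<delta> (Inl ` M) (Inr ` N) \<le> 2 * h"
  proof (rule hausdorff_dist_le)
    fix a :: "'a + 'b" assume "a \<in> Inl ` M"
    then obtain x where x: "a = Inl x" "x \<in> M" by blast
    have "q x (F x) \<le> 0" using q_le[of x x "F x"] x(2) F(1) by simp
    then show "\<exists>b\<in>Inr ` N. \<delta> a b \<le> 2 * h" using x F(1,2) by (intro bexI[of _ "Inr (F x)"]) auto
  next
    fix b assume "b \<in> (Inr ` N :: ('a + 'b) set)"
    then obtain w where w: "b = Inr w" "w \<in> N" by blast
    obtain x where x: "x \<in> M" "e (F x) w \<le> h" using F(4)[OF w(2)] by blast
    have "q x w \<le> h" using q_le[of x x w] x by simp
    then show "\<exists>a\<in>Inl ` M. \<delta> a b \<le> 2 * h" using x w by (intro bexI[of _ "Inl x"]) auto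
  qed (use M(3) Nne \<delta>_nonneg in auto)
  moreover have "GH_dist M d N e \<le> hausdorff_dist \<delta> (Inl ` M) (Inr ` N)"
    unfolding GH_dist_def using mem nn by (intro cInf_lower bdd_belowI[of _ 0])
  ultimately show "GH_dist M d N e \<le> 2 * h" by linarith
  show "0 \<le> GH_dist M d N e"
    unfolding GH_dist_def
  proof (rule cInf_greatest)
    show "?H \<noteq> {}" using mem unfolding ex_in_conv[symmetric] by (rule exI)
    show "0 \<le> r" if "r \<in> ?H" for r using that by (rule nn)
  qed
qed

section \<open>Graphs\<close>

text \<open>The natural-number form of \<open>graph_dist\<close> that the locale of
  distance-transitive metrics takes.\<close>

definition hop_dist :: "'a pair_pre_digraph \<Rightarrow> 'a \<Rightarrow> 'a \<Rightarrow> nat" where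
  "hop_dist G u v = (LEAST n. \<exists>p. pre_digraph.awalk (with_proj G) u p v \<and> length p = n)"

lemma hop_dist_le:
  "pre_digraph.awalk (with_proj G) u p v \<Longrightarrow> hop_dist G u v \<le> length p"
  unfolding hop_dist_def by (rule Least_le) blast

lemma (in wf_digraph) awalk_cost_unit: "awalk_cost (\<lambda>_. 1) p = real (length p)"
  by (induction p) auto

lemma awalk_rev_path_symmetric:
  assumes "pair_graph G" "pre_digraph.awalk (with_proj G) u p v"
  shows "pre_digraph.awalk (with_proj G) v (rev_path p) u"
proof -
  interpret pair_graph G by (rule assms(1))
  show ?thesis using awalk_rev_path'[OF assms(2)] .
qed

lemma length_rev_path: "length (rev_path p) = length p"
  by (induction p) auto

lemma shortest_awalk:
  assumes G: "scaled_finite_graph G" and uv: "u \<in> pverts G" "v \<in> pverts G"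
  obtains p where "pre_digraph.awalk (with_proj G) u p v" "length p = hop_dist G u v"
    "graph_dist G u v = real (hop_dist G u v)"
proof -
  have pg: "pair_graph G" and con: "connected (with_proj G)"
    using G by (auto simp: scaled_finite_graph_def)
  interpret G: graph "with_proj G" using pg by (rule pair_graph.pair_graphD_graph)
  have "u \<rightarrow>\<^sup>*\<^bsub>mk_symmetric (with_proj G)\<^esub> v"
    using con uv by (auto simp: connected_def strongly_connected_def)
  then have "u \<rightarrow>\<^sup>*\<^bsub>with_proj G\<^esub> v"
    using G.reachable_mk_symmetric_eq[OF G.sym_arcs] by simp
  then obtain p where p: "G.apath u p v" "G.\<mu> (\<lambda>_. 1) u v = G.awalk_cost (\<lambda>_. 1) p"
    using G.min_cost_awalk[of u v "\<lambda>_. 1"] by auto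
  have aw: "G.awalk u p v" using p(1) by (simp add: G.apath_def)
  have "length p \<le> length q" if "G.awalk u q v" for q
    using G.min_cost_le_walk_cost[OF that, of "\<lambda>_. 1"] p(2) by (simp add: G.awalk_cost_unit)
  then have "hop_dist G u v = length p"
    unfolding hop_dist_def using aw by (intro Least_equality) auto
  moreover have "graph_dist G u v = real (length p)"
    using p(2) by (simp add: graph_dist_def G.awalk_cost_unit)
  ultimately show ?thesis using that[OF aw] by simp
qed

lemma graph_dist_hop_dist:
  assumes "scaled_finite_graph G" "u \<in> pverts G" "v \<in> pverts G"
  shows "graph_dist G u v = real (hop_dist G u v)"
  by (rule shortest_awalk[OF assms])

text \<open>Automorphisms carry walks to walks of equal length; the image graph is the graph itself,
  so walks can also be pulled back.\<close>

lemma hop_dist_automorphism: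
  assumes G: "scaled_finite_graph G" and \<phi>: "graph_automorphism G \<phi>"
  shows "bij_betw \<phi> (pverts G) (pverts G)"
    and "u \<in> pverts G \<Longrightarrow> v \<in> pverts G \<Longrightarrow> hop_dist G (\<phi> u) (\<phi> v) = hop_dist G u v"
proof -
  have pg: "pair_graph G" using G by (auto simp: scaled_finite_graph_def)
  interpret G: graph "with_proj G" using pg by (rule pair_graph.pair_graphD_graph)
  obtain hom where hom: "G.digraph_isomorphism hom" "app_iso hom (with_proj G) = with_proj G" "iso_verts hom = \<phi>"
    using \<phi> by (auto simp: graph_automorphism_def)
  have "iso_verts hom ` verts (with_proj G) = verts (with_proj G)"
    using arg_cong[OF hom(2), of verts] by simp
  then have im: "\<phi> ` pverts G = pverts G" by (simp add: hom(3))
  have "inj_on \<phi> (pverts G)" using hom(1) by (simp add: G.digraph_isomorphism_def hom(3))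
  then show "bij_betw \<phi> (pverts G) (pverts G)" using im by (simp add: bij_betw_def)
  assume uv: "u \<in> pverts G" "v \<in> pverts G"
  have uv': "\<phi> u \<in> pverts G" "\<phi> v \<in> pverts G" using uv im by auto
  obtain p where p: "G.awalk u p v" "length p = hop_dist G u v" using shortest_awalk[OF G uv] by blast
  have "G.awalk (\<phi> u) (map (iso_arcs hom) p) (\<phi> v)"
    using G.awalk_app_isoI[OF p(1) hom(1)] by (simp only: hom(2,3))
  from hop_dist_le[OF this] have le: "hop_dist G (\<phi> u) (\<phi> v) \<le> hop_dist G u v" using p(2) by simp
  obtain q where q: "G.awalk (\<phi> u) q (\<phi> v)" "length q = hop_dist G (\<phi> u) (\<phi> v)"
    using shortest_awalk[OF G uv'] by blast
  have q': "pre_digraph.awalk (app_iso hom (with_proj G)) (\<phi> u) q (\<phi> v)" using q(1) by (simp only: hom(2))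
  have inv: "iso_verts (G.inv_iso hom) (\<phi> w) = w" if "w \<in> pverts G" for w
    using G.iso_verts_inv_iso[OF hom(1), of w] that by (simp add: hom(3))
  have "G.awalk u (map (iso_arcs (G.inv_iso hom)) q) v"
    using G.awalk_app_isoD[OF q' hom(1)] uv by (simp add: inv)
  from hop_dist_le[OF this] have "hop_dist G u v \<le> hop_dist G (\<phi> u) (\<phi> v)" using q(2) by simp
  then show "hop_dist G (\<phi> u) (\<phi> v) = hop_dist G u v" using le by simp
qed

lemma distance_transitive_metric_hop_dist:
  assumes G: "scaled_finite_graph G" and dt: "distance_transitive G"
  shows "distance_transitive_metric (pverts G) (hop_dist G)"
proof -
  have pg: "pair_graph G" and c2: "2 \<le> card (pverts G)" using G by (auto simp: scaled_finite_graph_def)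
  interpret G: graph "with_proj G" using pg by (rule pair_graph.pair_graphD_graph)
  have zero: "hop_dist G x y = 0 \<longleftrightarrow> x = y" if xy: "x \<in> pverts G" "y \<in> pverts G" for x y
  proof
    assume h: "hop_dist G x y = 0"
    obtain p where "G.awalk x p y" "length p = hop_dist G x y" using shortest_awalk[OF G xy] by blast
    then show "x = y" using h by (simp add: G.awalk_Nil_iff)
  next
    assume "x = y"
    then have "G.awalk x [] y" using xy by (simp add: G.awalk_Nil_iff)
    from hop_dist_le[OF this] show "hop_dist G x y = 0" by simp
  qed
  have sym_le: "hop_dist G y x \<le> hop_dist G x y" if xy: "x \<in> pverts G" "y \<in> pverts G" for x y
  proof -
    obtain p where p: "G.awalk x p y" "length p = hop_dist G x y" using shortest_awalk[OF G xy] by blast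
    show ?thesis
      using hop_dist_le[OF awalk_rev_path_symmetric[OF pg p(1)]] p(2) by (simp add: length_rev_path)
  qed
  have tri: "hop_dist G x z \<le> hop_dist G x y + hop_dist G y z"
    if xyz: "x \<in> pverts G" "y \<in> pverts G" "z \<in> pverts G" for x y z
  proof -
    obtain p where p: "G.awalk x p y" "length p = hop_dist G x y" using shortest_awalk[OF G xyz(1,2)] by blast
    obtain q where q: "G.awalk y q z" "length q = hop_dist G y z" using shortest_awalk[OF G xyz(2,3)] by blast
    have "G.awalk x (p @ q) z" using p(1) q(1) by (rule G.awalk_appendI)
    then show ?thesis using hop_dist_le[of G x "p @ q" z] p(2) q(2) by simp
  qed
  show ?thesis
  proof
    show "finite (pverts G)" using G.finite_verts by simp
    show "pverts G \<noteq> {}" using c2 by auto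
    show "hop_dist G x y = 0 \<longleftrightarrow> x = y" if "x \<in> pverts G" "y \<in> pverts G" for x y by (rule zero[OF that])
    show "hop_dist G x y = hop_dist G y x" if "x \<in> pverts G" "y \<in> pverts G" for x y
      using sym_le[OF that] sym_le[OF that(2,1)] by simp
    show "hop_dist G x z \<le> hop_dist G x y + hop_dist G y z"
      if "x \<in> pverts G" "y \<in> pverts G" "z \<in> pverts G" for x y z by (rule tri[OF that])
    show "\<exists>z\<in>pverts G. hop_dist G x z = n \<and> hop_dist G z y = 1"
      if xy: "x \<in> pverts G" "y \<in> pverts G" and n: "hop_dist G x y = Suc n" for x y n
    proof -
      obtain p where p: "G.awalk x p y" "length p = Suc n" using shortest_awalk[OF G xy] n by auto
      obtain q e where qe: "p = q @ [e]" using p(2) by (cases p rule: rev_cases) auto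
      obtain w where w: "G.awalk x q w" "G.awalk w [e] y" using p(1) qe by auto
      have wV: "w \<in> pverts G" using G.awalk_last_in_verts[OF w(1)] by simp
      have "hop_dist G x w \<le> n" using hop_dist_le[OF w(1)] p(2) qe by simp
      moreover have "hop_dist G w y \<le> 1" using hop_dist_le[OF w(2)] by simp
      moreover have "Suc n \<le> hop_dist G x w + hop_dist G w y" using tri[OF xy(1) wV xy(2)] n by simp
      ultimately show ?thesis using wV by (intro bexI[of _ w]) auto
    qed
    show "\<exists>\<phi>. bij_betw \<phi> (pverts G) (pverts G) \<and>
        (\<forall>x\<in>pverts G. \<forall>y\<in>pverts G. hop_dist G (\<phi> x) (\<phi> y) = hop_dist G x y) \<and> \<phi> u = u' \<and> \<phi> v = v'"
      if V: "u \<in> pverts G" "v \<in> pverts G" "u' \<in> pverts G" "v' \<in> pverts G" and eq: "hop_dist G u v = hop_dist G u' v'"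
      for u v u' v'
    proof -
      have "graph_dist G u v = graph_dist G u' v'"
        using graph_dist_hop_dist[OF G V(1,2)] graph_dist_hop_dist[OF G V(3,4)] eq by simp
      then obtain \<phi> where \<phi>: "graph_automorphism G \<phi>" "\<phi> u = u'" "\<phi> v = v'"
        using dt V unfolding distance_transitive_def by blast
      then show ?thesis using hop_dist_automorphism[OF G \<phi>(1)] by (intro exI[of _ \<phi>]) simp
    qed
  qed
qed

lemma scaled_dist_hop_dist:
  assumes G: "scaled_finite_graph G" and dt: "distance_transitive G"
    and uv: "u \<in> pverts G" "v \<in> pverts G"
  shows "scaled_dist G u v =
    real (hop_dist G u v) / real (distance_transitive_metric.diam (pverts G) (hop_dist G))"
proof -
  interpret D: distance_transitive_metric "pverts G" "hop_dist G"
    by (rule distance_transitive_metric_hop_dist[OF G dt])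
  have gd: "graph_dist G x y = real (hop_dist G x y)" if "x \<in> pverts G" "y \<in> pverts G" for x y
    by (rule graph_dist_hop_dist[OF G that])
  let ?R = "{hop_dist G x y |x y. x \<in> pverts G \<and> y \<in> pverts G}"
  have "{graph_dist G u v |u v. u \<in> pverts G \<and> v \<in> pverts G}
      = (\<lambda>(u, v). graph_dist G u v) ` (pverts G \<times> pverts G)" by auto
  also have "\<dots> = (\<lambda>(u, v). real (hop_dist G u v)) ` (pverts G \<times> pverts G)"
    by (intro image_cong) (auto simp: gd)
  also have "\<dots> = real ` (\<lambda>(u, v). hop_dist G u v) ` (pverts G \<times> pverts G)"
    by (simp add: image_image case_prod_beta)
  also have "(\<lambda>(u, v). hop_dist G u v) ` (pverts G \<times> pverts G) = ?R" by auto
  finally have eq: "{graph_dist G u v |u v. u \<in> pverts G \<and> v \<in> pverts G} = real ` ?R" .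
  have "?R \<noteq> {}" using D.V_ne by blast
  then have "graph_diameter G = real D.diam"
    unfolding graph_diameter_def eq D.diam_def using D.finite_dists by (simp add: mono_Max_commute mono_def)
  then show ?thesis using gd uv by (simp add: scaled_dist_def)
qed

section \<open>Convergence\<close>

lemma no_larger_subset: "finite M \<Longrightarrow> \<forall>S\<subseteq>M. card S = card M + 1 \<longrightarrow> P S"
proof (intro allI impI)
  fix S assume "finite M" "S \<subseteq> M" "card S = card M + 1"
  then show "P S" using card_mono[of M S] by simp
qed

context circle_approx begin

text \<open>When 2/\<open>\<epsilon>\<close> is not an integer, its floor \<open>N\<close> satisfies
  strict inequalities, which absorb a small \<open>\<tau>\<close>.\<close>

lemma entropy_eq_floor:
  assumes N: "1 \<le> N" "real N * \<epsilon> < 2" "2 < (real N + 1) * \<epsilon>" "0 < \<epsilon>"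
    and tau: "\<tau> < \<epsilon>" "3 * \<tau> < 2 / real N - \<epsilon>" "(real N + 1) * \<tau> < (real N + 1) * \<epsilon> - 2"
  shows "entropy \<epsilon> M \<rho> = N"
  using entropy_le[of N \<epsilon>] entropy_ge[of \<epsilon> N] assms by (simp add: algebra_simps)

lemma GH_dist_bounds:
  assumes M: "finite M" "M \<noteq> {}" and tau: "0 < \<tau>"
    and metric: "\<And>x y. x \<in> M \<Longrightarrow> y \<in> M \<Longrightarrow> 0 \<le> \<rho> x y" "\<And>x y. x \<in> M \<Longrightarrow> y \<in> M \<Longrightarrow> \<rho> x y = \<rho> y x"
      "\<And>x y. x \<in> M \<Longrightarrow> y \<in> M \<Longrightarrow> \<rho> x y = 0 \<longleftrightarrow> x = y"
      "\<And>x y z. x \<in> M \<Longrightarrow> y \<in> M \<Longrightarrow> z \<in> M \<Longrightarrow> \<rho> x z \<le> \<rho> x y + \<rho> y z"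
  shows "0 \<le> GH_dist M \<rho> circle circle_dist" "GH_dist M \<rho> circle circle_dist \<le> 2 * \<tau>"
proof -
  \<comment> \<open>\<open>Metric_space\<close> demands nonnegativity and symmetry on the whole
    type, whereas \<open>\<rho>\<close> is controlled on \<open>M\<close> only;
    \<open>GH_dist\<close> sees only values on \<open>M\<close>.\<close>
  define \<rho>' where "\<rho>' x y = (if x \<in> M \<and> y \<in> M then \<rho> x y else 0)" for x y
  have eq: "GH_dist M \<rho> circle circle_dist = GH_dist M \<rho>' circle circle_dist"
    by (simp add: GH_dist_def isometric_embedding_def \<rho>'_def)
  have ms: "Metric_space M \<rho>'"
    using metric by unfold_locales (auto simp: \<rho>'_def)
  define F where "F x = cis (pi * s x)" for x
  have F: "F x \<in> circle" "angle (F x) = s x" if "x \<in> M" for x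
    using angle_cis[OF s_range[OF that]] by (simp_all add: F_def)
  have dist: "\<bar>\<rho>' x y - circle_dist (F x) (F y)\<bar> \<le> 2 * \<tau>" if "x \<in> M" "y \<in> M" for x y
    using distort[OF that] F that tau circle_dist_arc[of "F x" "F y"] by (simp add: \<rho>'_def)
  have dns: "\<exists>x\<in>M. circle_dist (F x) w \<le> \<tau>" if "w \<in> circle" for w
  proof -
    obtain x where x: "x \<in> M" "arc_dist (s x) (angle w) \<le> \<tau>" using dense[OF angle_range] by blast
    have "circle_dist (F x) w = arc_dist (s x) (angle w)"
      using circle_dist_arc[OF F(1)[OF x(1)] that] F(2)[OF x(1)] by simp
    then show ?thesis using x by (intro bexI[of _ x]) simp
  qed
  show "0 \<le> GH_dist M \<rho> circle circle_dist" "GH_dist M \<rho> circle circle_dist \<le> 2 * \<tau>"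
    unfolding eq
    by (rule GH_dist_le_of_approx[OF ms M Metric_space_circle F(1) tau dist dns]; assumption)+
qed

end

context distance_transitive_metric begin

text \<open>Balls of radius \<open>\<rho>\<close> about a maximal \<open>\<rho>\<close>-separated
  set cover \<open>V\<close>, and the entropy bounds the size of that set.\<close>

lemma volume_bound:
  assumes dist: "\<And>x y. x \<in> V \<Longrightarrow> y \<in> V \<Longrightarrow> sd x y = real (d x y) / real diam" and D: "0 < diam"
    and ent: "entropy (real \<rho> / real diam) V sd \<le> K"
  shows "card V \<le> K * ball_size \<rho>"
proof -
  define F where "F = {S. S \<subseteq> V \<and> (\<forall>x\<in>S. \<forall>y\<in>S. x \<noteq> y \<longrightarrow> \<rho> < d x y)}"
  have "finite F" unfolding F_def using finV by simp
  moreover have "{} \<in> F" by (simp add: F_def)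
  ultimately obtain S where S: "S \<in> F" and max: "\<And>T. T \<in> F \<Longrightarrow> S \<subseteq> T \<Longrightarrow> S = T"
    using finite_has_maximal[of F] by blast
  have SV: "S \<subseteq> V" using S by (simp add: F_def)
  have cover: "\<exists>x\<in>S. d x z \<le> \<rho>" if z: "z \<in> V" for z
  proof (rule ccontr)
    assume neg: "\<not> ?thesis"
    have "d z x = d x z" if "x \<in> S" for x using d_sym z that SV by auto
    then have "insert z S \<in> F" using S z neg by (simp add: F_def not_le)
    then have "z \<in> S" using max[of "insert z S"] by blast
    then show False using neg z by auto
  qed
  have "card V \<le> card (\<Union>x\<in>S. {z \<in> V. d x z \<le> \<rho>})"
  proof (rule card_mono)
    show "finite (\<Union>x\<in>S. {z \<in> V. d x z \<le> \<rho>})" using finV finite_subset[OF SV finV] by simp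
    show "V \<subseteq> (\<Union>x\<in>S. {z \<in> V. d x z \<le> \<rho>})" using cover by blast
  qed
  also have "\<dots> \<le> (\<Sum>x\<in>S. card {z \<in> V. d x z \<le> \<rho>})"
    using finite_subset[OF SV finV] by (rule card_UN_le)
  also have "\<dots> = (\<Sum>x\<in>S. ball_size \<rho>)" using card_ball SV by (intro sum.cong) auto
  also have "\<dots> = card S * ball_size \<rho>" by simp
  also have "card S \<le> K"
  proof -
    have "card S \<le> entropy (real \<rho> / real diam) V sd"
    proof (rule card_separated_le_entropy[OF no_larger_subset[OF finV] SV])
      fix x y assume xy: "x \<in> S" "y \<in> S" "x \<noteq> y"
      then have V: "x \<in> V" "y \<in> V" using SV by auto
      have "\<rho> < d x y" "sd x y = real (d x y) / real diam" using S xy dist[OF V] by (auto simp: F_def)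
      then show "real \<rho> / real diam < sd x y" using D by (simp add: divide_strict_right_mono)
    qed
    then show ?thesis using ent by simp
  qed
  finally show ?thesis by simp
qed

text \<open>At a resolution below the scaled edge length all vertices are separated. So bounded
  entropy and bounded diameter would bound the number of vertices.\<close>

lemma card_le_entropy:
  assumes dist: "\<And>x y. x \<in> V \<Longrightarrow> y \<in> V \<Longrightarrow> sd x y = real (d x y) / real diam" and D: "0 < diam" "diam \<le> T"
  shows "card V \<le> entropy (1 / (real T + 1)) V sd"
proof (rule card_separated_le_entropy[OF no_larger_subset[OF finV]])
  fix x y assume xy: "x \<in> V" "y \<in> V" "x \<noteq> y"
  have "1 \<le> d x y" using d_zero_iff[OF xy(1,2)] xy(3) by simp
  have "1 / (real T + 1) < 1 / real diam" using D by (intro divide_strict_left_mono) auto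
  also have "\<dots> \<le> real (d x y) / real diam" using \<open>1 \<le> d x y\<close> by (intro divide_right_mono) auto
  finally show "1 / (real T + 1) < sd x y" using dist xy by simp
qed simp

text \<open>Vertex k is placed at 2k/N. A scaled distance is m/\<open>diam\<close> instead of 2m/N;
  for odd N these differ, by at most 1/\<open>diam\<close>, which also bounds the spacing
  2/N.\<close>

lemma circle_approx_cycle:
  assumes dist: "\<And>x y. x \<in> V \<Longrightarrow> y \<in> V \<Longrightarrow> sd x y = real (d x y) / real diam"
    and deg: "sphere_size 1 \<le> 2" and D: "2 \<le> diam"
  shows "\<exists>s. circle_approx V sd s (1 / real diam)"
proof -
  obtain v N where N: "N = 2 * diam \<or> N = 2 * diam + 1" and bij: "bij_betw v {..<N} V"
    and dv: "\<forall>i j. i \<le> j \<longrightarrow> j < N \<longrightarrow> d (v i) (v j) = min (j - i) (N - (j - i))"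
    using cyclic_coordinates[OF deg D] by blast
  define k where "k x = inv_into {..<N} v x" for x
  define s where "s x = 2 * real (k x) / real N" for x
  have Npos: "0 < real N" "real diam \<le> real N / 2" "real N / 2 \<le> real diam + 1 / 2" using N D by auto
  have kx: "k x < N" "v (k x) = x" if "x \<in> V" for x
    using bij_betw_inv_into_right[OF bij that] bij_betw_apply[OF bij_betw_inv_into[OF bij] that]
    by (simp_all add: k_def)
  have kv: "k (v i) = i" if "i < N" for i
    using bij_betw_inv_into_left[OF bij, of i] that by (simp add: k_def)
  have ordered: "\<bar>sd x y - arc_dist (s x) (s y)\<bar> \<le> 1 / real diam"
    if xy: "x \<in> V" "y \<in> V" "k x \<le> k y" for x y
  proof -
    define j where "j = k y - k x"
    define m where "m = min j (N - j)"
    have jN: "j < N" using kx[OF xy(2)] by (simp add: j_def)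
    have sd: "sd x y = real m / real diam"
      using dv[rule_format, OF xy(3) kx(1)[OF xy(2)]] kx(2)[OF xy(1)] kx(2)[OF xy(2)] dist[OF xy(1,2)]
      by (simp add: m_def j_def)
    have "s y - s x = 2 * real j / real N"
      using xy(3) by (simp add: s_def j_def of_nat_diff diff_divide_distrib right_diff_distrib)
    then have "\<bar>s x - s y\<bar> = 2 * real j / real N" by (simp add: abs_minus_commute[of "s x"])
    moreover have "2 - 2 * real j / real N = 2 * real (N - j) / real N"
      using jN by (simp add: of_nat_diff field_simps)
    ultimately have "arc_dist (s x) (s y) = min (2 * real j / real N) (2 * real (N - j) / real N)"
      by (simp only: arc_dist_def)
    also have "\<dots> = 2 * real m / real N"
      using Npos(1) by (simp add: m_def min_def divide_le_cancel)
    finally have arc: "arc_dist (s x) (s y) = 2 * real m / real N" .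
    have mN: "real m \<le> real N / 2"
    proof -
      have "2 * m \<le> N" unfolding m_def using jN by linarith
      then have "2 * real m \<le> real N" by (metis of_nat_le_iff of_nat_mult of_nat_numeral)
      then show ?thesis by simp
    qed
    have "2 * real m / real N \<le> real m / real diam"
      using Npos D mult_left_mono[of "2 * real diam" "real N" "real m"] by (simp add: field_simps)
    moreover have "real m / real diam - 2 * real m / real N \<le> 1 / real diam"
    proof -
      have "real m / real diam - 2 * real m / real N = real m * (real N - 2 * real diam) / (real diam * real N)"
        using Npos D by (simp add: field_simps)
      also have "\<dots> \<le> real N * 1 / (real diam * real N)"
        using Npos mN D by (intro divide_right_mono mult_mono) auto
      finally show ?thesis using Npos by simp
    qed
    ultimately show ?thesis by (simp add: sd arc)
  qed
  have "circle_approx V sd s (1 / real diam)"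
  proof
    fix x y assume x: "x \<in> V"
    show "s x \<in> {0..<2}" using kx(1)[OF x] by (simp add: s_def field_simps)
    assume y: "y \<in> V"
    show "\<bar>sd x y - arc_dist (s x) (s y)\<bar> \<le> 1 / real diam"
    proof (cases "k x \<le> k y")
      case True
      then show ?thesis using ordered x y by simp
    next
      case False
      have "sd x y = sd y x" using dist x y d_sym[OF x y] by simp
      then show ?thesis using ordered[of y x] False x y arc_dist_sym[of "s x"] by simp
    qed
    show "sd x y \<le> 1" using dist x y d_le_diam[OF x y] D by (simp add: divide_le_eq_1)
  next
    fix t :: real assume t: "t \<in> {0..<2}"
    define y where "y = t * real N / 2"
    define i where "i = nat \<lfloor>y\<rfloor>"
    have y: "0 \<le> y" "y < real N" using t Npos(1) by (auto simp: y_def)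
    then have "real i \<le> y" "y < real i + 1" unfolding i_def by linarith+
    then have i: "real i \<le> t * real N / 2" "t * real N / 2 < real i + 1" by (simp_all add: y_def)
    have iN: "i < N" using \<open>real i \<le> y\<close> y(2) by linarith
    have "2 * real i / real N \<le> t" "t \<le> 2 * (real i + 1) / real N"
      using i Npos(1) by (simp_all add: field_simps)
    moreover have "2 * (real i + 1) / real N = 2 * real i / real N + 2 / real N"
      by (simp add: add_divide_distrib)
    ultimately have "\<bar>s (v i) - t\<bar> \<le> 2 / real N" using kv[OF iN] by (simp add: s_def)
    moreover have "2 / real N \<le> 1 / real diam" using Npos D by (simp add: field_simps)
    ultimately have "arc_dist (s (v i)) t \<le> 1 / real diam" by (simp add: arc_dist_def)
    then show "\<exists>x\<in>V. arc_dist (s x) t \<le> 1 / real diam"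
      using bij_betw_apply[OF bij, of i] iN by auto
  qed
  then show ?thesis by blast
qed

end

text \<open>The circle of diameter 1 has length 2, so the entropy is compared with
  2/\<open>\<epsilon>\<close>, not with 1/\<open>\<epsilon>\<close>. For
  \<open>\<epsilon> \<le> 1\<close> the entropy of the circle is the largest integer below
  2/\<open>\<epsilon>\<close>, or 1 if \<open>\<epsilon>\<close> = 1. It jumps at 2/k, and there
  convergence can fail: an odd cycle whose length is a multiple of k has k vertices at mutual
  distances above 2/k, the circle has no such k points. At these values the two-sided bound remains.
  The value \<open>\<epsilon>\<close> = 1 need not be excluded, as no distance exceeds 1.\<close>

theorem corollary1p6:
  fixes X :: "nat \<Rightarrow> 'a pair_pre_digraph"
  assumes "\<And>n. scaled_finite_graph (X n)"
    and "\<And>n. distance_transitive (X n)"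
    and "bounded_geometry (\<lambda>n. pverts (X n)) (\<lambda>n. scaled_dist (X n))"
    and "filterlim (\<lambda>n. card (pverts (X n))) at_top sequentially"
  shows "(\<lambda>n. GH_dist (pverts (X n)) (scaled_dist (X n)) circle circle_dist) \<longlonglongrightarrow> 0
    \<and> (\<forall>\<epsilon>>0. (\<forall>k::nat. k \<ge> 3 \<longrightarrow> \<epsilon> \<noteq> 2 / real k) \<longrightarrow>
         (\<lambda>n. real (entropy \<epsilon> (pverts (X n)) (scaled_dist (X n))))
           \<longlonglongrightarrow> real (entropy \<epsilon> circle circle_dist))
    \<and> (\<forall>\<epsilon>. 0 < \<epsilon> \<and> \<epsilon> \<le> 1 \<longrightarrow>
         (\<forall>\<^sub>F n in sequentially.
            2 / \<epsilon> - 1 \<le> real (entropy \<epsilon> (pverts (X n)) (scaled_dist (X n)))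
            \<and> real (entropy \<epsilon> (pverts (X n)) (scaled_dist (X n))) \<le> 2 / \<epsilon>))"
proof -
  let ?V = "\<lambda>n. pverts (X n)" and ?sd = "\<lambda>n. scaled_dist (X n)" and ?d = "\<lambda>n. hop_dist (X n)"
  define D where "D n = distance_transitive_metric.diam (?V n) (?d n)" for n
  have dtm: "distance_transitive_metric (?V n) (?d n)" for n
    by (rule distance_transitive_metric_hop_dist[OF assms(1,2)])
  have sd: "?sd n x y = real (?d n x y) / real (D n)" if "x \<in> ?V n" "y \<in> ?V n" for n x y
    unfolding D_def by (rule scaled_dist_hop_dist[OF assms(1,2) that])
  obtain E :: "real \<Rightarrow> nat" where E: "antimono_on {0<..} E" "\<And>n \<epsilon>. 0 < \<epsilon> \<Longrightarrow> entropy \<epsilon> (?V n) (?sd n) \<le> E \<epsilon>"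
    using assms(3) unfolding bounded_geometry_def by blast
  have Dpos: "0 < D n" for n
  proof -
    interpret distance_transitive_metric "?V n" "?d n" by (rule dtm)
    have "2 \<le> card (?V n)" using assms(1)[of n] by (simp add: scaled_finite_graph_def)
    then have "\<not> card (?V n) \<le> Suc 0" by simp
    then obtain x y where xy: "x \<in> ?V n" "y \<in> ?V n" "x \<noteq> y"
      using card_le_Suc0_iff_eq[OF finV] by blast
    then have "0 < ?d n x y" using d_zero_iff[OF xy(1,2)] by simp
    then show ?thesis using d_le_diam[OF xy(1,2)] by (simp add: D_def)
  qed
  have D_large: "\<forall>\<^sub>F n in sequentially. T \<le> D n" for T
  proof -
    have "\<forall>\<^sub>F n in sequentially. E (1 / (real T + 1)) + 1 \<le> card (?V n)"
      using assms(4) unfolding filterlim_at_top by blast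
    then show ?thesis
    proof eventually_elim
      case (elim n)
      interpret distance_transitive_metric "?V n" "?d n" by (rule dtm)
      show ?case
      proof (rule ccontr)
        assume "\<not> T \<le> D n"
        then have "card (?V n) \<le> entropy (1 / (real T + 1)) (?V n) (?sd n)"
          using sd[of _ n] Dpos[of n] by (intro card_le_entropy) (auto simp: D_def)
        also have "\<dots> \<le> E (1 / (real T + 1))" by (rule E(2)) simp
        finally show False using elim by simp
      qed
    qed
  qed
  obtain T where T: "\<forall>(V :: 'a set) d. distance_transitive_metric V d \<longrightarrow>
     T \<le> distance_transitive_metric.diam V d \<longrightarrow>
     (\<forall>\<rho>. distance_transitive_metric.diam V d \<le> 100 * \<rho> \<longrightarrow>
        card V \<le> E (1 / 100) * distance_transitive_metric.ball_size V d \<rho>) \<longrightarrow>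
     distance_transitive_metric.sphere_size V d 1 \<le> 2"
    using degree_le_two_of_large_diameter by blast
  have approx: "\<forall>\<^sub>F n in sequentially. \<exists>s. circle_approx (?V n) (?sd n) s (1 / real (D n))"
    using D_large[of "T + 2"]
  proof eventually_elim
    case (elim n)
    interpret distance_transitive_metric "?V n" "?d n" by (rule dtm)
    have "sphere_size 1 \<le> 2"
    proof (rule T[rule_format, OF dtm])
      show "T \<le> diam" using elim by (simp add: D_def)
      fix \<rho> assume "diam \<le> 100 * \<rho>"
      then have \<rho>: "D n \<le> 100 * \<rho>" by (simp add: D_def)
      have ge: "1 / 100 \<le> real \<rho> / real (D n)"
        using \<rho> Dpos[of n] by (simp add: field_simps flip: of_nat_le_iff)
      have pos: "0 < real \<rho> / real (D n)" using ge by linarith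
      \<comment> \<open>Monotonicity of \<open>E\<close> reduces all radii from diam/100 on to the
        single constant \<open>E (1 / 100)\<close>.\<close>
      have "E (real \<rho> / real (D n)) \<le> E (1 / 100)"
        by (rule monotone_onD[OF E(1) _ _ ge]) (use pos in simp_all)
      then have "entropy (real \<rho> / real (D n)) (?V n) (?sd n) \<le> E (1 / 100)"
        using E(2)[OF pos, of n] by simp
      then show "card (?V n) \<le> E (1 / 100) * ball_size \<rho>"
        using sd[of _ n] Dpos[of n] by (intro volume_bound) (auto simp: D_def)
    qed
    then show ?case
      using circle_approx_cycle[of "?sd n"] sd[of _ n] elim by (simp add: D_def)
  qed
  have D_lim: "filterlim (\<lambda>n. real (D n)) at_top sequentially"
    using D_large by (intro filterlim_compose[OF filterlim_real_sequentially]) (simp add: filterlim_at_top)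
  have tau_lim: "(\<lambda>n. c * (1 / real (D n))) \<longlonglongrightarrow> 0" for c
    using tendsto_mult_right_zero[OF tendsto_divide_0[OF tendsto_const filterlim_at_top_imp_at_infinity[OF D_lim]]] .
  have small: "\<forall>\<^sub>F n in sequentially. c * (1 / real (D n)) < \<delta>" if "0 < \<delta>" for c \<delta>
    using order_tendstoD(2)[OF tau_lim that] .
  interpret C: circle_approx circle circle_dist angle 0 by (rule circle_approx_circle)
  have "(\<lambda>n. GH_dist (?V n) (?sd n) circle circle_dist) \<longlonglongrightarrow> 0"
  proof (rule tendsto_sandwich[OF _ _ tendsto_const tau_lim[of 2]])
    have bounds: "0 \<le> GH_dist (?V n) (?sd n) circle circle_dist \<and>
        GH_dist (?V n) (?sd n) circle circle_dist \<le> 2 * (1 / real (D n))"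
      if s: "circle_approx (?V n) (?sd n) s (1 / real (D n))" for n s
    proof -
      interpret distance_transitive_metric "?V n" "?d n" by (rule dtm)
      interpret A: circle_approx "?V n" "?sd n" s "1 / real (D n)" by (rule s)
      have tri: "?sd n x z \<le> ?sd n x y + ?sd n y z" if "x \<in> ?V n" "y \<in> ?V n" "z \<in> ?V n" for x y z
        using d_tri[OF that] Dpos[of n] sd that by (simp add: divide_right_mono flip: add_divide_distrib of_nat_add)
      have zero: "?sd n x y = 0 \<longleftrightarrow> x = y" if "x \<in> ?V n" "y \<in> ?V n" for x y
        using d_zero_iff[OF that] sd[OF that] Dpos[of n] by simp
      show ?thesis
        using A.GH_dist_bounds[OF finV V_ne _ _ _ zero tri] Dpos[of n] sd d_sym by simp
    qed
    show "\<forall>\<^sub>F n in sequentially. 0 \<le> GH_dist (?V n) (?sd n) circle circle_dist"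
      "\<forall>\<^sub>F n in sequentially. GH_dist (?V n) (?sd n) circle circle_dist \<le> 2 * (1 / real (D n))"
      using approx by (eventually_elim; use bounds in blast)+
  qed
  moreover have "(\<lambda>n. real (entropy \<epsilon> (?V n) (?sd n))) \<longlonglongrightarrow> real (entropy \<epsilon> circle circle_dist)"
    if \<epsilon>: "0 < \<epsilon>" and ne: "\<forall>k::nat. k \<ge> 3 \<longrightarrow> \<epsilon> \<noteq> 2 / real k" for \<epsilon>
  proof -
    have "\<forall>\<^sub>F n in sequentially. entropy \<epsilon> (?V n) (?sd n) = entropy \<epsilon> circle circle_dist"
    proof (cases "1 \<le> \<epsilon>")
      case True
      show ?thesis using approx small[OF \<epsilon>, of 1]
      proof eventually_elim
        case (elim n)
        then obtain s where "circle_approx (?V n) (?sd n) s (1 / real (D n))" by blast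
        then show ?case using circle_approx.entropy_eq_1[OF _ True] C.entropy_eq_1[OF True] elim \<epsilon> by simp
      qed
    next
      case False
      \<comment> \<open>By \<open>ne\<close> and since 2/\<open>\<epsilon>\<close> exceeds 2, the
        floor is not attained and both inequalities for \<open>N\<close> are strict.\<close>
      define N where "N = nat \<lfloor>2 / \<epsilon>\<rfloor>"
      have ge2: "2 < 2 / \<epsilon>" using False \<epsilon> by (simp add: field_simps)
      have N2: "2 \<le> N" using ge2 unfolding N_def by linarith
      have Nb: "real N \<le> 2 / \<epsilon>" "2 / \<epsilon> < real N + 1" using ge2 unfolding N_def by linarith+
      have "real N \<noteq> 2 / \<epsilon>"
      proof
        assume eq: "real N = 2 / \<epsilon>"
        have "\<epsilon> = 2 / real N" unfolding eq by simp
        moreover have "3 \<le> N" using eq ge2 by linarith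
        ultimately show False using ne by blast
      qed
      then have N: "1 \<le> N" "real N * \<epsilon> < 2" "2 < (real N + 1) * \<epsilon>"
        using N2 Nb \<epsilon> by (auto simp: field_simps)
      have pos: "0 < 2 / real N - \<epsilon>" "0 < (real N + 1) * \<epsilon> - 2" using N by (auto simp: field_simps)
      have C: "entropy \<epsilon> circle circle_dist = N"
        using C.entropy_eq_floor[OF N \<epsilon>] pos \<epsilon> by simp
      show ?thesis using approx small[OF \<epsilon>, of 1] small[OF pos(1), of 3] small[OF pos(2), of "real N + 1"]
      proof eventually_elim
        case (elim n)
        then obtain s where s: "circle_approx (?V n) (?sd n) s (1 / real (D n))" by blast
        have "entropy \<epsilon> (?V n) (?sd n) = N"
          using elim by (intro circle_approx.entropy_eq_floor[OF s N \<epsilon>]) simp_all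
        then show ?case using C by simp
      qed
    qed
    then show ?thesis by (intro tendsto_eventually) (auto elim: eventually_mono)
  qed
  moreover have "\<forall>\<^sub>F n in sequentially. 2 / \<epsilon> - 1 \<le> real (entropy \<epsilon> (?V n) (?sd n))
      \<and> real (entropy \<epsilon> (?V n) (?sd n)) \<le> 2 / \<epsilon>" if \<epsilon>: "0 < \<epsilon>" "\<epsilon> \<le> 1" for \<epsilon>
  proof -
    have ge2: "2 \<le> 2 / \<epsilon>" using \<epsilon> by (simp add: field_simps)
    define N where "N = nat \<lfloor>2 / \<epsilon>\<rfloor>"
    \<comment> \<open>The largest integer strictly below 2/\<open>\<epsilon>\<close>; it differs
      from \<open>N\<close> exactly when 2/\<open>\<epsilon>\<close> is an integer.\<close>
    define K where "K = nat (\<lceil>2 / \<epsilon>\<rceil> - 1)"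
    have N: "1 \<le> N" "real N \<le> 2 / \<epsilon>" "2 / \<epsilon> < real N + 1" using ge2 unfolding N_def by linarith+
    have K: "1 \<le> K" "2 / \<epsilon> - 1 \<le> real K" "real K < 2 / \<epsilon>" using ge2 unfolding K_def by linarith+
    have pos: "0 < 2 / real K - \<epsilon>" "0 < (real N + 1) * \<epsilon> - 2" using N K \<epsilon> by (auto simp: field_simps)
    show ?thesis using approx small[OF \<epsilon>(1), of 1] small[OF pos(1), of 3] small[OF pos(2), of "real N + 1"]
    proof eventually_elim
      case (elim n)
      then obtain s where "circle_approx (?V n) (?sd n) s (1 / real (D n))" by blast
      then interpret A: circle_approx "?V n" "?sd n" s "1 / real (D n)" .
      have "K \<le> entropy \<epsilon> (?V n) (?sd n)" using elim K(1) by (intro A.entropy_ge) auto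
      moreover have "entropy \<epsilon> (?V n) (?sd n) \<le> N"
        using elim N(1) by (intro A.entropy_le) (auto simp: right_diff_distrib)
      ultimately have "real K \<le> real (entropy \<epsilon> (?V n) (?sd n))" "real (entropy \<epsilon> (?V n) (?sd n)) \<le> real N"
        by simp_all
      then show ?case using K(2) N(2) by linarith
    qed
  qed
  ultimately show ?thesis by blast
qed

end
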